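(* Let $X_d=\otimes_{j=1}^dX_{1,j}$, $(a_d)$ a real sequence and $(b_d)$ a positive sequence with $b_d\to\infty$. Let $G$ be a self-decomposable distribution function with Lévy triplet $(\gamma,\sigma^2,L)$ where $L(x)=0$ for $x<0$, and let $q:(0,1)\to\mathbb R$ be non-increasing with $q(\varepsilon)=G^{-1}(1-\varepsilon^2)$ for all $\varepsilon\in(0,1)$. Assume $$\lim_{d\to\infty}\max_{j=1,\dots,d}\sum_{k=1}^\infty\bar\lambda^{X_{1,j}}_k\,\mathbf 1\bigl(\bar\lambda^{X_{1,j}}_k<e^{-\tau b_d}\bigr)=0\quad\text{for all }\tau>0.$$ Let $N$ be either $\infty$ or a natural number with $\sum_{j=1}^\infty\sum_{k=N+1}^\infty\bar\lambda^{X_{1,j}}_k<\infty$, and set $M^{X_{1,j}}_{p,N}(x)=\sum_{k=1}^N|\ln\bar\lambda^{X_{1,j}}_k|^p\,\bar\lambda^{X_{1,j}}_k\,\mathbf 1(\bar\lambda^{X_{1,j}}_k\ge e^{-x})$, $x\ge0$, $p\in\{1,2\}$. Then $$\ln n^{X_d}(\varepsilon)=a_d+q(\varepsilon)b_d+o(b_d),\quad d\to\infty,\quad\text{for all }\varepsilon\in(0,1)$$ holds if and only if all of the following hold: (A) $\lim_{d\to\infty}\sum_{j=1}^d\sum_{k=1}^N\bar\lambda^{X_{1,j}}_k\mathbf 1(\bar\lambda^{X_{1,j}}_k<e^{-xb_d})=-L(x)$ for all $x>0$; (B) $\lim_{d\to\infty}\frac1{b_d}\bigl(\sum_{j=1}^dM^{X_{1,j}}_{1,N}(\tau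 b_d)-a_d\bigr)=\gamma+\int_0^\tau\frac{x^3\,dL(x)}{1+x^2}-\int_\tau^\infty\frac{x\,dL(x)}{1+x^2}$ for all $\tau>0$; (C) $\lim_{\tau\to0}\limsup_{d\to\infty}\frac1{b_d^2}\sum_{j=1}^d\bigl(M^{X_{1,j}}_{2,N}(\tau b_d)-(M^{X_{1,j}}_{1,N}(\tau b_d))^2\bigr)=\lim_{\tau\to0}\liminf_{d\to\infty}\frac1{b_d^2}\sum_{j=1}^d\bigl(M^{X_{1,j}}_{2,N}(\tau b_d)-(M^{X_{1,j}}_{1,N}(\tau b_d))^2\bigr)=\sigma^2$.
   Context: For a centered Hilbert-space random element $Z$ with finite second moment, $\lambda^Z_1\ge\lambda^Z_2\ge\dots\ge 0$ denote the eigenvalues of its covariance operator $K^Z$ with multiplicity (padded with zeros), $\Lambda^Z=\sum_k\lambda^Z_k$, $\bar\lambda^Z_k=\lambda^Z_k/\Lambda^Z$. Let $X_{1,j}$ be centered random elements of separable Hilbert spaces $H_{1,j}$ with $\mathbb E\|X_{1,j}\|^2<\infty$ and $\lambda^{X_{1,j}}_1>0$; $X_d=\otimes_{j=1}^dX_{1,j}$ means $X_d$ is a centered random element of $H_d=\otimes_{j=1}^dH_{1,j}$ with covariance operator $\otimes_{j=1}^dK^{X_{1,j}}$ (eigenvalues $\prod_j\lambda^{X_{1,j}}_{k_j}$). The complexity is $n^{X_d}(\varepsilon)=\min\{n\in\mathbb N:\sum_{k>n}\bar\lambda^{X_d}_k\le\varepsilon^2\}$, equivalently the minimal rank $n$ of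 a linear approximation $\sum_{m=1}^nl_m(X_d)\psi_m$ ($l_m\in H_d^*$, $\psi_m\in H_d$) with $\mathbb E\|X_d-\sum l_m(X_d)\psi_m\|^2\le\varepsilon^2\mathbb E\|X_d\|^2$. $f^{-1}(y)=\inf\{x:f(x)\ge y\}$. A distribution function $F$ is self-decomposable if for every $\alpha>1$ there is a distribution function $F_\alpha$ with $F(x)=\int F_\alpha(x-y)\,dF(\alpha y)$. Its characteristic function then has the Lévy representation $f(t)=\exp\{i\gamma t-\sigma^2t^2/2+\int_{|x|>0}(e^{itx}-1-\frac{itx}{1+x^2})\,dL(x)\}$; $(\gamma,\sigma^2,L)$ is its Lévy triplet, with $L$ non-decreasing on $(-\infty,0)$ and $(0,\infty)$, $L(\pm\infty)=0$, $\int_{0<|x|<\tau}x^2dL<\infty$. *)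

theory Defs
  imports "HOL-Probability.Probability" "HOL-Library.Landau_Symbols" "HOL-Library.Extended_Nat"
begin

definition gen_inv :: "(real \<Rightarrow> real) \<Rightarrow> real \<Rightarrow> real" where
  "gen_inv f y = Inf {x. f x \<ge> y}"

(* Self-decomposability of the distribution function F = cdf M:
   for every alpha > 1 there is a distribution function F_alpha = cdf K with
   F(x) = int F_alpha(x - y) dF(alpha y); the measure dF(alpha y) is the law of Y/alpha, Y ~ M. *)
definition self_decomposable :: "real measure \<Rightarrow> bool" where
  "self_decomposable M \<longleftrightarrow> real_distribution M \<and>
     (\<forall>\<alpha>>1. \<exists>K. real_distribution K \<and>
        (\<forall>x. cdf M x = (\<integral>y. cdf K (x - y) \<partial>(distr M borel (\<lambda>y. y / \<alpha>)))))"

(* nu is the Lebesgue-Stieltjes measure dL of L on (0,infinity) (L vanishes on (-infinity,0)) *)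
definition stieltjes_pos :: "(real \<Rightarrow> real) \<Rightarrow> real measure \<Rightarrow> bool" where
  "stieltjes_pos L \<nu> \<longleftrightarrow> sets \<nu> = sets borel \<and> emeasure \<nu> {..0} = 0 \<and>
     (\<forall>a b. 0 < a \<longrightarrow> a \<le> b \<longrightarrow> emeasure \<nu> {a<..b} = ennreal (L b - L a))"

definition levy_triplet :: "real measure \<Rightarrow> real \<Rightarrow> real \<Rightarrow> (real \<Rightarrow> real) \<Rightarrow> real measure \<Rightarrow> bool" where
  "levy_triplet M \<gamma> \<sigma>2 L \<nu> \<longleftrightarrow>
     \<sigma>2 \<ge> 0 \<and> (\<forall>x<0. L x = 0) \<and> mono_on {0<..} L \<and> (L \<longlongrightarrow> 0) at_top \<and>
     stieltjes_pos L \<nu> \<and>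
     (\<forall>\<tau>>0. (\<integral>\<^sup>+x\<in>{0<..<\<tau>}. ennreal (x\<^sup>2) \<partial>\<nu>) < \<infinity>) \<and>
     (\<forall>t. char M t = exp (\<i> * complex_of_real (\<gamma> * t) - complex_of_real (\<sigma>2 * t\<^sup>2 / 2)
         + (CLINT x|\<nu>. iexp (t * x) - 1 - \<i> * complex_of_real (t * x / (1 + x\<^sup>2)))))"

(* Eigenvalue sequences: lam j k is the k-th eigenvalue (k >= 1, with multiplicity, nonincreasing,
   padded with zeros) of the covariance operator of X_{1,j}, j >= 1. *)
definition trace1 :: "(nat \<Rightarrow> nat \<Rightarrow> real) \<Rightarrow> nat \<Rightarrow> real" where
  "trace1 lam j = (\<Sum>\<^sub>\<infinity>k\<in>{1..}. lam j k)"

definition barlam :: "(nat \<Rightarrow> nat \<Rightarrow> real) \<Rightarrow> nat \<Rightarrow> nat \<Rightarrow> real" where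
  "barlam lam j k = lam j k / trace1 lam j"

(* multi-indices (k_1,...,k_d), k_j >= 1, labelling the eigenvalues of the tensor product X_d *)
definition multi_idx :: "nat \<Rightarrow> (nat \<Rightarrow> nat) set" where
  "multi_idx d = PiE {1..d} (\<lambda>_. {1..})"

(* eigenvalue prod_j lam_{k_j}^{X_{1,j}} of the covariance operator of X_d *)
definition prod_eig :: "(nat \<Rightarrow> nat \<Rightarrow> real) \<Rightarrow> nat \<Rightarrow> (nat \<Rightarrow> nat) \<Rightarrow> real" where
  "prod_eig lam d \<kappa> = (\<Prod>j\<in>{1..d}. lam j (\<kappa> j))"

definition trace_d :: "(nat \<Rightarrow> nat \<Rightarrow> real) \<Rightarrow> nat \<Rightarrow> real" where
  "trace_d lam d = (\<Sum>\<^sub>\<infinity>\<kappa>\<in>multi_idx d. prod_eig lam d \<kappa>)"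

(* sum of the n largest eigenvalues lambda^{X_d}_1 + ... + lambda^{X_d}_n (with multiplicity) *)
definition top_sum :: "(nat \<Rightarrow> nat \<Rightarrow> real) \<Rightarrow> nat \<Rightarrow> nat \<Rightarrow> real" where
  "top_sum lam d n = Sup ((\<lambda>S. \<Sum>\<kappa>\<in>S. prod_eig lam d \<kappa>) `
       {S. S \<subseteq> multi_idx d \<and> finite S \<and> card S \<le> n})"

(* sum_{k>n} bar lambda^{X_d}_k *)
definition tail_d :: "(nat \<Rightarrow> nat \<Rightarrow> real) \<Rightarrow> nat \<Rightarrow> nat \<Rightarrow> real" where
  "tail_d lam d n = (trace_d lam d - top_sum lam d n) / trace_d lam d"

definition complexity :: "(nat \<Rightarrow> nat \<Rightarrow> real) \<Rightarrow> nat \<Rightarrow> real \<Rightarrow> nat" where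
  "complexity lam d \<epsilon> = (LEAST n. tail_d lam d n \<le> \<epsilon>\<^sup>2)"

definition Mfun :: "(nat \<Rightarrow> nat \<Rightarrow> real) \<Rightarrow> nat \<Rightarrow> enat \<Rightarrow> nat \<Rightarrow> real \<Rightarrow> real" where
  "Mfun lam p N j x = (\<Sum>\<^sub>\<infinity>k\<in>{k. 1 \<le> k \<and> enat k \<le> N}.
      (if barlam lam j k \<ge> exp (- x) then \<bar>ln (barlam lam j k)\<bar> ^ p * barlam lam j k else 0))"

end

theory Submission
  imports Defs
begin

text \<open>
  Under the probability weights given by the normalised eigenvalues of the tensor product, minus the
  logarithm of the eigenvalue is a sum \<open>U\<close> of independent nonnegative variables. At most \<open>exp x\<close>
  eigenvalues have weight at least \<open>exp (- x)\<close>, and \<open>n\<close> eigenvalues of smaller weight carry mass at most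
  \<open>n * exp (- x)\<close>; as \<open>b d\<close> tends to infinity, the logarithm of the complexity therefore follows the quantiles of
  \<open>U\<close>, and the asymptotic formula says that \<open>(U - a d) / b d\<close> converges weakly to the given law. This
  needs the limit distribution function to have no flat pieces, which self-decomposability ensures: if the
  law had a gap, shrinking its end points slightly and adding an almost vanishing independent summand
  would put mass into the gap.

  The conditions (A), (B), (C) are the classical criterion for convergence of row sums of a null array.
  After centering at truncated means, the characteristic function of the row sum is close to the
  exponential of the sum of the centered characteristic functions minus one. Averaging second
  differences of these exponents over \<open>[-1, 1]\<close> gives characteristic functions of finite measures,
  whose weak convergence yields (A) and (C); comparing exponents then gives (B).
\<close>

section \<open>Finite sums and weak convergence of finite measures\<close>

text \<open>Condition (A) is required at every \<open>x > 0\<close>, whereas weak convergence yields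
  tail limits only where \<open>L\<close> is continuous. Continuity of \<open>L\<close> is not a
  feature of general null arrays; it comes from the rows being rescalings of one fixed sequence of
  variables.

  Two further obstacles shape the converse. Approximating the characteristic function by an
  exponential presupposes a bound on the sum of the \<open>spread\<close>s, which has to be
  extracted from the characteristic functions alone: they stay away from 0 on
  \<open>[-1, 1]\<close>, and averaging one minus their squared moduli there controls the
  symmetrised summands. And exponents are determined by their exponentials only up to multiples of 2
  pi i; uniform convergence on compact intervals keeps the difference of exponents on the branch
  that starts at 0.

  The average of \<open>1 - cos (s * x)\<close> over \<open>[-1, 1]\<close> is
  \<open>1 - sin x / x\<close>, comparable to \<open>min 1 (x^2)\<close>. A finite measure with this
  density sees variance and jumps together: the Gaussian part becomes an atom
  \<open>\<sigma>2 / 6\<close> at 0, and 6 is the reciprocal of the leading Taylor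
  coefficient.\<close>

definition msum :: "'i set \<Rightarrow> ('i \<Rightarrow> real measure) \<Rightarrow> real measure" where
  "msum I N = measure_of UNIV (sets borel) (\<lambda>A. \<Sum>i\<in>I. emeasure (N i) A)"

lemma sets_msum [measurable_cong, simp]: "sets (msum I N) = sets borel"
  unfolding msum_def by (metis sets.sets_measure_of_eq space_borel)

lemma space_msum [simp]: "space (msum I N) = UNIV"
  using sets_eq_imp_space_eq[OF sets_msum] by simp

lemma emeasure_msum:
  assumes "\<And>i. i \<in> I \<Longrightarrow> sets (N i) = sets borel" "A \<in> sets borel"
  shows "emeasure (msum I N) A = (\<Sum>i\<in>I. emeasure (N i) A)"
  unfolding msum_def
proof (rule emeasure_measure_of_sigma)
  show "sigma_algebra UNIV (sets (borel::real measure))"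
    using sets.sigma_algebra_axioms[of "borel::real measure"] by simp
  show "positive (sets borel) (\<lambda>A. \<Sum>i\<in>I. emeasure (N i) A)"
    by (simp add: positive_def)
  show "countably_additive (sets borel) (\<lambda>A. \<Sum>i\<in>I. emeasure (N i) A)"
  proof (rule countably_additiveI)
    fix F :: "nat \<Rightarrow> real set"
    assume F: "range F \<subseteq> sets borel" "disjoint_family F" "\<Union> (range F) \<in> sets borel"
    have "(\<Sum>n. \<Sum>i\<in>I. emeasure (N i) (F n)) = (\<Sum>i\<in>I. \<Sum>n. emeasure (N i) (F n))"
      by (rule suminf_sum) auto
    also have "\<dots> = (\<Sum>i\<in>I. emeasure (N i) (\<Union> (range F)))"
      using F assms(1) by (intro sum.cong refl suminf_emeasure) auto
    finally show "(\<Sum>n. \<Sum>i\<in>I. emeasure (N i) (F n)) = (\<Sum>i\<in>I. emeasure (N i) (\<Union> (range F)))" .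
  qed
qed (use assms in auto)

lemma nn_integral_msum:
  assumes N: "\<And>i. i \<in> I \<Longrightarrow> sets (N i) = sets borel"
    and f: "f \<in> borel_measurable borel"
  shows "(\<integral>\<^sup>+x. f x \<partial>msum I N) = (\<Sum>i\<in>I. \<integral>\<^sup>+x. f x \<partial>N i)"
  using f
proof (induction rule: borel_measurable_induct)
  case (cong f g)
  then have "f = g" by (auto simp: fun_eq_iff)
  with cong show ?case by simp
next
  case (set A)
  then show ?case by (simp add: emeasure_msum N)
next
  case (mult u c)
  have "u \<in> borel_measurable (N i)" if "i \<in> I" for i
    using mult(2) N[OF that] measurable_cong_sets by blast
  moreover have "u \<in> borel_measurable (msum I N)"
    using mult(2) measurable_cong_sets[OF sets_msum] by blast
  ultimately show ?case using mult
    by (simp add: nn_integral_cmult sum_distrib_left cong: sum.cong)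
next
  case (add u v)
  have "u \<in> borel_measurable (N i)" "v \<in> borel_measurable (N i)" if "i \<in> I" for i
    using add N[OF that] measurable_cong_sets by blast+
  moreover have "u \<in> borel_measurable (msum I N)" "v \<in> borel_measurable (msum I N)"
    using add measurable_cong_sets[OF sets_msum] by blast+
  ultimately show ?case using add
    by (simp add: nn_integral_add sum.distrib cong: sum.cong)
next
  case (seq U)
  have m: "U i \<in> borel_measurable (N k)" if "k \<in> I" for i k
    using seq N[OF that] measurable_cong_sets by blast
  have m': "U i \<in> borel_measurable (msum I N)" for i
    using seq measurable_cong_sets[OF sets_msum] by blast
  have iU: "incseq U" using seq by simp
  have inc: "incseq (\<lambda>n. \<integral>\<^sup>+x. U n x \<partial>N k)" for k
    using seq by (auto intro!: incseq_SucI nn_integral_mono dest: incseq_SucD le_funD)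
  have "(\<integral>\<^sup>+x. (SUP i. U i) x \<partial>msum I N) = (SUP i. \<integral>\<^sup>+x. U i x \<partial>msum I N)"
    unfolding SUP_apply by (rule nn_integral_monotone_convergence_SUP[OF iU m'])
  also have "\<dots> = (SUP i. \<Sum>k\<in>I. \<integral>\<^sup>+x. U i x \<partial>N k)"
    using seq by simp
  also have "\<dots> = (\<Sum>k\<in>I. SUP i. \<integral>\<^sup>+x. U i x \<partial>N k)"
    by (rule ennreal_SUP_sum) (use inc in \<open>auto\<close>)
  also have "\<dots> = (\<Sum>k\<in>I. \<integral>\<^sup>+x. (SUP i. U i) x \<partial>N k)"
    unfolding SUP_apply
    by (intro sum.cong refl nn_integral_monotone_convergence_SUP[OF iU m, symmetric])
  finally show ?case .
qed

lemma finite_measure_msum: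
  assumes "finite I" "\<And>i. i \<in> I \<Longrightarrow> sets (N i) = sets borel" "\<And>i. i \<in> I \<Longrightarrow> finite_measure (N i)"
  shows "finite_measure (msum I N)"
proof
  have "emeasure (N i) UNIV \<noteq> \<infinity>" if "i \<in> I" for i
    using finite_measure.emeasure_finite[OF assms(3)[OF that]] by auto
  then show "emeasure (msum I N) (space (msum I N)) \<noteq> \<infinity>"
    using assms by (simp add: emeasure_msum)
qed

lemma integrable_bounded_borel:
  fixes f :: "real \<Rightarrow> 'b::{banach, second_countable_topology}"
  assumes "finite_measure H" "sets H = sets borel" "f \<in> borel_measurable borel" "\<And>x. norm (f x) \<le> B"
  shows "integrable H f"
proof -
  have "f \<in> borel_measurable H"
    using assms(2,3) measurable_cong_sets by blast
  then show ?thesis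
    by (intro finite_measure.integrable_const_bound[OF assms(1), of _ B]) (use assms(4) in auto)
qed

lemma integral_msum_real:
  fixes f :: "real \<Rightarrow> real"
  assumes I: "finite I" and N: "\<And>i. i \<in> I \<Longrightarrow> sets (N i) = sets borel"
    and fin: "\<And>i. i \<in> I \<Longrightarrow> finite_measure (N i)"
    and f[measurable]: "f \<in> borel_measurable borel" and B: "\<And>x. \<bar>f x\<bar> \<le> B"
  shows "(\<integral>x. f x \<partial>msum I N) = (\<Sum>i\<in>I. \<integral>x. f x \<partial>N i)"
proof -
  have int: "integrable (N i) f" if "i \<in> I" for i
    using integrable_bounded_borel[OF fin[OF that] N[OF that] f] B by auto
  have int': "integrable (msum I N) f"
    by (rule integrable_bounded_borel[OF finite_measure_msum sets_msum f, of I N]) (use I N fin B in auto)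
  have nn: "(\<integral>\<^sup>+x. ennreal (f x) \<partial>N i) < top" "(\<integral>\<^sup>+x. ennreal (- f x) \<partial>N i) < top"
    if "i \<in> I" for i
    using int[OF that] unfolding real_integrable_def by (auto simp: less_top)
  have "enn2real (\<integral>\<^sup>+x. ennreal (f x) \<partial>msum I N) = (\<Sum>i\<in>I. enn2real (\<integral>\<^sup>+x. ennreal (f x) \<partial>N i))"
    by (subst nn_integral_msum[OF N]) (auto simp: enn2real_sum nn)
  moreover have "enn2real (\<integral>\<^sup>+x. ennreal (- f x) \<partial>msum I N) = (\<Sum>i\<in>I. enn2real (\<integral>\<^sup>+x. ennreal (- f x) \<partial>N i))"
    by (subst nn_integral_msum[OF N]) (auto simp: enn2real_sum nn)
  ultimately show ?thesis
    unfolding real_lebesgue_integral_def[OF int']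
    by (simp add: sum_subtractf[symmetric] real_lebesgue_integral_def[OF int])
qed

lemma integral_msum:
  fixes f :: "real \<Rightarrow> complex"
  assumes I: "finite I" and N: "\<And>i. i \<in> I \<Longrightarrow> sets (N i) = sets borel"
    and fin: "\<And>i. i \<in> I \<Longrightarrow> finite_measure (N i)"
    and f[measurable]: "f \<in> borel_measurable borel" and B: "\<And>x. norm (f x) \<le> B"
  shows "(\<integral>x. f x \<partial>msum I N) = (\<Sum>i\<in>I. \<integral>x. f x \<partial>N i)"
proof -
  have int: "integrable (N i) f" if "i \<in> I" for i
    using integrable_bounded_borel[OF fin[OF that] N[OF that] f] B by auto
  have int': "integrable (msum I N) f"
    by (rule integrable_bounded_borel[OF finite_measure_msum sets_msum f, of I N]) (use I N fin B in auto)
  have R: "(\<integral>x. Re (f x) \<partial>msum I N) = (\<Sum>i\<in>I. \<integral>x. Re (f x) \<partial>N i)"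
    by (rule integral_msum_real[OF I N fin, where B=B]) (auto intro: order_trans[OF abs_Re_le_cmod B])
  have J: "(\<integral>x. Im (f x) \<partial>msum I N) = (\<Sum>i\<in>I. \<integral>x. Im (f x) \<partial>N i)"
    by (rule integral_msum_real[OF I N fin, where B=B]) (auto intro: order_trans[OF abs_Im_le_cmod B])
  show ?thesis
  proof (rule complex_eqI)
    show "Re (\<integral>x. f x \<partial>msum I N) = Re (\<Sum>i\<in>I. \<integral>x. f x \<partial>N i)"
      unfolding integral_Re[OF int', symmetric] R Re_sum by (intro sum.cong refl integral_Re int)
    show "Im (\<integral>x. f x \<partial>msum I N) = Im (\<Sum>i\<in>I. \<integral>x. f x \<partial>N i)"
      unfolding integral_Im[OF int', symmetric] J Im_sum by (intro sum.cong refl integral_Im int)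
  qed
qed

text \<open>The point mass at 0 is a default that keeps every term of a sequence a probability law
  even if some measures vanish. Limits are taken only for positive limit mass, hence along terms
  that eventually have positive mass.\<close>

definition normalized :: "real measure \<Rightarrow> real measure" where
  "normalized H = (if measure H UNIV > 0 then density H (\<lambda>_. ennreal (1 / measure H UNIV)) else return borel 0)"

lemma real_distribution_normalized:
  assumes "finite_measure H" "sets H = sets borel"
  shows "real_distribution (normalized H)"
proof (cases "measure H UNIV > 0")
  case True
  interpret finite_measure H by fact
  have sp: "space H = UNIV" using sets_eq_imp_space_eq[OF assms(2)] by simp
  have "emeasure (normalized H) (space (normalized H)) = ennreal (1 / measure H UNIV) * emeasure H UNIV"
    using True using sets.top[of H] by (simp add: normalized_def emeasure_density sp)
  also have "\<dots> = 1"
    using True by (simp add: emeasure_eq_measure ennreal_mult[symmetric])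
  finally have "prob_space (normalized H)" by (rule prob_spaceI)
  then show ?thesis
    unfolding real_distribution_def real_distribution_axioms_def
    using True assms(2) sp by (simp add: normalized_def)
next
  case False
  then show ?thesis
    unfolding real_distribution_def real_distribution_axioms_def normalized_def
    by (auto intro: prob_space_return)
qed

lemma integral_normalized:
  fixes f :: "real \<Rightarrow> 'b::{banach, second_countable_topology}"
  assumes "sets H = sets borel" "measure H UNIV > 0" and f: "f \<in> borel_measurable borel"
  shows "(\<integral>x. f x \<partial>normalized H) = (1 / measure H UNIV) *\<^sub>R (\<integral>x. f x \<partial>H)"
proof -
  have "f \<in> borel_measurable H"
    using assms(1) f measurable_cong_sets by blast
  then show ?thesis
    using assms(2) by (simp add: normalized_def integral_density)
qed

lemma cdf_normalized:
  assumes "finite_measure H" "sets H = sets borel" "measure H UNIV > 0"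
  shows "cdf (normalized H) x = measure H {..x} / measure H UNIV"
proof -
  interpret finite_measure H by fact
  have "emeasure (normalized H) {..x} = ennreal (1 / measure H UNIV) * emeasure H {..x}"
    using assms by (simp add: normalized_def emeasure_density nn_integral_cmult_indicator)
  also have "\<dots> = ennreal (measure H {..x} / measure H UNIV)"
    using assms(3) by (simp add: emeasure_eq_measure ennreal_mult[symmetric] mult.commute)
  finally show ?thesis
    using assms(3) by (simp add: cdf_def measure_def)
qed

text \<open>An integral is the mass times the integral against the normalised law, and both factors
  converge. When the limit mass is 0 there is no law to converge to, and the bound of the integral
  by \<open>B\<close> times the mass gives the limit 0 directly.\<close>

lemma integral_tendsto_if_normalized_weak_conv:
  fixes f :: "real \<Rightarrow> 'b::{banach, second_countable_topology}"
  assumes fin: "\<And>n. finite_measure (H n)" "\<And>n. sets (H n) = sets borel"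
    and fin0: "finite_measure H0" "sets H0 = sets borel"
    and mass: "(\<lambda>n. measure (H n) UNIV) \<longlonglongrightarrow> measure H0 UNIV"
    and weak: "measure H0 UNIV > 0 \<Longrightarrow> weak_conv_m (\<lambda>n. normalized (H n)) (normalized H0)"
    and f: "\<And>x. isCont f x" "\<And>x. norm (f x) \<le> B"
  shows "(\<lambda>n. \<integral>x. f x \<partial>H n) \<longlonglongrightarrow> (\<integral>x. f x \<partial>H0)"
proof -
  have fm: "f \<in> borel_measurable borel"
    using f(1) by (intro borel_measurable_continuous_onI) (simp add: continuous_at_imp_continuous_on)
  have sp: "space (H n) = UNIV" for n using sets_eq_imp_space_eq[OF fin(2)] by simp
  have sp0: "space H0 = UNIV" using sets_eq_imp_space_eq[OF fin0(2)] by simp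
  have nb: "norm (\<integral>x. f x \<partial>K) \<le> B * measure K UNIV"
    if "finite_measure K" "sets K = sets borel" for K
  proof -
    have spK: "space K = UNIV" using sets_eq_imp_space_eq[OF that(2)] by simp
    have "norm (\<integral>x. f x \<partial>K) \<le> (\<integral>x. B \<partial>K)"
      by (intro Bochner_Integration.integral_norm_bound_integral integrable_bounded_borel[OF that fm f(2)]
          finite_measure.integrable_const[OF that(1)] f(2))
    then show ?thesis by (simp add: spK mult.commute)
  qed
  show ?thesis
  proof (cases "measure H0 UNIV > 0")
    case False
    then have z: "measure H0 UNIV = 0" using measure_nonneg[of H0 UNIV] by linarith
    have "(\<integral>x. f x \<partial>H0) = 0" using nb[OF fin0] z by simp
    moreover have "(\<lambda>n. \<integral>x. f x \<partial>H n) \<longlonglongrightarrow> 0"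
    proof (rule Lim_null_comparison)
      show "\<forall>\<^sub>F n in sequentially. norm (\<integral>x. f x \<partial>H n) \<le> B * measure (H n) UNIV"
        using nb[OF fin] by simp
      show "(\<lambda>n. B * measure (H n) UNIV) \<longlonglongrightarrow> 0"
        using tendsto_mult_left[OF mass, of B] z by simp
    qed
    ultimately show ?thesis by simp
  next
    case True
    have "(\<lambda>n. \<integral>x. f x \<partial>normalized (H n)) \<longlonglongrightarrow> (\<integral>x. f x \<partial>normalized H0)"
      by (rule weak_conv_imp_integral_bdd_continuous_conv[OF real_distribution_normalized[OF fin]
          real_distribution_normalized[OF fin0] weak[OF True] f])
    from tendsto_scaleR[OF mass this]
    have "(\<lambda>n. measure (H n) UNIV *\<^sub>R (\<integral>x. f x \<partial>normalized (H n))) \<longlonglongrightarrow> (\<integral>x. f x \<partial>H0)"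
      using integral_normalized[OF fin0(2) True fm] True by simp
    moreover have "\<forall>\<^sub>F n in sequentially. measure (H n) UNIV *\<^sub>R (\<integral>x. f x \<partial>normalized (H n)) = (\<integral>x. f x \<partial>H n)"
      using order_tendstoD(1)[OF mass True]
    proof eventually_elim
      case (elim n)
      then show ?case using integral_normalized[OF fin(2) elim fm] by simp
    qed
    ultimately show ?thesis by (rule Lim_transform_eventually)
  qed
qed

text \<open>The value at \<open>t = 0\<close> gives convergence of the masses; dividing by them
  turns the hypothesis into convergence of characteristic functions of probability laws.\<close>

lemma finite_measure_levy_continuity:
  fixes f :: "real \<Rightarrow> 'b::{banach, second_countable_topology}"
  assumes fin: "\<And>n. finite_measure (H n)" "\<And>n. sets (H n) = sets borel"
    and fin0: "finite_measure H0" "sets H0 = sets borel"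
    and conv: "\<And>t. (\<lambda>n. CLINT x|H n. iexp (t * x)) \<longlonglongrightarrow> (CLINT x|H0. iexp (t * x))"
    and f: "\<And>x. isCont f x" "\<And>x. norm (f x) \<le> B"
  shows "(\<lambda>n. \<integral>x. f x \<partial>H n) \<longlonglongrightarrow> (\<integral>x. f x \<partial>H0)"
proof (rule integral_tendsto_if_normalized_weak_conv[OF fin fin0 _ _ f])
  have sp: "space K = UNIV" if "sets K = sets borel" for K :: "real measure"
    using sets_eq_imp_space_eq[OF that] by simp
  have "(\<lambda>n. Re (CLINT x|H n. 1)) \<longlonglongrightarrow> Re (CLINT x|H0. 1)"
    using conv[of 0] by (intro tendsto_Re) simp
  then show mass: "(\<lambda>n. measure (H n) UNIV) \<longlonglongrightarrow> measure H0 UNIV"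
    using sp fin fin0 by simp
  assume pos: "measure H0 UNIV > 0"
  show "weak_conv_m (\<lambda>n. normalized (H n)) (normalized H0)"
  proof (rule levy_continuity[OF real_distribution_normalized[OF fin] real_distribution_normalized[OF fin0]])
    fix t
    have ev: "\<forall>\<^sub>F n in sequentially. (1 / measure (H n) UNIV) *\<^sub>R (CLINT x|H n. iexp (t * x)) = char (normalized (H n)) t"
      using order_tendstoD(1)[OF mass pos]
      by eventually_elim (simp add: char_def integral_normalized fin)
    have "(\<lambda>n. (1 / measure (H n) UNIV) *\<^sub>R (CLINT x|H n. iexp (t * x)))
        \<longlonglongrightarrow> (1 / measure H0 UNIV) *\<^sub>R (CLINT x|H0. iexp (t * x))"
      using pos by (intro tendsto_scaleR tendsto_divide conv mass tendsto_const) auto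
    then show "(\<lambda>n. char (normalized (H n)) t) \<longlonglongrightarrow> char (normalized H0) t"
      using Lim_transform_eventually[OF _ ev] pos by (simp add: char_def integral_normalized fin0)
  qed
qed

lemma finite_measure_cdf_tendsto:
  fixes f :: "real \<Rightarrow> 'b::{banach, second_countable_topology}"
  assumes fin: "\<And>n. finite_measure (H n)" "\<And>n. sets (H n) = sets borel"
    and fin0: "finite_measure H0" "sets H0 = sets borel"
    and mass: "(\<lambda>n. measure (H n) UNIV) \<longlonglongrightarrow> measure H0 UNIV"
    and conv: "\<And>x. (\<lambda>n. measure (H n) {..x}) \<longlonglongrightarrow> measure H0 {..x}"
    and f: "\<And>x. isCont f x" "\<And>x. norm (f x) \<le> B"
  shows "(\<lambda>n. \<integral>x. f x \<partial>H n) \<longlonglongrightarrow> (\<integral>x. f x \<partial>H0)"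
proof (rule integral_tendsto_if_normalized_weak_conv[OF fin fin0 mass _ f])
  assume pos: "measure H0 UNIV > 0"
  show "weak_conv_m (\<lambda>n. normalized (H n)) (normalized H0)"
    unfolding weak_conv_m_def weak_conv_def
  proof (intro allI impI)
    fix x
    have ev: "\<forall>\<^sub>F n in sequentially. measure (H n) {..x} / measure (H n) UNIV = cdf (normalized (H n)) x"
      using order_tendstoD(1)[OF mass pos]
      by eventually_elim (simp add: cdf_normalized fin)
    have "(\<lambda>n. measure (H n) {..x} / measure (H n) UNIV) \<longlonglongrightarrow> measure H0 {..x} / measure H0 UNIV"
      using pos by (intro tendsto_divide conv mass) auto
    then show "(\<lambda>n. cdf (normalized (H n)) x) \<longlonglongrightarrow> cdf (normalized H0) x"
      using Lim_transform_eventually[OF _ ev] pos by (simp add: cdf_normalized fin0)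
  qed
qed

text \<open>On a Skorokhod space the variables converge pointwise, and the exponentials differ by at
  most \<open>min 2 (R * |Yn - Y|)\<close>, a bound free of \<open>t\<close>. Dominated convergence
  sends its expectation to 0, which gives uniformity over the interval at once.\<close>

lemma weak_conv_char_uniform:
  assumes "\<And>n. real_distribution (M n)" "real_distribution M'" "weak_conv_m M M'" "e > 0"
  shows "\<forall>\<^sub>F n in sequentially. \<forall>t. \<bar>t\<bar> \<le> R \<longrightarrow> norm (char (M n) t - char M' t) < e"
proof -
  obtain \<Omega> :: "real measure" and Yn Y where S: "prob_space \<Omega>" "\<And>n. Yn n \<in> measurable \<Omega> borel"
    "\<And>n. distr \<Omega> borel (Yn n) = M n" "Y \<in> measurable \<Omega> lborel" "distr \<Omega> borel Y = M'"
    "\<And>x. x \<in> space \<Omega> \<Longrightarrow> (\<lambda>n. Yn n x) \<longlonglongrightarrow> Y x"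
    using Skorohod[OF assms(1-3)] by blast
  interpret prob_space \<Omega> by fact
  have [measurable]: "Yn n \<in> borel_measurable \<Omega>" "Y \<in> borel_measurable \<Omega>" for n
    using S by auto
  define g where "g n x = min 2 (\<bar>R\<bar> * \<bar>Yn n x - Y x\<bar>)" for n x
  have gm[measurable]: "g n \<in> borel_measurable \<Omega>" for n unfolding g_def by measurable
  have gb: "\<bar>g n x\<bar> \<le> 2" for n x unfolding g_def by auto
  have "(\<lambda>n. \<integral>x. g n x \<partial>\<Omega>) \<longlonglongrightarrow> (\<integral>x. 0 \<partial>\<Omega>)"
  proof (rule integral_dominated_convergence[where w="\<lambda>_. 2"])
    show "AE x in \<Omega>. (\<lambda>n. g n x) \<longlonglongrightarrow> 0"
    proof (rule AE_I2)
      fix x assume "x \<in> space \<Omega>"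
      then have "(\<lambda>n. \<bar>R\<bar> * \<bar>Yn n x - Y x\<bar>) \<longlonglongrightarrow> \<bar>R\<bar> * \<bar>Y x - Y x\<bar>"
        by (intro tendsto_intros S)
      then have "(\<lambda>n. min 2 (\<bar>R\<bar> * \<bar>Yn n x - Y x\<bar>)) \<longlonglongrightarrow> min 2 (\<bar>R\<bar> * \<bar>Y x - Y x\<bar>)"
        by (intro tendsto_min tendsto_const)
      then show "(\<lambda>n. g n x) \<longlonglongrightarrow> 0" unfolding g_def by simp
    qed
  qed (use gb in auto)
  then have ev: "\<forall>\<^sub>F n in sequentially. (\<integral>x. g n x \<partial>\<Omega>) < e"
    using \<open>e > 0\<close> by (simp add: order_tendstoD)
  then show ?thesis
  proof eventually_elim
    case (elim n)
    show ?case
    proof (intro allI impI)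
      fix t assume t: "\<bar>t\<bar> \<le> R"
      have pw: "norm (iexp (t * Yn n x) - iexp (t * Y x)) \<le> g n x" for x
      proof -
        have "iexp (t * Yn n x) - iexp (t * Y x) = iexp (t * Y x) * (iexp (t * Yn n x - t * Y x) - 1)"
          by (simp add: algebra_simps exp_diff)
        then have "norm (iexp (t * Yn n x) - iexp (t * Y x)) = norm (iexp (t * Yn n x - t * Y x) - 1)"
          by (simp add: norm_mult)
        moreover have "norm (iexp (t * Yn n x - t * Y x) - 1) \<le> \<bar>t * Yn n x - t * Y x\<bar>"
          using iexp_approx1[of "t * Yn n x - t * Y x" 0] by simp
        moreover have "norm (iexp (t * Yn n x - t * Y x) - 1) \<le> 2"
          using iexp_approx2[of "t * Yn n x - t * Y x" 0] by simp
        moreover have "\<bar>t * Yn n x - t * Y x\<bar> \<le> \<bar>R\<bar> * \<bar>Yn n x - Y x\<bar>"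
          using t by (simp add: abs_mult right_diff_distrib[symmetric] mult_right_mono)
        ultimately show ?thesis unfolding g_def by simp
      qed
      have "char (M n) t - char M' t = (CLINT x|\<Omega>. iexp (t * Yn n x) - iexp (t * Y x))"
        unfolding char_def S(3)[symmetric] S(5)[symmetric]
        by (simp add: integral_distr integrable_iexp)
      also have "norm \<dots> \<le> (\<integral>x. g n x \<partial>\<Omega>)"
        using pw gb by (intro Bochner_Integration.integral_norm_bound_integral Bochner_Integration.integrable_diff integrable_iexp
            integrable_const_bound[of _ 2]) auto
      finally show "norm (char (M n) t - char M' t) < e" using elim by simp
    qed
  qed
qed

section \<open>The Levy exponent\<close>

definition unif :: "real measure" where
  "unif = density lborel (\<lambda>s. ennreal (indicator {-1..1} s / 2))"

text \<open>The average of \<open>1 - cos (s * x)\<close> over uniform \<open>s\<close> in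
  \<open>[-1, 1]\<close>; the value 0 at 0 is the continuous extension.\<close>

definition wt :: "real \<Rightarrow> real" where
  "wt x = (if x = 0 then 0 else 1 - sin x / x)"

lemma sets_unif [measurable_cong, simp]: "sets unif = sets borel"
  by (simp add: unif_def)

lemma space_unif [simp]: "space unif = UNIV"
  by (simp add: unif_def)

lemma prob_space_unif: "prob_space unif"
proof (rule prob_spaceI)
  have e: "ennreal (indicator {-1..1} s / 2) * indicator UNIV s = ennreal (1/2) * indicator {-1..1} s" for s :: real
    by (cases "s \<in> {-1..1}") simp_all
  have "emeasure unif (space unif) = (\<integral>\<^sup>+s. ennreal (indicator {-1..1::real} s / 2) * indicator UNIV s \<partial>lborel)"
    unfolding unif_def space_density space_lborel space_borel by (subst emeasure_density) auto
  also have "\<dots> = ennreal (1/2) * ennreal 2"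
    unfolding e by (subst nn_integral_cmult_indicator) auto
  also have "\<dots> = ennreal (1/2 * 2)" by (rule ennreal_mult[symmetric]) auto
  also have "\<dots> = 1" by simp
  finally show "emeasure unif (space unif) = 1" .
qed

interpretation unif: prob_space unif by (rule prob_space_unif)

lemma AE_unif: "AE s in unif. \<bar>s\<bar> \<le> 1"
  unfolding unif_def by (subst AE_density) (auto simp: indicator_def)

lemma integral_unif:
  fixes f :: "real \<Rightarrow> 'b::{banach, second_countable_topology}"
  assumes [measurable]: "f \<in> borel_measurable borel"
  shows "(\<integral>s. f s \<partial>unif) = (1/2) *\<^sub>R (\<integral>s. indicator {-1..1} s *\<^sub>R f s \<partial>lborel)"
proof -
  have "(\<integral>s. f s \<partial>unif) = (\<integral>s. (1/2) *\<^sub>R (indicator {-1..1} s *\<^sub>R f s) \<partial>lborel)"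
    unfolding unif_def by (subst integral_density) auto
  then show ?thesis by (simp only: integral_scaleR_right)
qed

lemma integral_unif_one_minus_cos: "(\<integral>s. 1 - cos (s * x) \<partial>unif) = wt x"
proof (cases "x = 0")
  case False
  have "(\<integral>s. 1 - cos (s * x) \<partial>unif) = (1/2) * (\<integral>s. (1 - cos (s * x)) * indicator {-1..1} s \<partial>lborel)"
    by (subst integral_unif) (auto simp: mult.commute)
  also have "(\<integral>s. (1 - cos (s * x)) * indicator {-1..1} s \<partial>lborel) = (1 - sin (1 * x) / x) - (-1 - sin (-1 * x) / x)"
    using False by (intro integral_FTC_Icc_real[where F="\<lambda>s. s - sin (s * x) / x"])
      (auto intro!: derivative_eq_intros continuous_intros)
  finally show ?thesis using False by (simp add: wt_def)
qed (simp add: wt_def)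

lemma integral_unif_square: "(\<integral>s. s\<^sup>2 \<partial>unif) = 1/3"
proof -
  have "(\<integral>s. s\<^sup>2 \<partial>unif) = (1/2) * (\<integral>s. s\<^sup>2 * indicator {-1..1} s \<partial>lborel)"
    by (subst integral_unif) (auto simp: mult.commute)
  also have "(\<integral>s. s\<^sup>2 * indicator {-1..1} s \<partial>lborel) = 1^3/3 - (-1)^3/(3::real)"
    by (intro integral_FTC_Icc_real[where F="\<lambda>s. s^3/3"])
      (auto intro!: derivative_eq_intros continuous_intros)
  finally show ?thesis by simp
qed

lemma wt_taylor: "\<bar>wt x - x\<^sup>2 / 6\<bar> \<le> x^4 / 120"
proof (cases "x = 0")
  case False
  have s: "(\<Sum>m<5. sin_coeff m * x ^ m) = x - x^3/6"
  proof -
    have "{..<5} = {0, 1, 2, 3, 4::nat}" by auto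
    then show ?thesis by (simp add: sin_coeff_def fact_numeral)
  qed
  have "\<bar>sin x - (x - x^3/6)\<bar> \<le> \<bar>x\<bar>^5 / 120"
    using Maclaurin_sin_bound[of x 5] unfolding s by (simp add: fact_numeral field_simps)
  then have "\<bar>sin x - (x - x^3/6)\<bar> / \<bar>x\<bar> \<le> \<bar>x\<bar>^5 / 120 / \<bar>x\<bar>"
    by (rule divide_right_mono) simp
  moreover have "\<bar>x\<bar>^5 / 120 / \<bar>x\<bar> = x^4 / 120"
    using False by (simp add: eval_nat_numeral)
  moreover have "\<bar>sin x - (x - x^3/6)\<bar> / \<bar>x\<bar> = \<bar>wt x - x\<^sup>2/6\<bar>"
  proof -
    have "wt x - x\<^sup>2/6 = - ((sin x - (x - x^3/6)) / x)"
      using False by (simp add: wt_def field_simps eval_nat_numeral)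
    then show ?thesis by (simp add: abs_divide)
  qed
  ultimately show ?thesis by simp
qed (simp add: wt_def)

lemma wt_nonneg: "0 \<le> wt x"
  using abs_sin_x_le_abs_x[of x] by (cases "x > 0") (auto simp: wt_def field_simps abs_if split: if_splits)

text \<open>For \<open>|x| <= 2\<close> the Taylor bound leaves
  \<open>1/6 - 4/120 = 2/15 >= 1/8\<close> of \<open>x^2\<close>; beyond,
  \<open>|sin x / x| <= 1/2\<close> already gives \<open>wt x >= 1/2\<close>.\<close>

lemma wt_ge: "min 1 (x\<^sup>2) / 8 \<le> wt x"
proof (cases "\<bar>x\<bar> \<le> 2")
  case True
  then have "x\<^sup>2 \<le> 4" using abs_le_square_iff[of x 2] by simp
  then have "x\<^sup>2 * x\<^sup>2 \<le> 4 * x\<^sup>2" by (intro mult_right_mono) auto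
  then have "x^4 \<le> 4 * x\<^sup>2" by (simp add: eval_nat_numeral)
  then have "x\<^sup>2 / 8 \<le> wt x" using wt_taylor[of x] by linarith
  then show ?thesis by (auto simp: min_def)
next
  case False
  have "\<bar>sin x / x\<bar> \<le> 1 / 2"
    unfolding abs_divide using False abs_sin_le_one[of x] by (intro frac_le) auto
  then have "sin x / x \<le> 1/2" by linarith
  then have "1/2 \<le> wt x" using False by (auto simp: wt_def)
  then show ?thesis by (auto simp: min_def)
qed

lemma wt_le: "wt x \<le> 2 * min 1 (x\<^sup>2)"
proof -
  have 1: "wt x \<le> 2"
  proof (cases "x = 0")
    case False
    have "\<bar>sin x / x\<bar> \<le> 1" using abs_sin_x_le_abs_x[of x] False by (simp add: abs_divide)
    then have "- (sin x / x) \<le> 1" by linarith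
    then show ?thesis using False by (simp add: wt_def)
  qed (simp add: wt_def)
  show ?thesis
  proof (cases "\<bar>x\<bar> \<le> 1")
    case True
    then have "x\<^sup>2 \<le> 1" by (simp add: abs_square_le_1)
    then have "x\<^sup>2 * x\<^sup>2 \<le> 1 * x\<^sup>2" by (intro mult_right_mono) auto
    then have "x^4 \<le> x\<^sup>2" by (simp add: eval_nat_numeral)
    then have "wt x \<le> 2 * x\<^sup>2"
      using wt_taylor[of x] zero_le_power2[of x] by linarith
    then show ?thesis using \<open>x\<^sup>2 \<le> 1\<close> by (simp add: min_def)
  next
    case False
    then have "1 \<le> x\<^sup>2" using abs_le_square_iff[of 1 x] by simp
    then show ?thesis using 1 by simp
  qed
qed

lemma wt_pos: "x \<noteq> 0 \<Longrightarrow> 0 < wt x"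
  using wt_ge[of x] by (auto simp: min_def split: if_splits) (smt (verit) zero_less_power2)

lemma isCont_wt: "isCont wt x"
proof -
  have "wt = (\<lambda>x. 1 - sinc x)" by (auto simp: wt_def fun_eq_iff)
  moreover have "isCont (\<lambda>x. 1 - sinc x) x"
    by (intro continuous_diff continuous_const isCont_sinc)
  ultimately show ?thesis by simp
qed

lemma wt_measurable [measurable]: "wt \<in> borel_measurable borel"
  by (intro borel_measurable_continuous_onI continuous_at_imp_continuous_on ballI isCont_wt)

text \<open>This ratio fixes the value at 0 of a test function divided by \<open>wt\<close>, and
  thereby the coefficient of the Gaussian variance.\<close>

lemma wt_over_square: "((\<lambda>x. x\<^sup>2 / wt x) \<longlongrightarrow> 6) (at 0)"
proof -
  have "((\<lambda>x. wt x / x\<^sup>2) \<longlongrightarrow> 1/6) (at 0)"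
  proof (rule LIM_zero_cancel, rule Lim_null_comparison)
    show "((\<lambda>x::real. x\<^sup>2 / 120) \<longlongrightarrow> 0) (at 0)"
      by (auto intro!: tendsto_eq_intros)
    show "\<forall>\<^sub>F x in at 0. norm (wt x / x\<^sup>2 - 1/6) \<le> x\<^sup>2 / 120"
    proof (rule eventually_at_topological[THEN iffD2], intro exI[of _ UNIV] conjI ballI impI)
      fix x :: real assume x: "x \<noteq> 0"
      have "\<bar>wt x - x\<^sup>2 / 6\<bar> / x\<^sup>2 \<le> x^4 / 120 / x\<^sup>2"
        by (rule divide_right_mono[OF wt_taylor]) simp
      moreover have "wt x / x\<^sup>2 - 1/6 = (wt x - x\<^sup>2 / 6) / x\<^sup>2" using x by (simp add: field_simps)
      ultimately show "norm (wt x / x\<^sup>2 - 1/6) \<le> x\<^sup>2 / 120"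
        using x by (simp add: abs_divide eval_nat_numeral)
    qed auto
  qed
  then have "((\<lambda>x. inverse (wt x / x\<^sup>2)) \<longlongrightarrow> inverse (1/6)) (at 0)"
    by (rule tendsto_inverse) simp
  then show ?thesis by simp
qed

lemma iexp_second_difference:
  "iexp (t * x) - (iexp ((t + s) * x) + iexp ((t - s) * x)) / 2
    = iexp (t * x) * complex_of_real (1 - cos (s * x))"
proof -
  have 1: "iexp ((t + s) * x) = iexp (t * x) * iexp (s * x)"
    by (simp add: algebra_simps exp_add)
  have 2: "iexp ((t - s) * x) = iexp (t * x) * iexp (- (s * x))"
    by (simp add: algebra_simps exp_add[symmetric])
  have 3: "iexp (s * x) + iexp (- (s * x)) = 2 * complex_of_real (cos (s * x))"
    unfolding cis_conv_exp[symmetric] by (simp add: complex_eq_iff)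
  have "iexp ((t + s) * x) + iexp ((t - s) * x) = 2 * (iexp (t * x) * complex_of_real (cos (s * x)))"
    unfolding 1 2 distrib_left[symmetric] 3 by (simp only: mult.left_commute)
  then show ?thesis by (simp add: right_diff_distrib)
qed

lemma one_minus_cos_le_square: "1 - cos (x::real) \<le> x\<^sup>2 / 2"
proof -
  have "1 - cos x = 2 * (sin (x/2))\<^sup>2"
    using cos_double_sin[of "x/2"] by simp
  moreover have "(sin (x/2))\<^sup>2 \<le> (x/2)\<^sup>2"
    using abs_sin_x_le_abs_x[of "x/2"] by (simp only: abs_le_square_iff)
  ultimately show ?thesis by (simp add: power_divide)
qed

text \<open>Fubini is justified because the inner integral of the modulus is \<open>wt x\<close>,
  which a multiple of \<open>min 1 (x^2)\<close> dominates. Asking for sigma-finiteness admits jump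
  measures of infinite mass near 0.\<close>

lemma integral_wt_iexp:
  fixes K :: "real measure"
  assumes "sigma_finite_measure K" and sets: "sets K = sets borel" and int: "integrable K (\<lambda>x. min 1 (x\<^sup>2))"
  shows "(CLINT s|unif. CLINT x|K. iexp (t * x) * complex_of_real (1 - cos (s * x)))
      = (CLINT x|K. iexp (t * x) * complex_of_real (wt x))"
proof -
  interpret K: sigma_finite_measure K by fact
  interpret P: pair_sigma_finite K unif ..
  note [measurable_cong] = sets
  have "(CLINT s|unif. CLINT x|K. iexp (t * x) * complex_of_real (1 - cos (s * x)))
     = (CLINT x|K. CLINT s|unif. iexp (t * x) * complex_of_real (1 - cos (s * x)))"
  proof (rule P.Fubini_integral, rule P.Fubini_integrable)
    have "integrable K wt"
      using Bochner_Integration.integrable_mult_right[OF int, of 2]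
      by (rule Bochner_Integration.integrable_bound) (auto simp: wt_nonneg wt_le)
    moreover have "(\<integral>s. norm (iexp (t * x) * complex_of_real (1 - cos (s * x))) \<partial>unif) = wt x" for x
      unfolding integral_unif_one_minus_cos[symmetric]
      by (simp add: norm_mult abs_of_nonneg del: of_real_diff)
    ultimately show "integrable K (\<lambda>x. \<integral>s. norm (case (x, s) of (x, s) \<Rightarrow> iexp (t * x) * complex_of_real (1 - cos (s * x))) \<partial>unif)"
      by simp
    show "AE x in K. complex_integrable unif (\<lambda>s. case (x, s) of (x, s) \<Rightarrow> iexp (t * x) * complex_of_real (1 - cos (s * x)))"
      by (intro AE_I2 unif.integrable_const_bound[of _ 2])
        (auto simp: norm_mult abs_of_nonneg simp del: of_real_diff intro!: AE_I2 add_increasing2)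
  qed measurable
  also have "\<dots> = (CLINT x|K. iexp (t * x) * complex_of_real (wt x))"
    by (simp only: integral_mult_right_zero integral_complex_of_real integral_unif_one_minus_cos)
  finally show ?thesis .
qed

section \<open>Compensated exponentials and the exponent of a Levy triplet\<close>

definition levy_kernel :: "real \<Rightarrow> real \<Rightarrow> complex" where
  "levy_kernel t x = iexp (t * x) - 1 - \<i> * complex_of_real (t * x / (1 + x\<^sup>2))"

lemma levy_kernel_measurable [measurable]: "levy_kernel t \<in> borel_measurable borel"
  unfolding levy_kernel_def by measurable

lemma iexp_minus_one_le: "norm (iexp y - 1) \<le> \<bar>y\<bar>"
  using iexp_approx1[of y 0] by simp

lemma iexp_minus_one_le2: "norm (iexp y - 1) \<le> 2"
  using iexp_approx2[of y 0] by simp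

lemma iexp_linear_le: "norm (iexp y - 1 - \<i> * complex_of_real y) \<le> y\<^sup>2 / 2"
  using iexp_approx1[of y 1] by (simp add: eval_nat_numeral diff_diff_eq abs_mult_self_eq)

lemma iexp_quadratic_le: "norm (iexp y - 1 - \<i> * complex_of_real y + complex_of_real (y\<^sup>2 / 2)) \<le> \<bar>y\<bar>^3 / 6"
  using iexp_approx1[of y 2] by (simp add: eval_nat_numeral diff_diff_eq algebra_simps)

text \<open>For \<open>|x| <= 1\<close> the kernel is the Taylor remainder of second order plus
  \<open>t * x^3 / (1 + x^2)\<close> up to a factor i; for larger \<open>x\<close> every part is
  bounded. The constant is polynomial in \<open>t\<close>, which gives one dominating function for
  all \<open>t\<close> in a compact set.\<close>

lemma norm_levy_kernel_le: "norm (levy_kernel t x) \<le> (t\<^sup>2 / 2 + \<bar>t\<bar> + 2) * min 1 (x\<^sup>2)"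
proof (cases "\<bar>x\<bar> \<le> 1")
  case True
  then have x1: "x\<^sup>2 \<le> 1" by (simp add: abs_square_le_1)
  have e: "levy_kernel t x = (iexp (t * x) - 1 - \<i> * complex_of_real (t * x))
      + \<i> * complex_of_real (t * x - t * x / (1 + x\<^sup>2))"
    by (simp add: levy_kernel_def algebra_simps)
  have d: "t * x - t * x / (1 + x\<^sup>2) = t * x * (x\<^sup>2 / (1 + x\<^sup>2))"
    by (simp add: field_simps add_nonneg_eq_0_iff)
  have "\<bar>t * x - t * x / (1 + x\<^sup>2)\<bar> \<le> \<bar>t\<bar> * 1 * (x\<^sup>2 / 1)"
  proof -
    have "x\<^sup>2 \<le> x\<^sup>2 * (1 + x\<^sup>2)" by (simp add: algebra_simps)
    then have "x\<^sup>2 / (1 + x\<^sup>2) \<le> x\<^sup>2" by (simp add: divide_le_eq add_pos_nonneg)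
    then show ?thesis unfolding d abs_mult using True by (intro mult_mono) (auto simp: abs_divide)
  qed
  then have "norm (levy_kernel t x) \<le> (t * x)\<^sup>2 / 2 + \<bar>t\<bar> * x\<^sup>2"
    unfolding e using iexp_linear_le[of "t * x"]
    by (intro order_trans[OF norm_triangle_ineq] add_mono) (auto simp: norm_mult simp del: of_real_diff)
  also have "\<dots> \<le> (t\<^sup>2 / 2 + \<bar>t\<bar> + 2) * x\<^sup>2"
    by (simp add: algebra_simps power_mult_distrib)
  finally show ?thesis using x1 by (simp add: min_def)
next
  case False
  then have x1: "1 \<le> x\<^sup>2" using abs_le_square_iff[of 1 x] by simp
  have "\<bar>x\<bar> \<le> 1 + x\<^sup>2"
    using zero_le_power2[of "1 - \<bar>x\<bar>"] abs_ge_zero[of x] by (simp add: power2_diff)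
  then have "\<bar>t\<bar> * (\<bar>x\<bar> / (1 + x\<^sup>2)) \<le> \<bar>t\<bar> * 1"
    by (intro mult_left_mono) (auto simp: divide_le_eq add_pos_nonneg)
  then have b: "norm (\<i> * complex_of_real (t * x / (1 + x\<^sup>2))) \<le> \<bar>t\<bar>"
    by (simp add: norm_mult abs_mult del: of_real_divide of_real_mult)
  have "norm (levy_kernel t x) \<le> 2 + \<bar>t\<bar>"
    unfolding levy_kernel_def
    by (rule order_trans[OF norm_triangle_ineq4 add_mono[OF iexp_minus_one_le2 b]])
  also have "\<dots> \<le> t\<^sup>2 / 2 + \<bar>t\<bar> + 2" by simp
  finally show ?thesis using x1 by simp
qed

locale levy_exponent =
  fixes \<gamma> \<sigma>2 :: real and L :: "real \<Rightarrow> real" and \<nu> :: "real measure"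
  assumes s2_nonneg: "\<sigma>2 \<ge> 0" and L_mono: "mono_on {0<..} L" and L_lim: "(L \<longlongrightarrow> 0) at_top"
    and stj: "stieltjes_pos L \<nu>"
    and fin2: "\<And>\<tau>. \<tau> > 0 \<Longrightarrow> (\<integral>\<^sup>+x\<in>{0<..<\<tau>}. ennreal (x\<^sup>2) \<partial>\<nu>) < \<infinity>"
begin

lemma sets_nu [measurable_cong, simp]: "sets \<nu> = sets borel"
  using stj by (simp add: stieltjes_pos_def)

lemma space_nu [simp]: "space \<nu> = UNIV"
  using sets_eq_imp_space_eq[OF sets_nu] by simp

lemma AE_nu_pos: "AE x in \<nu>. 0 < x"
proof (rule AE_I[of _ _ "{..0}"])
  show "emeasure \<nu> {..0} = 0" using stj by (simp add: stieltjes_pos_def)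
qed auto

text \<open>Continuity from below, with \<open>L\<close> vanishing at infinity, identifies
  \<open>- L\<close> as the tail function of the jump measure.\<close>

lemma emeasure_nu_tail:
  assumes "x > 0"
  shows "emeasure \<nu> {x<..} = ennreal (- L x)"
proof -
  have "(\<Union>n::nat. {x<..x + real n}) = {x<..}"
  proof safe
    fix y assume "x < y"
    moreover obtain n :: nat where "y - x \<le> real n" using real_arch_simple by blast
    ultimately show "y \<in> (\<Union>n::nat. {x<..x + real n})" by (auto intro!: exI[of _ n])
  qed auto
  moreover have "(\<lambda>n. emeasure \<nu> {x<..x + real n}) \<longlonglongrightarrow> emeasure \<nu> (\<Union>n::nat. {x<..x + real n})"
    by (rule Lim_emeasure_incseq) (auto simp: incseq_def)
  ultimately have 1: "(\<lambda>n. emeasure \<nu> {x<..x + real n}) \<longlonglongrightarrow> emeasure \<nu> {x<..}" by simp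
  have 2: "(\<lambda>n. emeasure \<nu> {x<..x + real n}) = (\<lambda>n. ennreal (L (x + real n) - L x))"
    using stj assms by (auto simp: stieltjes_pos_def fun_eq_iff)
  have "(\<lambda>n. ennreal (L (x + real n) - L x)) \<longlonglongrightarrow> ennreal (0 - L x)"
  proof (intro tendsto_ennrealI tendsto_diff tendsto_const)
    have "filterlim (\<lambda>n. x + real n) at_top sequentially"
      by (intro filterlim_tendsto_add_at_top[OF tendsto_const] filterlim_real_sequentially)
    from filterlim_compose[OF L_lim this] show "(\<lambda>n. L (x + real n)) \<longlonglongrightarrow> 0" .
  qed
  from LIMSEQ_unique[OF 1[unfolded 2] this] show ?thesis by simp
qed

lemma L_nonpos:
  assumes "x > 0" shows "L x \<le> 0"
proof (rule tendsto_lowerbound[OF L_lim])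
  show "\<forall>\<^sub>F y in at_top. L x \<le> L y"
    using eventually_ge_at_top[of x] by eventually_elim (use L_mono assms in \<open>auto simp: mono_on_def\<close>)
qed simp

lemma measure_nu_tail: "x > 0 \<Longrightarrow> measure \<nu> {x<..} = - L x"
  using emeasure_nu_tail[of x] L_nonpos[of x] by (simp add: measure_def)

lemma integrable_min: "integrable \<nu> (\<lambda>x. min 1 (x\<^sup>2))"
proof (rule integrableI_bounded)
  have "(\<integral>\<^sup>+x. ennreal (norm (min 1 (x\<^sup>2))) \<partial>\<nu>)
    \<le> (\<integral>\<^sup>+x. ennreal (x\<^sup>2) * indicator {0<..<2} x + indicator {1<..} x \<partial>\<nu>)"
    using AE_nu_pos by (intro nn_integral_mono_AE) (auto elim!: eventually_mono split: split_indicator simp: min_def)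
  also have "\<dots> = (\<integral>\<^sup>+x\<in>{0<..<2}. ennreal (x\<^sup>2) \<partial>\<nu>) + emeasure \<nu> {1<..}"
    by (subst nn_integral_add) auto
  also have "\<dots> < \<infinity>" using fin2[of 2] emeasure_nu_tail[of 1] by simp
  finally show "(\<integral>\<^sup>+x. ennreal (norm (min 1 (x\<^sup>2))) \<partial>\<nu>) < \<infinity>" .
qed measurable

lemma integrable_nu_bound:
  fixes f :: "real \<Rightarrow> 'b::{banach, second_countable_topology}"
  assumes [measurable]: "f \<in> borel_measurable borel" and "\<And>x. x > 0 \<Longrightarrow> norm (f x) \<le> C * min 1 (x\<^sup>2)"
  shows "integrable \<nu> f"
  using Bochner_Integration.integrable_mult_right[OF integrable_min, of C]
proof (rule Bochner_Integration.integrable_bound)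
  show "AE x in \<nu>. norm (f x) \<le> norm (C * min 1 (x\<^sup>2))"
    using AE_nu_pos by eventually_elim (use assms(2) order_trans[OF _ abs_ge_self] in auto)
qed measurable

lemma sigma_finite_nu: "sigma_finite_measure \<nu>"
proof
  let ?A = "insert {..0} (range (\<lambda>n. {1 / real (Suc n) <..}))"
  have "x \<in> \<Union> ?A" for x
  proof (cases "x \<le> 0")
    case False
    then obtain n where "1 / real (Suc n) < x" using reals_Archimedean[of x] by (auto simp: inverse_eq_divide)
    then show ?thesis by auto
  qed auto
  then have "\<Union> ?A = space \<nu>" by auto
  moreover have "\<forall>a\<in>?A. emeasure \<nu> a \<noteq> \<infinity>"
    using stj by (auto simp: emeasure_nu_tail stieltjes_pos_def)
  ultimately show "\<exists>A. countable A \<and> A \<subseteq> sets \<nu> \<and> \<Union> A = space \<nu> \<and> (\<forall>a\<in>A. emeasure \<nu> a \<noteq> \<infinity>)"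
    by (intro exI[of _ ?A]) auto
qed

definition psi :: "real \<Rightarrow> complex" where
  "psi t = \<i> * complex_of_real (\<gamma> * t) - complex_of_real (\<sigma>2 * t\<^sup>2 / 2) + (CLINT x|\<nu>. levy_kernel t x)"

lemma integrable_levy_kernel: "complex_integrable \<nu> (levy_kernel t)"
  by (rule integrable_nu_bound[OF _ norm_levy_kernel_le]) measurable

lemma isCont_psi: "isCont psi t"
proof -
  have "isCont (\<lambda>t. CLINT x|\<nu>. levy_kernel t x) t"
    unfolding continuous_at_sequentially comp_def
  proof (intro allI impI)
    fix u :: "nat \<Rightarrow> real" assume u: "u \<longlonglongrightarrow> t"
    then obtain B where B: "\<And>n. \<bar>u n\<bar> \<le> B"
      using convergent_imp_Bseq[of u] by (auto simp: convergent_def Bseq_def)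
    have B0: "B \<ge> 0" using B[of 0] by simp
    show "(\<lambda>n. CLINT x|\<nu>. levy_kernel (u n) x) \<longlonglongrightarrow> (CLINT x|\<nu>. levy_kernel t x)"
    proof (rule integral_dominated_convergence[where w="\<lambda>x. (B\<^sup>2/2 + B + 2) * min 1 (x\<^sup>2)"])
      show "integrable \<nu> (\<lambda>x. (B\<^sup>2 / 2 + B + 2) * min 1 (x\<^sup>2))"
        by (rule Bochner_Integration.integrable_mult_right[OF integrable_min])
      show "AE x in \<nu>. (\<lambda>n. levy_kernel (u n) x) \<longlonglongrightarrow> levy_kernel t x"
        unfolding levy_kernel_def by (intro AE_I2 tendsto_intros u) (auto simp: add_nonneg_eq_0_iff)
      show "AE x in \<nu>. norm (levy_kernel (u n) x) \<le> (B\<^sup>2 / 2 + B + 2) * min 1 (x\<^sup>2)" for n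
      proof (rule AE_I2, rule order_trans[OF norm_levy_kernel_le], rule mult_right_mono)
        have "(u n)\<^sup>2 \<le> B\<^sup>2" using B[of n] B0 by (simp add: abs_le_square_iff[symmetric])
        then show "(u n)\<^sup>2 / 2 + \<bar>u n\<bar> + 2 \<le> B\<^sup>2 / 2 + B + 2" using B[of n] by simp
      qed simp
    qed measurable
  qed
  then show ?thesis
    unfolding psi_def[abs_def] by (intro continuous_intros) auto
qed

lemma psi_0: "psi 0 = 0"
  by (simp add: psi_def levy_kernel_def)

text \<open>Second differences annihilate whatever is linear in \<open>t\<close>, that is, the drift
  and the compensator; the Gaussian part and a nonnegative weight remain.\<close>

lemma psi_second_difference:
  "psi t - (psi (t + s) + psi (t - s)) / 2 = complex_of_real (\<sigma>2 * s\<^sup>2 / 2)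
    + (CLINT x|\<nu>. iexp (t * x) * complex_of_real (1 - cos (s * x)))"
proof -
  have k: "levy_kernel t x - (levy_kernel (t + s) x + levy_kernel (t - s) x) / 2
      = iexp (t * x) * complex_of_real (1 - cos (s * x))" for x
  proof -
    have "(t + s) * x / (1 + x\<^sup>2) + (t - s) * x / (1 + x\<^sup>2) = 2 * (t * x / (1 + x\<^sup>2))"
      by (simp add: add_divide_distrib[symmetric] algebra_simps)
    from arg_cong[OF this, of complex_of_real]
    have q: "complex_of_real ((t + s) * x / (1 + x\<^sup>2)) + complex_of_real ((t - s) * x / (1 + x\<^sup>2))
        = 2 * complex_of_real (t * x / (1 + x\<^sup>2))"
      by (simp only: of_real_add of_real_mult of_real_numeral)
    have alg: "A - 1 - \<i> * q - ((B - 1 - \<i> * q1) + (C - 1 - \<i> * q2)) / 2 = A - (B + C) / 2"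
      if "q1 + q2 = 2 * q" for A B C q q1 q2 :: complex
    proof -
      have q1: "q1 = 2 * q - q2" using that by (simp add: algebra_simps)
      show ?thesis unfolding q1 by (simp add: field_simps)
    qed
    show ?thesis
      unfolding iexp_second_difference[symmetric] levy_kernel_def by (rule alg[OF q])
  qed
  have "(CLINT x|\<nu>. levy_kernel t x - (levy_kernel (t + s) x + levy_kernel (t - s) x) / 2)
    = (CLINT x|\<nu>. levy_kernel t x) - ((CLINT x|\<nu>. levy_kernel (t + s) x) + (CLINT x|\<nu>. levy_kernel (t - s) x)) / 2"
    by (simp add: integrable_levy_kernel)
  then have I: "(CLINT x|\<nu>. levy_kernel t x) - ((CLINT x|\<nu>. levy_kernel (t + s) x) + (CLINT x|\<nu>. levy_kernel (t - s) x)) / 2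
    = (CLINT x|\<nu>. iexp (t * x) * complex_of_real (1 - cos (s * x)))"
    unfolding k by (rule sym)
  define p where "p t = \<i> * complex_of_real (\<gamma> * t) - complex_of_real (\<sigma>2 * t\<^sup>2 / 2)" for t
  have P: "p t - (p (t + s) + p (t - s)) / 2 = complex_of_real (\<sigma>2 * s\<^sup>2 / 2)"
  proof (rule complex_eqI)
    have R: "Re (p u) = - (\<sigma>2 * u\<^sup>2 / 2)" and I: "Im (p u) = \<gamma> * u" for u by (simp_all add: p_def)
    have "- (\<sigma>2 * t\<^sup>2 / 2) - (- (\<sigma>2 * (t + s)\<^sup>2 / 2) + - (\<sigma>2 * (t - s)\<^sup>2 / 2)) / 2 = \<sigma>2 * s\<^sup>2 / 2"
      by (simp add: power2_eq_square field_simps)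
    then show "Re (p t - (p (t + s) + p (t - s)) / 2) = Re (complex_of_real (\<sigma>2 * s\<^sup>2 / 2))"
      by (simp only: minus_complex.sel plus_complex.sel Re_divide_numeral R Re_complex_of_real)
    have "\<gamma> * t - (\<gamma> * (t + s) + \<gamma> * (t - s)) / 2 = 0"
      by (simp add: field_simps)
    then show "Im (p t - (p (t + s) + p (t - s)) / 2) = Im (complex_of_real (\<sigma>2 * s\<^sup>2 / 2))"
      by (simp only: minus_complex.sel plus_complex.sel Im_divide_numeral I Im_complex_of_real)
  qed
  have alg: "(q + i) - ((q1 + i1) + (q2 + i2)) / 2 = (q - (q1 + q2) / 2) + (i - (i1 + i2) / 2)"
    for q q1 q2 i i1 i2 :: complex by (simp add: field_simps)
  show ?thesis
    unfolding psi_def p_def[symmetric] alg P I ..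
qed

text \<open>The right-hand side is the characteristic function of a finite measure: an atom
  \<open>\<sigma>2 / 6\<close> at 0 plus the jump measure with density \<open>wt\<close>.\<close>

lemma integral_psi_second_difference:
  "(CLINT s|unif. psi t - (psi (t + s) + psi (t - s)) / 2)
    = complex_of_real (\<sigma>2 / 6) + (CLINT x|\<nu>. iexp (t * x) * complex_of_real (wt x))"
proof -
  have [measurable]: "psi \<in> borel_measurable borel"
    by (intro borel_measurable_continuous_onI continuous_at_imp_continuous_on ballI isCont_psi)
  have i1: "integrable unif (\<lambda>s. \<sigma>2 * s\<^sup>2 / 2)"
  proof (rule unif.integrable_const_bound[of _ "\<sigma>2"])
    show "AE s in unif. norm (\<sigma>2 * s\<^sup>2 / 2) \<le> \<sigma>2"
      using AE_unif
    proof eventually_elim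
      case (elim s)
      then have "s\<^sup>2 \<le> 1" by (simp add: abs_square_le_1)
      then have "\<sigma>2 * s\<^sup>2 \<le> \<sigma>2 * 1" using s2_nonneg by (intro mult_left_mono) auto
      then show ?case using s2_nonneg by simp
    qed
  qed measurable
  \<comment> \<open>Measurability in \<open>s\<close> is read off the preceding identity: the
    integral is a combination of values of the continuous function \<open>psi\<close> and a
    polynomial.\<close>
  have m: "(\<lambda>s. CLINT x|\<nu>. iexp (t * x) * complex_of_real (1 - cos (s * x))) \<in> borel_measurable unif"
  proof -
    have "(\<lambda>s. psi t - (psi (t + s) + psi (t - s)) / 2 - complex_of_real (\<sigma>2 * s\<^sup>2 / 2)) \<in> borel_measurable unif"
      by measurable
    then show ?thesis unfolding psi_second_difference by simp
  qed
  have i2: "complex_integrable unif (\<lambda>s. CLINT x|\<nu>. iexp (t * x) * complex_of_real (1 - cos (s * x)))"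
  proof (rule unif.integrable_const_bound[of _ "\<integral>x. 2 * min 1 (x\<^sup>2) \<partial>\<nu>", OF _ m])
    show "AE s in unif. norm (CLINT x|\<nu>. iexp (t * x) * complex_of_real (1 - cos (s * x))) \<le> (\<integral>x. 2 * min 1 (x\<^sup>2) \<partial>\<nu>)"
      using AE_unif
    proof eventually_elim
      case (elim s)
      have b: "norm (iexp (t * x) * complex_of_real (1 - cos (s * x))) \<le> 2 * min 1 (x\<^sup>2)" for x
      proof -
        have "s\<^sup>2 * x\<^sup>2 \<le> 1 * x\<^sup>2" using elim by (intro mult_right_mono) (auto simp: abs_square_le_1)
        then have "1 - cos (s * x) \<le> 2 * x\<^sup>2"
          using one_minus_cos_le_square[of "s * x"] zero_le_power2[of x] by (simp only: power_mult_distrib)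
        then have "1 - cos (s * x) \<le> 2 * min 1 (x\<^sup>2)"
          using cos_ge_minus_one[of "s * x"] by (simp add: min_def)
        then show ?thesis by (simp add: norm_mult del: of_real_diff)
      qed
      have "complex_integrable \<nu> (\<lambda>x. iexp (t * x) * complex_of_real (1 - cos (s * x)))"
        by (rule integrable_nu_bound[OF _ b]) measurable
      then show ?case
        by (rule Bochner_Integration.integral_norm_bound_integral[OF _ Bochner_Integration.integrable_mult_right[OF integrable_min]]) (use b in auto)
    qed
  qed
  have "(CLINT s|unif. psi t - (psi (t + s) + psi (t - s)) / 2)
     = (CLINT s|unif. complex_of_real (\<sigma>2 * s\<^sup>2 / 2)) + (CLINT x|\<nu>. iexp (t * x) * complex_of_real (wt x))"
    unfolding psi_second_difference integral_wt_iexp[OF sigma_finite_nu sets_nu integrable_min, symmetric]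
    by (rule Bochner_Integration.integral_add[OF integrable_of_real[OF i1] i2])
  also have "(CLINT s|unif. complex_of_real (\<sigma>2 * s\<^sup>2 / 2)) = complex_of_real (\<sigma>2 / 6)"
  proof -
    have "(LINT s|unif. \<sigma>2 * s\<^sup>2 / 2) = \<sigma>2 / 6" using integral_unif_square by simp
    then show ?thesis by (simp only: integral_complex_of_real)
  qed
  finally show ?thesis .
qed

text \<open>The right-hand side of condition (B): the drift that belongs to sharp truncation at
  \<open>\<tau>\<close> in place of the smooth compensator \<open>x / (1 + x^2)\<close>.\<close>

definition levy_shift :: "real \<Rightarrow> real" where
  "levy_shift \<tau> = \<gamma> + (LINT x:{0<..\<tau>}|\<nu>. x ^ 3 / (1 + x\<^sup>2)) - (LINT x:{\<tau><..}|\<nu>. x / (1 + x\<^sup>2))"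

lemma set_integral_nu_eq: "(LINT x:A|\<nu>. f x) = (LINT x|\<nu>. indicator A x * (f x :: real))"
  by (simp add: set_lebesgue_integral_def)

lemma cube_ratio_bound:
  fixes x u :: real
  assumes "0 < x" "x \<le> u"
  shows "\<bar>x ^ 3 / (1 + x\<^sup>2)\<bar> \<le> (1 + u) * min 1 (x\<^sup>2)"
proof -
  have p: "0 < 1 + x\<^sup>2" by (simp add: add_pos_nonneg)
  have e: "x^3 = x * x\<^sup>2" by (simp add: eval_nat_numeral)
  have x2: "0 \<le> x\<^sup>2" by simp
  have "x * x\<^sup>2 \<le> x * (1 + x\<^sup>2)" using assms by (intro mult_left_mono) auto
  then have "x^3 / (1 + x\<^sup>2) \<le> x" using p by (simp add: divide_le_eq e)
  moreover have "x^3 / (1 + x\<^sup>2) \<le> x^3 / 1"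
    using assms by (intro divide_left_mono) (auto simp: add_pos_nonneg)
  moreover have "x * x\<^sup>2 \<le> u * x\<^sup>2" using assms x2 by (intro mult_right_mono) auto
  ultimately have "x^3 / (1 + x\<^sup>2) \<le> 1 + u" "x^3 / (1 + x\<^sup>2) \<le> (1 + u) * x\<^sup>2"
    using assms x2 unfolding e distrib_right by linarith+
  moreover have n: "0 \<le> x^3 / (1 + x\<^sup>2)" using assms p by (intro divide_nonneg_pos) auto
  ultimately show ?thesis unfolding abs_of_nonneg[OF n] by (simp add: min_def)
qed

lemma linear_ratio_bound:
  fixes x u :: real
  assumes "0 < u" "u < x"
  shows "\<bar>x / (1 + x\<^sup>2)\<bar> \<le> (1 + 1/u\<^sup>2) * min 1 (x\<^sup>2)"
proof -
  have x: "x > 0" using assms by simp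
  have p: "0 < 1 + x\<^sup>2" by (simp add: add_pos_nonneg)
  have "0 \<le> (1 - x)\<^sup>2" by simp
  then have "x \<le> 1 + x\<^sup>2" using x by (simp add: power2_diff)
  then have 1: "x / (1 + x\<^sup>2) \<le> 1" using p by (simp add: divide_le_eq)
  have "u\<^sup>2 \<le> x\<^sup>2" using assms by (intro power_mono) auto
  then have "1 \<le> (1/u\<^sup>2) * x\<^sup>2" using assms by (simp add: field_simps)
  then have 2: "1 \<le> (1 + 1/u\<^sup>2) * x\<^sup>2" unfolding distrib_right using zero_le_power2[of x] by linarith
  have 3: "0 \<le> x / (1 + x\<^sup>2)" "1 \<le> 1 + 1/u\<^sup>2" using x p by auto
  show ?thesis
    unfolding min_def abs_of_nonneg[OF 3(1)]
    using order_trans[OF 1 2] order_trans[OF 1 3(2)] by simp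
qed

lemma integrable_cube_ratio:
  assumes "0 \<le> a"
  shows "integrable \<nu> (\<lambda>x. indicator {a<..b} x * (x^3 / (1 + x\<^sup>2)))"
proof (rule integrable_nu_bound[where C="1 + \<bar>b\<bar>"])
  fix x :: real assume "x > 0"
  then show "norm (indicator {a<..b} x * (x^3 / (1 + x\<^sup>2))) \<le> (1 + \<bar>b\<bar>) * min 1 (x\<^sup>2)"
    using cube_ratio_bound[of x "\<bar>b\<bar>"] by (cases "x \<in> {a<..b}") auto
qed measurable

lemma integrable_linear_ratio:
  assumes "0 < a" "\<And>x. x \<in> A \<Longrightarrow> a < x" "A \<in> sets borel"
  shows "integrable \<nu> (\<lambda>x. indicator A x * (x / (1 + x\<^sup>2)))"
proof (rule integrable_nu_bound[where C="1 + 1/a\<^sup>2"])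
  fix x :: real assume "x > 0"
  then show "norm (indicator A x * (x / (1 + x\<^sup>2))) \<le> (1 + 1/a\<^sup>2) * min 1 (x\<^sup>2)"
    using linear_ratio_bound[of a x] assms by (cases "x \<in> A") auto
qed (use assms in measurable)

lemma cube_plus_linear_ratio: "x^3 / (1 + x\<^sup>2) + x / (1 + x\<^sup>2) = (x::real)"
proof -
  have p: "1 + x\<^sup>2 \<noteq> 0" by (simp add: add_nonneg_eq_0_iff)
  have "x^3 + x = x * (1 + x\<^sup>2)" by (simp add: algebra_simps eval_nat_numeral)
  then show ?thesis using p by (simp add: add_divide_distrib[symmetric])
qed

text \<open>Moving the threshold from \<open>\<delta>\<close> to \<open>\<tau>\<close> adds the
  first quotient on the strip between them and stops subtracting the second one there; together the
  two quotients make \<open>x\<close>.\<close>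

lemma levy_shift_diff:
  assumes "0 < \<delta>" "\<delta> < \<tau>"
  shows "levy_shift \<tau> = levy_shift \<delta> + (LINT x:{\<delta><..\<tau>}|\<nu>. x)"
proof -
  have e1: "indicator {0<..\<tau>} x * c = indicator {0<..\<delta>} x * c + indicator {\<delta><..\<tau>} x * c" for x c :: real
    using assms by (auto split: split_indicator)
  have e2: "indicator {\<delta><..} x * c = indicator {\<tau><..} x * c + indicator {\<delta><..\<tau>} x * c" for x c :: real
    using assms by (auto split: split_indicator)
  have e3: "indicator {\<delta><..\<tau>} x * x = indicator {\<delta><..\<tau>} x * (x^3 / (1 + x\<^sup>2)) + indicator {\<delta><..\<tau>} x * (x / (1 + x\<^sup>2))" for x
    unfolding distrib_left[symmetric] cube_plus_linear_ratio ..
  have i: "integrable \<nu> (\<lambda>x. indicator {0<..\<delta>} x * (x^3 / (1 + x\<^sup>2)))"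
    "integrable \<nu> (\<lambda>x. indicator {\<delta><..\<tau>} x * (x^3 / (1 + x\<^sup>2)))"
    "integrable \<nu> (\<lambda>x. indicator {\<tau><..} x * (x / (1 + x\<^sup>2)))"
    "integrable \<nu> (\<lambda>x. indicator {\<delta><..\<tau>} x * (x / (1 + x\<^sup>2)))"
    using assms by (rule_tac integrable_cube_ratio integrable_linear_ratio[of \<delta>]; force)+
  show ?thesis
    unfolding levy_shift_def set_integral_nu_eq e1[of _ "_ / _"] e2 e3
      Bochner_Integration.integral_add[OF i(1,2)] Bochner_Integration.integral_add[OF i(3,4)]
      Bochner_Integration.integral_add[OF i(2,4)]
    by simp
qed

text \<open>Jumps up to \<open>\<delta>\<close> are dropped and the drift is that of truncation at
  \<open>\<delta>\<close>. The exponents of the rows of an array expand into this shape.\<close>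

definition levy_main :: "real \<Rightarrow> real \<Rightarrow> complex" where
  "levy_main \<delta> t = \<i> * complex_of_real (t * levy_shift \<delta>) - complex_of_real (\<sigma>2 * t\<^sup>2 / 2)
    + (CLINT x|\<nu>. indicator {\<delta><..} x * (iexp (t * x) - 1))"

text \<open>Once the smooth compensator is exchanged for truncation at \<open>\<delta>\<close>,
  jumps above \<open>\<delta>\<close> match exactly, and those below leave the second-order
  remainder of the exponential.\<close>

lemma psi_levy_main:
  assumes "0 < \<delta>"
  shows "norm (psi t - levy_main \<delta> t) \<le> t\<^sup>2 / 2 * (LINT x|\<nu>. indicator {0<..\<delta>} x * x\<^sup>2)"
proof -
  let ?f = "\<lambda>x. indicator {0<..\<delta>} x * (x^3 / (1 + x\<^sup>2)) :: real"
  let ?g = "\<lambda>x. indicator {\<delta><..} x * (x / (1 + x\<^sup>2)) :: real"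
  let ?h = "\<lambda>x. indicator {\<delta><..} x * (iexp (t * x) - 1)"
  let ?k = "\<lambda>x. indicator {0<..\<delta>} x * (iexp (t * x) - 1 - \<i> * complex_of_real (t * x))"
  have f: "integrable \<nu> ?f" by (rule integrable_cube_ratio) simp
  have g: "integrable \<nu> ?g" by (rule integrable_linear_ratio[OF assms]) auto
  have h: "complex_integrable \<nu> ?h"
  proof (rule integrable_nu_bound[where C="2 + 2/\<delta>\<^sup>2"])
    fix x :: real assume x: "x > 0"
    show "norm (?h x) \<le> (2 + 2/\<delta>\<^sup>2) * min 1 (x\<^sup>2)"
    proof (cases "x > \<delta>")
      case True
      then have "\<delta>\<^sup>2 \<le> x\<^sup>2" using assms by (intro power_mono) auto
      then have "2 \<le> (2/\<delta>\<^sup>2) * x\<^sup>2" using assms by (simp add: field_simps)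
      then have "2 \<le> (2 + 2/\<delta>\<^sup>2) * x\<^sup>2" unfolding distrib_right using zero_le_power2[of x] by linarith
      moreover have "(2::real) \<le> 2 + 2/\<delta>\<^sup>2" by simp
      ultimately have "2 \<le> (2 + 2/\<delta>\<^sup>2) * min 1 (x\<^sup>2)" by (simp add: min_def)
      then show ?thesis using True iexp_minus_one_le2[of "t * x"] by (simp add: norm_mult)
    qed (simp add: min_def)
  qed measurable
  have q: "integrable \<nu> (\<lambda>x. indicator {0<..\<delta>} x * x\<^sup>2)"
  proof (rule integrable_nu_bound[where C="1 + \<delta>\<^sup>2"])
    fix x :: real assume x: "x > 0"
    show "norm (indicator {0<..\<delta>} x * x\<^sup>2) \<le> (1 + \<delta>\<^sup>2) * min 1 (x\<^sup>2)"
    proof (cases "x \<le> \<delta>")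
      case True
      then have "x\<^sup>2 \<le> \<delta>\<^sup>2" using x by (intro power_mono) auto
      then have a: "x\<^sup>2 \<le> 1 + \<delta>\<^sup>2" by simp
      have b: "x\<^sup>2 \<le> (1 + \<delta>\<^sup>2) * x\<^sup>2" by (simp add: distrib_right)
      show ?thesis using True x a b by (simp add: min_def)
    qed (simp add: min_def indicator_def)
  qed measurable
  have kb: "norm (?k x) \<le> t\<^sup>2 / 2 * (indicator {0<..\<delta>} x * x\<^sup>2)" for x
    using iexp_linear_le[of "t * x"] by (auto simp: norm_mult power_mult_distrib split: split_indicator)
  have k: "complex_integrable \<nu> ?k"
    by (rule Bochner_Integration.integrable_bound[OF Bochner_Integration.integrable_mult_right[OF q, of "t\<^sup>2 / 2"]])
      (measurable, rule AE_I2, metis kb abs_ge_self order_trans real_norm_def)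
  have pt: "levy_kernel t x - ?h x - \<i> * t * complex_of_real (?f x) + \<i> * t * complex_of_real (?g x) = ?k x"
    if x: "x > 0" for x
  proof (cases "x \<le> \<delta>")
    case True
    have "t * x = t * (x / (1 + x\<^sup>2)) + t * (x^3 / (1 + x\<^sup>2))"
      using cube_plus_linear_ratio[of x] by (simp only: distrib_left[symmetric] add.commute)
    from arg_cong[OF this, of complex_of_real]
    have "complex_of_real (t * x) = complex_of_real (t * (x / (1 + x\<^sup>2))) + complex_of_real (t * (x^3 / (1 + x\<^sup>2)))"
      by (simp only: of_real_add)
    also have "t * (x / (1 + x\<^sup>2)) = t * x / (1 + x\<^sup>2)" by simp
    also have "complex_of_real (t * (x^3 / (1 + x\<^sup>2))) = t * complex_of_real (x^3 / (1 + x\<^sup>2))"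
      by (rule of_real_mult)
    finally show ?thesis using True x unfolding levy_kernel_def
      by (simp add: algebra_simps del: of_real_divide of_real_mult of_real_power of_real_add)
  next
    case False
    then show ?thesis using x assms by (simp add: levy_kernel_def)
  qed
  have "psi t - levy_main \<delta> t = (CLINT x|\<nu>. levy_kernel t x) - (CLINT x|\<nu>. ?h x)
     - \<i> * t * complex_of_real (LINT x|\<nu>. ?f x) + \<i> * t * complex_of_real (LINT x|\<nu>. ?g x)"
    unfolding psi_def levy_main_def levy_shift_def set_integral_nu_eq by (simp add: algebra_simps)
  also have "\<dots> = (CLINT x|\<nu>. levy_kernel t x - ?h x - \<i> * t * complex_of_real (?f x) + \<i> * t * complex_of_real (?g x))"
  proof -
    have f': "complex_integrable \<nu> (\<lambda>x. \<i> * t * complex_of_real (?f x))"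
      by (intro integrable_mult_right integrable_of_real f)
    have g': "complex_integrable \<nu> (\<lambda>x. \<i> * t * complex_of_real (?g x))"
      by (intro integrable_mult_right integrable_of_real g)
    show ?thesis
      unfolding Bochner_Integration.integral_add[OF Bochner_Integration.integrable_diff[OF Bochner_Integration.integrable_diff[OF integrable_levy_kernel h] f'] g']
        Bochner_Integration.integral_diff[OF Bochner_Integration.integrable_diff[OF integrable_levy_kernel h] f']
        Bochner_Integration.integral_diff[OF integrable_levy_kernel h]
        integral_mult_right_zero integral_complex_of_real ..
  qed
  also have "\<dots> = (CLINT x|\<nu>. ?k x)"
    by (rule integral_cong_AE) (measurable, use AE_nu_pos in eventually_elim, rule pt)
  finally have "norm (psi t - levy_main \<delta> t) = norm (CLINT x|\<nu>. ?k x)" by simp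
  also have "\<dots> \<le> (LINT x|\<nu>. t\<^sup>2 / 2 * (indicator {0<..\<delta>} x * x\<^sup>2))"
    by (rule Bochner_Integration.integral_norm_bound_integral[OF k Bochner_Integration.integrable_mult_right[OF q]]) (use kb in auto)
  finally show ?thesis by simp
qed

lemma small_jumps_tendsto: "((\<lambda>\<delta>. LINT x|\<nu>. indicator {0<..\<delta>} x * x\<^sup>2) \<longlongrightarrow> 0) (at_right 0)"
proof (rule tendsto_at_right_sequentially[of 0 1])
  fix u :: "nat \<Rightarrow> real" assume u: "\<And>n. 0 < u n" "\<And>n. u n < 1" "decseq u" "u \<longlonglongrightarrow> 0"
  have "(\<lambda>n. LINT x|\<nu>. indicator {0<..u n} x * x\<^sup>2) \<longlonglongrightarrow> (LINT x|\<nu>. 0)"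
  proof (rule integral_dominated_convergence[where w="\<lambda>x. min 1 (x\<^sup>2)", OF _ _ integrable_min])
    show "AE x in \<nu>. (\<lambda>n. indicator {0<..u n} x * x\<^sup>2) \<longlonglongrightarrow> 0"
      using AE_nu_pos
    proof eventually_elim
      case (elim x)
      have "\<forall>\<^sub>F n in sequentially. indicator {0<..u n} x * x\<^sup>2 = 0"
        using order_tendstoD(2)[OF u(4) elim] by eventually_elim (auto simp: indicator_def)
      then show ?case by (rule tendsto_eventually)
    qed
    show "AE x in \<nu>. norm (indicator {0<..u n} x * x\<^sup>2) \<le> min 1 (x\<^sup>2)" for n
      using AE_nu_pos
    proof eventually_elim
      case (elim x)
      show ?case
      proof (cases "x \<le> u n")
        case True
        then have "x\<^sup>2 \<le> 1" using elim u(2)[of n] by (simp add: power_le_one)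
        then show ?thesis by (auto split: split_indicator)
      qed (auto simp: indicator_def)
    qed
  qed measurable
  then show "(\<lambda>n. LINT x|\<nu>. indicator {0<..u n} x * x\<^sup>2) \<longlonglongrightarrow> 0" by simp
qed simp

end

section \<open>Truncated moments of a nonnegative random variable\<close>

lemma integrable_measure_pmf_bounded:
  fixes f :: "'a \<Rightarrow> 'b::{banach, second_countable_topology}"
  assumes "\<And>x. x \<in> set_pmf p \<Longrightarrow> norm (f x) \<le> B"
  shows "integrable (measure_pmf p) f"
  by (rule measure_pmf.integrable_const_bound[of _ B]) (auto simp: AE_measure_pmf_iff assms)

abbreviation E :: "'a pmf \<Rightarrow> ('a \<Rightarrow> 'b::{banach, second_countable_topology}) \<Rightarrow> 'b" where
  "E p f \<equiv> integral\<^sup>L (measure_pmf p) f"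

lemma expectation_mono:
  fixes f g :: "'a \<Rightarrow> real"
  assumes "integrable (measure_pmf p) f" "integrable (measure_pmf p) g" "\<And>x. x \<in> set_pmf p \<Longrightarrow> f x \<le> g x"
  shows "E p f \<le> E p g"
  by (rule integral_mono_AE) (use assms in \<open>auto simp: AE_measure_pmf_iff\<close>)

lemma norm_expectation_le:
  fixes f :: "'a \<Rightarrow> 'b::{banach, second_countable_topology}"
  assumes "integrable (measure_pmf p) g" "\<And>x. x \<in> set_pmf p \<Longrightarrow> norm (f x) \<le> g x"
  shows "norm (E p f) \<le> E p g"
proof -
  have "integrable (measure_pmf p) f"
    by (rule Bochner_Integration.integrable_bound[OF assms(1)])
      (use assms(2) in \<open>auto simp: AE_measure_pmf_iff intro: order_trans[OF _ abs_ge_self]\<close>)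
  then have "norm (E p f) \<le> E p (\<lambda>x. norm (f x))" by (intro integral_norm_bound)
  also have "\<dots> \<le> E p g"
    by (rule integral_mono_AE) (use \<open>integrable (measure_pmf p) f\<close> assms in \<open>auto simp: AE_measure_pmf_iff\<close>)
  finally show ?thesis .
qed

definition tailp :: "real pmf \<Rightarrow> real \<Rightarrow> real" where
  "tailp p \<tau> = measure_pmf.prob p {\<tau><..}"

definition trm1 :: "real pmf \<Rightarrow> real \<Rightarrow> real" where
  "trm1 p \<tau> = E p (\<lambda>x. indicator {..\<tau>} x * x)"

definition trm2 :: "real pmf \<Rightarrow> real \<Rightarrow> real" where
  "trm2 p \<tau> = E p (\<lambda>x. indicator {..\<tau>} x * x\<^sup>2)"

text \<open>The variance of the variable after it is set to 0 above \<open>\<tau>\<close>; its row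
  sums are the expressions of condition (C).\<close>

definition trvar :: "real pmf \<Rightarrow> real \<Rightarrow> real" where
  "trvar p \<tau> = trm2 p \<tau> - (trm1 p \<tau>)\<^sup>2"

definition pchar :: "real pmf \<Rightarrow> real \<Rightarrow> complex" where
  "pchar p t = E p (\<lambda>x. iexp (t * x))"

text \<open>Characteristic function minus 1 of the variable centered at its mean truncated at 1.
  Without centering the leading term would be of the size of \<open>trm1\<close>, whose row sums may
  be unbounded.\<close>

definition betac :: "real pmf \<Rightarrow> real \<Rightarrow> complex" where
  "betac p t = E p (\<lambda>x. iexp (t * (x - trm1 p 1))) - 1"

definition spread :: "real pmf \<Rightarrow> real" where
  "spread p = trvar p 1 + tailp p 1"

lemma pchar_eq_char: "pchar p t = char (distr (measure_pmf p) borel (\<lambda>x. x)) t"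
  unfolding pchar_def char_def by (subst integral_distr) auto

lemma integrable_iexp_pmf: "complex_integrable (measure_pmf p) (\<lambda>x. iexp (t * f x))"
  by (rule integrable_measure_pmf_bounded[of _ _ 1]) simp

lemma tailp_eq: "tailp p \<tau> = E p (indicator {\<tau><..})"
  by (simp add: tailp_def)

lemma tailp_nonneg: "0 \<le> tailp p \<tau>"
  by (simp add: tailp_def)

lemma tailp_antimono: "\<sigma> \<le> \<tau> \<Longrightarrow> tailp p \<tau> \<le> tailp p \<sigma>"
  unfolding tailp_def by (rule measure_pmf.finite_measure_mono) auto

lemma norm_one_plus_betac: "norm (1 + betac p t) \<le> 1"
proof -
  have "norm (E p (\<lambda>x. iexp (t * (x - trm1 p 1)))) \<le> E p (\<lambda>x. 1)"
    by (rule norm_expectation_le) auto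
  then show ?thesis by (simp add: betac_def)
qed

text \<open>It gives \<open>|exp (betac p t)| <= 1\<close>, which the telescoping comparison of
  products requires.\<close>

lemma Re_betac: "Re (betac p t) \<le> 0"
  using complex_Re_le_cmod[of "1 + betac p t"] norm_one_plus_betac[of p t] by simp

lemma betac_pchar: "1 + betac p t = iexp (- t * trm1 p 1) * pchar p t"
proof -
  have "iexp (t * (x - trm1 p 1)) = iexp (- t * trm1 p 1) * iexp (t * x)" for x
    by (simp add: exp_add[symmetric] algebra_simps)
  then show ?thesis unfolding betac_def pchar_def
    by (simp only: integral_mult_right_zero) simp
qed

lemma integrable_indicator_iexp:
  "complex_integrable (measure_pmf p) (\<lambda>x. indicator S x * (iexp (t * g x) - 1))"
proof (rule integrable_measure_pmf_bounded[of _ _ 2])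
  show "norm (indicator S x * (iexp (t * g x) - 1)) \<le> 2" for x
    using iexp_minus_one_le2[of "t * g x"] by (cases "x \<in> S") simp_all
qed

text \<open>The mean of \<open>wt\<close> at the difference of two independent copies, written as an
  iterated expectation.\<close>

definition symw :: "real pmf \<Rightarrow> real" where
  "symw p = E p (\<lambda>x. E p (\<lambda>y. wt (x - y)))"

lemma integral_unif_one_minus_cos_pmf:
  fixes f :: "'a \<Rightarrow> real"
  shows "(\<integral>s. E p (\<lambda>y. 1 - cos (s * f y)) \<partial>unif) = E p (\<lambda>y. wt (f y))"
proof -
  let ?K = "distr (measure_pmf p) borel f"
  interpret K: prob_space ?K by (rule measure_pmf.prob_space_distr) simp
  have i: "integrable ?K (\<lambda>x. min 1 (x\<^sup>2))"
    by (rule K.integrable_const_bound[of _ 1]) auto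
  have "(CLINT s|unif. CLINT x|?K. complex_of_real (1 - cos (s * x))) = (CLINT x|?K. complex_of_real (wt x))"
    using integral_wt_iexp[OF K.sigma_finite_measure_axioms _ i, of 0] by simp
  then have "(\<integral>s. \<integral>x. 1 - cos (s * x) \<partial>?K \<partial>unif) = (\<integral>x. wt x \<partial>?K)"
    unfolding integral_complex_of_real of_real_eq_iff .
  then show ?thesis by (simp add: integral_distr)
qed

text \<open>The squared modulus of a characteristic function is the characteristic function of the
  difference of two independent copies, and averaging \<open>1 - cos\<close> yields
  \<open>wt\<close>. Expressing one copy through the real and imaginary parts \<open>C\<close> and
  \<open>S\<close> leaves a bounded integrand in two variables for Fubini.\<close>

lemma integral_unif_pchar: "(\<integral>s. 1 - (norm (pchar p s))\<^sup>2 \<partial>unif) = symw p"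
proof -
  let ?K = "distr (measure_pmf p) borel (\<lambda>x. x)"
  interpret K: real_distribution ?K by (rule prob_space.real_distribution_distr[OF prob_space_measure_pmf]) simp
  interpret P: pair_prob_space ?K unif ..
  define C where "C s = Re (char ?K s)" for s
  define S where "S s = Im (char ?K s)" for s
  have [measurable]: "C \<in> borel_measurable borel" "S \<in> borel_measurable borel"
    unfolding C_def S_def by measurable
  have CS: "C s = E p (\<lambda>y. cos (s * y))" "S s = E p (\<lambda>y. sin (s * y))" for s
    unfolding C_def S_def pchar_eq_char[symmetric] pchar_def
      integral_Re[OF integrable_iexp_pmf, symmetric] integral_Im[OF integrable_iexp_pmf, symmetric]
    by (simp_all only: cis_conv_exp[symmetric] cis.sel)
  have ic: "integrable (measure_pmf p) (\<lambda>y. cos (s * y))" "integrable (measure_pmf p) (\<lambda>y. sin (s * y))" for s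
    by (rule integrable_measure_pmf_bounded[of _ _ 1]; simp)+
  define g where "g x s = 1 - (cos (s * x) * C s + sin (s * x) * S s)" for x s
  have gE: "g x s = E p (\<lambda>y. 1 - cos (s * (x - y)))" for x s
  proof -
    have "(\<lambda>y. 1 - cos (s * (x - y))) = (\<lambda>y. 1 - (cos (s * x) * cos (s * y) + sin (s * x) * sin (s * y)))"
      by (simp add: right_diff_distrib cos_diff)
    then show ?thesis unfolding g_def CS using ic[of s] by simp
  qed
  have CSb: "\<bar>C s\<bar> \<le> 1" "\<bar>S s\<bar> \<le> 1" for s
    unfolding C_def S_def using K.cmod_char_le_1[of s] abs_Re_le_cmod abs_Im_le_cmod order_trans by blast+
  have gb: "\<bar>g x s\<bar> \<le> 3" for x s
  proof -
    have "\<bar>cos (s * x) * C s\<bar> \<le> 1 * 1" "\<bar>sin (s * x) * S s\<bar> \<le> 1 * 1"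
      unfolding abs_mult using CSb by (intro mult_mono; simp)+
    then show ?thesis unfolding g_def by linarith
  qed
  have gm[measurable]: "(\<lambda>(x, s). g x s) \<in> borel_measurable (?K \<Otimes>\<^sub>M unif)"
    unfolding g_def by measurable
  have "1 - (norm (pchar p s))\<^sup>2 = (\<integral>x. g x s \<partial>?K)" for s
  proof -
    have "(\<integral>x. g x s \<partial>?K) = E p (\<lambda>x. g x s)"
      unfolding g_def by (subst integral_distr) auto
    also have "\<dots> = 1 - (C s * C s + S s * S s)"
      unfolding g_def using ic[of s] by (simp add: CS[symmetric])
    also have "\<dots> = 1 - (norm (pchar p s))\<^sup>2"
      unfolding C_def S_def pchar_eq_char cmod_power2 by (simp add: power2_eq_square)
    finally show ?thesis by simp
  qed
  then have "(\<integral>s. 1 - (norm (pchar p s))\<^sup>2 \<partial>unif) = (\<integral>s. \<integral>x. g x s \<partial>?K \<partial>unif)" by (simp only:)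
  also have "\<dots> = (\<integral>x. \<integral>s. g x s \<partial>unif \<partial>?K)"
  proof (rule P.Fubini_integral[of g], rule P.integrable_const_bound[of _ 3, OF _ gm])
    show "AE xs in ?K \<Otimes>\<^sub>M unif. norm (case xs of (x, s) \<Rightarrow> g x s) \<le> 3"
      by (rule AE_I2) (simp add: gb split: prod.split)
  qed
  also have "\<dots> = E p (\<lambda>x. \<integral>s. g x s \<partial>unif)"
  proof (rule integral_distr)
    show "(\<lambda>x. \<integral>s. g x s \<partial>unif) \<in> borel_measurable borel"
      unfolding g_def by measurable
  qed simp
  also have "\<dots> = symw p"
    unfolding gE integral_unif_one_minus_cos_pmf symw_def ..
  finally show ?thesis .
qed

locale nonneg_pmf =
  fixes p :: "real pmf"
  assumes nonneg: "\<And>x. x \<in> set_pmf p \<Longrightarrow> 0 \<le> x"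
begin

lemma integrable_trunc:
  "integrable (measure_pmf p) (\<lambda>x. indicator {..\<delta>} x * x)"
  "integrable (measure_pmf p) (\<lambda>x. indicator {..\<delta>} x * x\<^sup>2)"
  "integrable (measure_pmf p) (indicator {..\<delta>} :: real \<Rightarrow> real)"
  "integrable (measure_pmf p) (indicator {\<delta><..} :: real \<Rightarrow> real)"
proof -
  show "integrable (measure_pmf p) (\<lambda>x. indicator {..\<delta>} x * x)"
    by (rule integrable_measure_pmf_bounded[of _ _ "\<bar>\<delta>\<bar>"]) (auto dest: nonneg split: split_indicator)
  show "integrable (measure_pmf p) (\<lambda>x. indicator {..\<delta>} x * x\<^sup>2)"
  proof (rule integrable_measure_pmf_bounded[of _ _ "\<delta>\<^sup>2"])
    fix x assume "x \<in> set_pmf p"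
    then show "norm (indicator {..\<delta>} x * x\<^sup>2) \<le> \<delta>\<^sup>2"
      using nonneg[of x] power_mono[of x \<delta> 2] by (auto split: split_indicator)
  qed
  show "integrable (measure_pmf p) (indicator {..\<delta>} :: real \<Rightarrow> real)"
    "integrable (measure_pmf p) (indicator {\<delta><..} :: real \<Rightarrow> real)"
    by (rule integrable_measure_pmf_bounded[of _ _ 1]; simp add: indicator_def)+
qed

lemma expectation_atMost: "E p (indicator {..\<delta>} :: real \<Rightarrow> real) = 1 - tailp p \<delta>"
proof -
  have "(indicator {..\<delta>} :: real \<Rightarrow> real) = (\<lambda>x. 1 - indicator {\<delta><..} x)"
    by (auto simp: fun_eq_iff split: split_indicator)
  then show ?thesis unfolding tailp_eq using integrable_trunc(4)[of \<delta>] by simp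
qed

lemma trm1_bounds: "0 \<le> trm1 p \<delta>" "\<delta> \<ge> 0 \<Longrightarrow> trm1 p \<delta> \<le> \<delta>"
proof -
  show "0 \<le> trm1 p \<delta>"
    unfolding trm1_def by (rule integral_nonneg_AE) (auto simp: AE_measure_pmf_iff dest: nonneg)
  assume "\<delta> \<ge> 0"
  have "trm1 p \<delta> \<le> E p (\<lambda>x. \<delta>)"
    unfolding trm1_def by (rule expectation_mono[OF integrable_trunc(1)])
      (use \<open>\<delta> \<ge> 0\<close> in \<open>auto split: split_indicator\<close>)
  then show "trm1 p \<delta> \<le> \<delta>" by simp
qed

lemma trm1_le:
  assumes "0 < \<eta>"
  shows "trm1 p 1 \<le> \<eta> + tailp p \<eta>"
proof -
  have "trm1 p 1 \<le> E p (\<lambda>x. \<eta> + indicator {\<eta><..} x)"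
    unfolding trm1_def by (rule expectation_mono[OF integrable_trunc(1)])
      (use assms integrable_trunc(4)[of \<eta>] in \<open>auto split: split_indicator dest: nonneg\<close>)
  also have "\<dots> = \<eta> + tailp p \<eta>"
    unfolding tailp_eq using integrable_trunc(4)[of \<eta>] by simp
  finally show ?thesis .
qed

lemma trm2_le: "trm2 p 1 \<le> trm1 p 1"
  unfolding trm1_def trm2_def
proof (rule expectation_mono[OF integrable_trunc(2,1)])
  fix x assume "x \<in> set_pmf p"
  then have "0 \<le> x" by (rule nonneg)
  then show "indicator {..1} x * x\<^sup>2 \<le> indicator {..1} x * x"
    using mult_left_le[of x x] by (auto split: split_indicator simp: power2_eq_square)
qed

text \<open>The third identity trades the discontinuous cut at \<open>\<tau>\<close> for the
  continuous function \<open>min x \<tau>\<close> and a tail probability, both accessible to limits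
  above \<open>\<delta>\<close>.\<close>

lemma trm1_diff:
  assumes "\<delta> \<le> \<tau>" "0 \<le> \<tau>"
  shows "0 \<le> trm1 p \<tau> - trm1 p \<delta>" "trm1 p \<tau> - trm1 p \<delta> \<le> \<tau> * tailp p \<delta>"
    "trm1 p \<tau> - trm1 p \<delta> = E p (\<lambda>x. indicator {\<delta><..} x * min x \<tau>) - \<tau> * tailp p \<tau>"
proof -
  have e: "trm1 p \<tau> - trm1 p \<delta> = E p (\<lambda>x. indicator {..\<tau>} x * x - indicator {..\<delta>} x * x)"
    unfolding trm1_def by (rule Bochner_Integration.integral_diff[symmetric]) (rule integrable_trunc)+
  show "0 \<le> trm1 p \<tau> - trm1 p \<delta>"
    unfolding e by (rule integral_nonneg_AE) (use assms in \<open>auto simp: AE_measure_pmf_iff split: split_indicator dest: nonneg\<close>)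
  have "trm1 p \<tau> - trm1 p \<delta> \<le> E p (\<lambda>x. \<tau> * indicator {\<delta><..} x)"
    unfolding e by (rule expectation_mono)
      (use assms integrable_trunc(4)[of \<delta>] integrable_trunc(1) in \<open>auto split: split_indicator\<close>)
  then show "trm1 p \<tau> - trm1 p \<delta> \<le> \<tau> * tailp p \<delta>" by (simp add: tailp_eq)
  have m: "integrable (measure_pmf p) (\<lambda>x. indicator {\<delta><..} x * min x \<tau>)"
    by (rule integrable_measure_pmf_bounded[of _ _ \<tau>])
      (use assms in \<open>auto split: split_indicator dest: nonneg\<close>)
  have "(\<lambda>x. indicator {..\<tau>} x * x - indicator {..\<delta>} x * x)
    = (\<lambda>x. indicator {\<delta><..} x * min x \<tau> - \<tau> * indicator {\<tau><..} x)"
    using assms by (auto simp: fun_eq_iff split: split_indicator)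
  then show "trm1 p \<tau> - trm1 p \<delta> = E p (\<lambda>x. indicator {\<delta><..} x * min x \<tau>) - \<tau> * tailp p \<tau>"
    unfolding e tailp_eq using m integrable_trunc(4)[of \<tau>] by simp
qed

lemma centered_first: "E p (\<lambda>x. indicator {..\<delta>} x * (x - c)) = trm1 p \<delta> - c * (1 - tailp p \<delta>)"
proof -
  have "(\<lambda>x. indicator {..\<delta>} x * (x - c)) = (\<lambda>x. indicator {..\<delta>} x * x - c * indicator {..\<delta>} x)"
    by (auto simp: fun_eq_iff split: split_indicator)
  then show ?thesis
    unfolding trm1_def expectation_atMost[symmetric] using integrable_trunc[of \<delta>] by simp
qed

lemma centered_second:
  "integrable (measure_pmf p) (\<lambda>x. indicator {..\<delta>} x * (x - c)\<^sup>2)"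
  "E p (\<lambda>x. indicator {..\<delta>} x * (x - c)\<^sup>2) = trvar p \<delta> + (trm1 p \<delta> - c)\<^sup>2 - c\<^sup>2 * tailp p \<delta>"
proof -
  have e: "(\<lambda>x. indicator {..\<delta>} x * (x - c)\<^sup>2)
    = (\<lambda>x. indicator {..\<delta>} x * x\<^sup>2 - (2 * c) * (indicator {..\<delta>} x * x) + c\<^sup>2 * indicator {..\<delta>} x)"
    by (auto simp: fun_eq_iff power2_diff split: split_indicator)
  show "integrable (measure_pmf p) (\<lambda>x. indicator {..\<delta>} x * (x - c)\<^sup>2)"
    unfolding e using integrable_trunc[of \<delta>] by simp
  have "E p (\<lambda>x. indicator {..\<delta>} x * (x - c)\<^sup>2) = trm2 p \<delta> - 2 * c * trm1 p \<delta> + c\<^sup>2 * (1 - tailp p \<delta>)"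
    unfolding e trm1_def trm2_def expectation_atMost[symmetric] using integrable_trunc[of \<delta>] by simp
  also have "\<dots> = trvar p \<delta> + (trm1 p \<delta> - c)\<^sup>2 - c\<^sup>2 * tailp p \<delta>"
    by (simp add: trvar_def power2_diff algebra_simps)
  finally show "E p (\<lambda>x. indicator {..\<delta>} x * (x - c)\<^sup>2) = trvar p \<delta> + (trm1 p \<delta> - c)\<^sup>2 - c\<^sup>2 * tailp p \<delta>" .
qed

lemma centered_second_nonneg: "0 \<le> E p (\<lambda>x. indicator {..\<delta>} x * (x - c)\<^sup>2)"
  by (rule integral_nonneg_AE) auto

text \<open>Taking \<open>c = trm1 p \<delta>\<close> in \<open>centered_second\<close> removes the
  middle square and leaves a nonnegative expression that is at most \<open>trvar\<close>.\<close>

lemma trvar_nonneg: "0 \<le> trvar p \<delta>"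
proof -
  have "0 \<le> trvar p \<delta> - (trm1 p \<delta>)\<^sup>2 * tailp p \<delta>"
    using centered_second_nonneg[of \<delta> "trm1 p \<delta>"] unfolding centered_second(2) by simp
  moreover have "0 \<le> (trm1 p \<delta>)\<^sup>2 * tailp p \<delta>" using tailp_nonneg by simp
  ultimately show ?thesis by linarith
qed

lemma spread_nonneg: "0 \<le> spread p"
  using trvar_nonneg tailp_nonneg by (simp add: spread_def)

lemma spread_le:
  assumes "0 < \<eta>" "\<eta> \<le> 1"
  shows "spread p \<le> \<eta> + 2 * tailp p \<eta>"
proof -
  have "trvar p 1 \<le> trm2 p 1" by (simp add: trvar_def)
  then show ?thesis
    using trm2_le trm1_le[OF assms(1)] tailp_antimono[OF assms(2), of p] by (simp add: spread_def)
qed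

text \<open>Subtracting and restoring the linear term below \<open>\<delta>\<close> isolates the
  drift. The extra \<open>c * tailp p \<delta>\<close> arises because the centering constant is
  charged only on the mass below \<open>\<delta>\<close>.\<close>

lemma betac_split:
  fixes t \<delta>
  defines "c \<equiv> trm1 p 1"
  shows "betac p t = E p (\<lambda>x. indicator {..\<delta>} x * (iexp (t * (x - c)) - 1 - \<i> * complex_of_real (t * (x - c))))
     + \<i> * complex_of_real (t * (trm1 p \<delta> - c + c * tailp p \<delta>))
     + E p (\<lambda>x. indicator {\<delta><..} x * (iexp (t * (x - c)) - 1))"
proof -
  let ?f = "\<lambda>x. indicator {..\<delta>} x * (iexp (t * (x - c)) - 1)"
  let ?g = "\<lambda>x. indicator {..\<delta>} x * (\<i> * complex_of_real (t * (x - c)))"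
  let ?h = "\<lambda>x. indicator {\<delta><..} x * (iexp (t * (x - c)) - 1)"
  have f: "complex_integrable (measure_pmf p) ?f" and h: "complex_integrable (measure_pmf p) ?h"
    by (rule integrable_indicator_iexp)+
  have ge: "?g = (\<lambda>x. \<i> * complex_of_real t * complex_of_real (indicator {..\<delta>} x * (x - c)))"
    by (auto simp: fun_eq_iff split: split_indicator)
  have i1: "integrable (measure_pmf p) (\<lambda>x. indicator {..\<delta>} x * (x - c))"
  proof -
    have "(\<lambda>x. indicator {..\<delta>} x * (x - c)) = (\<lambda>x. indicator {..\<delta>} x * x - c * indicator {..\<delta>} x)"
      by (auto simp: fun_eq_iff split: split_indicator)
    then show ?thesis using integrable_trunc[of \<delta>] by simp
  qed
  have g: "complex_integrable (measure_pmf p) ?g"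
    unfolding ge by (intro integrable_mult_right integrable_of_real i1)
  have Eg: "E p ?g = \<i> * complex_of_real (t * (trm1 p \<delta> - c + c * tailp p \<delta>))"
    unfolding ge integral_mult_right_zero integral_complex_of_real centered_first
    by (simp add: algebra_simps)
  have "betac p t = E p (\<lambda>x. iexp (t * (x - c)) - 1)"
    unfolding betac_def c_def
    by (subst Bochner_Integration.integral_diff) (rule integrable_iexp_pmf, simp_all)
  also have "(\<lambda>x. iexp (t * (x - c)) - 1) = (\<lambda>x. ?f x - ?g x + ?g x + ?h x)"
    by (auto simp: fun_eq_iff split: split_indicator)
  also have "E p (\<lambda>x. ?f x - ?g x + ?g x + ?h x) = E p (\<lambda>x. ?f x - ?g x) + E p ?g + E p ?h"
    using f g h by simp
  also have "(\<lambda>x. ?f x - ?g x) = (\<lambda>x. indicator {..\<delta>} x * (iexp (t * (x - c)) - 1 - \<i> * complex_of_real (t * (x - c))))"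
    by (auto simp: fun_eq_iff split: split_indicator)
  finally show ?thesis unfolding Eg .
qed

text \<open>At \<open>\<delta> = 1\<close> the linear terms cancel up to
  \<open>c * tailp p 1\<close>, because \<open>c\<close> is the mean truncated at 1; what is left is
  of second order or lives on large values.\<close>

lemma norm_betac_le: "norm (betac p t) \<le> (t\<^sup>2 / 2 + \<bar>t\<bar> + 2) * spread p"
proof -
  define c where "c = trm1 p 1"
  have c: "0 \<le> c" "c \<le> 1" using trm1_bounds[of 1] by (auto simp: c_def)
  have 1: "norm (E p (\<lambda>x. indicator {..1} x * (iexp (t * (x - c)) - 1 - \<i> * complex_of_real (t * (x - c)))))
      \<le> E p (\<lambda>x. t\<^sup>2 / 2 * (indicator {..1} x * (x - c)\<^sup>2))"
  proof (rule norm_expectation_le)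
    show "integrable (measure_pmf p) (\<lambda>x. t\<^sup>2 / 2 * (indicator {..1} x * (x - c)\<^sup>2))"
      by (intro integrable_mult_right centered_second)
    show "norm (indicator {..1} x * (iexp (t * (x - c)) - 1 - \<i> * complex_of_real (t * (x - c))))
      \<le> t\<^sup>2 / 2 * (indicator {..1} x * (x - c)\<^sup>2)" for x
    proof (cases "x \<le> 1")
      case True
      then show ?thesis using iexp_linear_le[of "t * (x - c)"]
        by (simp add: power_mult_distrib del: of_real_mult of_real_diff)
    qed simp
  qed
  also have "\<dots> = t\<^sup>2 / 2 * (trvar p 1 - c\<^sup>2 * tailp p 1)"
    unfolding integral_mult_right_zero centered_second(2) by (simp add: c_def)
  also have "\<dots> \<le> t\<^sup>2 / 2 * trvar p 1"
    using tailp_nonneg[of p 1] by (intro mult_left_mono) auto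
  finally have 1: "norm (E p (\<lambda>x. indicator {..1} x * (iexp (t * (x - c)) - 1 - \<i> * complex_of_real (t * (x - c)))))
    \<le> t\<^sup>2 / 2 * trvar p 1" .
  have 2: "norm (\<i> * complex_of_real (t * (c - c + c * tailp p 1))) \<le> \<bar>t\<bar> * tailp p 1"
  proof -
    have "\<bar>t\<bar> * (c * tailp p 1) \<le> \<bar>t\<bar> * (1 * tailp p 1)"
      using c tailp_nonneg[of p 1] by (intro mult_left_mono mult_right_mono) auto
    then show ?thesis using c tailp_nonneg[of p 1] by (simp add: norm_mult abs_mult)
  qed
  have 3: "norm (E p (\<lambda>x. indicator {1<..} x * (iexp (t * (x - c)) - 1))) \<le> 2 * tailp p 1"
  proof -
    have "norm (E p (\<lambda>x. indicator {1<..} x * (iexp (t * (x - c)) - 1))) \<le> E p (\<lambda>x. 2 * indicator {1<..} x)"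
      using iexp_minus_one_le2[of "t * (_ - c)"] integrable_trunc(4)[of 1]
      by (intro norm_expectation_le) (auto simp: norm_mult split: split_indicator)
    then show ?thesis by (simp add: tailp_eq)
  qed
  have "norm (betac p t) \<le> t\<^sup>2 / 2 * trvar p 1 + \<bar>t\<bar> * tailp p 1 + 2 * tailp p 1"
    unfolding betac_split[of t 1] c_def[symmetric]
    by (intro order_trans[OF norm_triangle_ineq] add_mono 1 2 3)
  also have "\<dots> \<le> (t\<^sup>2 / 2 + \<bar>t\<bar> + 2) * spread p"
  proof -
    have "0 \<le> t\<^sup>2 / 2 * tailp p 1" "0 \<le> \<bar>t\<bar> * trvar p 1" "0 \<le> trvar p 1"
      using trvar_nonneg[of 1] tailp_nonneg[of p 1] by auto
    then show ?thesis unfolding spread_def distrib_left distrib_right by linarith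
  qed
  finally show ?thesis .
qed

text \<open>Errors come from the cubic Taylor remainder, where \<open>|x - c| <= \<delta>\<close>
  gains a factor \<open>\<delta>\<close>; from exchanging the centered second moment for
  \<open>trvar\<close>; and from the centering at large values and in the linear term. Apart from
  \<open>\<delta>\<close> times the variance, each is a tail times \<open>c\<close>,
  \<open>c^2\<close> or that tail again, and these factors vanish in null arrays.\<close>

lemma betac_small_jump_expansion:
  fixes t \<delta>
  defines "c \<equiv> trm1 p 1"
  assumes \<delta>: "0 < \<delta>" "\<delta> \<le> 1" and c\<delta>: "c \<le> \<delta>"
  shows "norm (betac p t - \<i> * complex_of_real (t * (trm1 p \<delta> - c)) + complex_of_real (t\<^sup>2 / 2 * trvar p \<delta>)
      - E p (\<lambda>x. indicator {\<delta><..} x * (iexp (t * x) - 1)))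
    \<le> \<bar>t\<bar>^3 * \<delta> / 6 * (trvar p \<delta> + (tailp p \<delta>)\<^sup>2) + 2 * \<bar>t\<bar> * c * tailp p \<delta>
      + t\<^sup>2 / 2 * ((tailp p \<delta>)\<^sup>2 + c\<^sup>2 * tailp p \<delta>)"
proof -
  have c0: "0 \<le> c" using trm1_bounds[of 1] by (auto simp: c_def)
  let ?W = "E p (\<lambda>x. indicator {..\<delta>} x * (x - c)\<^sup>2)"
  let ?f = "\<lambda>x. indicator {..\<delta>} x * (iexp (t * (x - c)) - 1 - \<i> * complex_of_real (t * (x - c)))"
  let ?h = "\<lambda>x. indicator {\<delta><..} x * (iexp (t * (x - c)) - 1)"
  let ?hh = "\<lambda>x. indicator {\<delta><..} x * (iexp (t * x) - 1)"
  have sq: "(trm1 p \<delta> - c)\<^sup>2 \<le> (tailp p \<delta>)\<^sup>2"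
    unfolding abs_le_square_iff[symmetric]
    using trm1_diff(1,2)[OF \<delta>(2)] tailp_nonneg[of p \<delta>] unfolding c_def by linarith
  have Wle: "?W \<le> trvar p \<delta> + (tailp p \<delta>)\<^sup>2"
    unfolding centered_second(2) using sq mult_nonneg_nonneg[OF zero_le_power2[of c] tailp_nonneg[of p \<delta>]] by linarith
  have WV: "\<bar>?W - trvar p \<delta>\<bar> \<le> (tailp p \<delta>)\<^sup>2 + c\<^sup>2 * tailp p \<delta>"
    unfolding centered_second(2) using sq tailp_nonneg[of p \<delta>] zero_le_power2[of "trm1 p \<delta> - c"]
      mult_nonneg_nonneg[OF zero_le_power2[of c] tailp_nonneg[of p \<delta>]] zero_le_power2[of "tailp p \<delta>"] by linarith
  have q: "integrable (measure_pmf p) (\<lambda>x. t\<^sup>2/2 * (indicator {..\<delta>} x * (x - c)\<^sup>2))"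
    by (intro integrable_mult_right centered_second)
  have f: "complex_integrable (measure_pmf p) ?f"
  proof (rule Bochner_Integration.integrable_bound[OF q])
    have "norm (?f x) \<le> norm (t\<^sup>2/2 * (indicator {..\<delta>} x * (x - c)\<^sup>2))" for x
      using iexp_linear_le[of "t * (x - c)"]
      by (cases "x \<le> \<delta>") (simp_all add: power_mult_distrib abs_mult del: of_real_mult of_real_diff)
    then show "AE x in measure_pmf p. norm (?f x) \<le> norm (t\<^sup>2/2 * (indicator {..\<delta>} x * (x - c)\<^sup>2))" by simp
  qed simp
  have 1: "norm (E p ?f + complex_of_real (t\<^sup>2 / 2 * ?W)) \<le> \<bar>t\<bar>^3 * \<delta> / 6 * ?W"
  proof -
    have eq: "E p ?f + complex_of_real (t\<^sup>2 / 2 * ?W)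
      = E p (\<lambda>x. ?f x + complex_of_real (t\<^sup>2/2 * (indicator {..\<delta>} x * (x - c)\<^sup>2)))"
      unfolding Bochner_Integration.integral_add[OF f integrable_of_real[OF q]] integral_complex_of_real
        integral_mult_right_zero ..
    have "norm (E p (\<lambda>x. ?f x + complex_of_real (t\<^sup>2/2 * (indicator {..\<delta>} x * (x - c)\<^sup>2))))
      \<le> E p (\<lambda>x. \<bar>t\<bar>^3 * \<delta> / 6 * (indicator {..\<delta>} x * (x - c)\<^sup>2))"
    proof (rule norm_expectation_le)
      show "integrable (measure_pmf p) (\<lambda>x. \<bar>t\<bar>^3 * \<delta> / 6 * (indicator {..\<delta>} x * (x - c)\<^sup>2))"
        by (intro integrable_mult_right centered_second)
      fix x assume x: "x \<in> set_pmf p"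
      show "norm (?f x + complex_of_real (t\<^sup>2/2 * (indicator {..\<delta>} x * (x - c)\<^sup>2)))
        \<le> \<bar>t\<bar>^3 * \<delta> / 6 * (indicator {..\<delta>} x * (x - c)\<^sup>2)"
      proof (cases "x \<le> \<delta>")
        case True
        then have xc: "\<bar>x - c\<bar> \<le> \<delta>" using nonneg[OF x] c0 c\<delta> by auto
        have "norm (?f x + complex_of_real (t\<^sup>2/2 * (indicator {..\<delta>} x * (x - c)\<^sup>2))) \<le> \<bar>t * (x - c)\<bar>^3 / 6"
        proof -
          have i: "indicator {..\<delta>} x = (1::real)" "indicator {..\<delta>} x = (1::complex)" using True by simp_all
          have e: "t\<^sup>2/2 * (x - c)\<^sup>2 = (t * (x - c))\<^sup>2 / 2" by (simp add: power_mult_distrib)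
          show ?thesis unfolding i mult_1 e by (rule iexp_quadratic_le)
        qed
        also have "\<dots> = \<bar>t\<bar>^3 / 6 * (x - c)\<^sup>2 * \<bar>x - c\<bar>"
        proof -
          have "\<bar>x - c\<bar>^3 = \<bar>x - c\<bar>\<^sup>2 * \<bar>x - c\<bar>" unfolding power3_eq_cube power2_eq_square ..
          then have "\<bar>x - c\<bar>^3 = (x - c)\<^sup>2 * \<bar>x - c\<bar>" by (simp only: power2_abs)
          then show ?thesis by (simp only: abs_mult power_mult_distrib times_divide_eq_left mult.assoc)
        qed
        also have "\<dots> \<le> \<bar>t\<bar>^3 / 6 * (x - c)\<^sup>2 * \<delta>"
          by (rule mult_left_mono[OF xc]) simp
        finally have "norm (?f x + complex_of_real (t\<^sup>2/2 * (indicator {..\<delta>} x * (x - c)\<^sup>2)))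
          \<le> \<bar>t\<bar>^3 / 6 * (x - c)\<^sup>2 * \<delta>" .
        also have "\<dots> = \<bar>t\<bar>^3 * \<delta> / 6 * (indicator {..\<delta>} x * (x - c)\<^sup>2)"
          using True by simp
        finally show ?thesis .
      next
        case False
        then have "indicator {..\<delta>} x = (0::real)" "indicator {..\<delta>} x = (0::complex)" by simp_all
        then show ?thesis by (simp only: mult_zero_left mult_zero_right of_real_0 add_0 norm_zero)
      qed
    qed
    then show ?thesis unfolding eq by (simp only: integral_mult_right_zero)
  qed
  have 2: "norm (E p ?h - E p ?hh) \<le> \<bar>t\<bar> * c * tailp p \<delta>"
  proof -
    have eq: "E p ?h - E p ?hh = E p (\<lambda>x. ?h x - ?hh x)"
      by (rule Bochner_Integration.integral_diff[symmetric]) (rule integrable_indicator_iexp)+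
    have "norm (E p (\<lambda>x. ?h x - ?hh x)) \<le> E p (\<lambda>x. \<bar>t\<bar> * c * indicator {\<delta><..} x)"
    proof (rule norm_expectation_le)
      show "integrable (measure_pmf p) (\<lambda>x. \<bar>t\<bar> * c * indicator {\<delta><..} x)"
        using integrable_trunc(4)[of \<delta>] by simp
      show "norm (?h x - ?hh x) \<le> \<bar>t\<bar> * c * indicator {\<delta><..} x" for x
      proof (cases "x > \<delta>")
        case True
        have e: "iexp (t * (x - c)) = iexp (t * x) * iexp (- (t * c))"
          by (simp add: exp_add[symmetric] algebra_simps)
        have "?h x - ?hh x = iexp (t * x) * (iexp (- (t * c)) - 1)"
        proof -
          have i: "indicator {\<delta><..} x = (1::complex)" using True by simp
          have alg: "(a * b - 1) - (a - 1) = a * (b - 1)" for a b :: complex by (simp add: right_diff_distrib)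
          show ?thesis unfolding i e mult_1 by (rule alg)
        qed
        then have "norm (?h x - ?hh x) = norm (iexp (- (t * c)) - 1)"
          by (simp add: norm_mult del: of_real_minus)
        then show ?thesis using True c0 iexp_minus_one_le[of "- (t * c)"] by (simp add: abs_mult)
      qed simp
    qed
    then show ?thesis unfolding eq by (simp add: tailp_eq)
  qed
  have 3: "norm (complex_of_real (t\<^sup>2 / 2 * trvar p \<delta>) - complex_of_real (t\<^sup>2 / 2 * ?W))
     \<le> t\<^sup>2 / 2 * ((tailp p \<delta>)\<^sup>2 + c\<^sup>2 * tailp p \<delta>)"
    unfolding of_real_diff[symmetric] norm_of_real right_diff_distrib[symmetric] abs_mult
    using WV by (simp add: abs_minus_commute mult_left_mono)
  have 4: "norm (\<i> * complex_of_real (t * (c * tailp p \<delta>))) \<le> \<bar>t\<bar> * c * tailp p \<delta>"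
    using c0 tailp_nonneg[of p \<delta>] by (simp add: norm_mult abs_mult)
  have eq: "betac p t - \<i> * complex_of_real (t * (trm1 p \<delta> - c)) + complex_of_real (t\<^sup>2 / 2 * trvar p \<delta>) - E p ?hh
    = (E p ?f + complex_of_real (t\<^sup>2 / 2 * ?W))
      + (complex_of_real (t\<^sup>2 / 2 * trvar p \<delta>) - complex_of_real (t\<^sup>2 / 2 * ?W))
      + \<i> * complex_of_real (t * (c * tailp p \<delta>)) + (E p ?h - E p ?hh)"
  proof -
    have sp: "\<i> * complex_of_real (t * (trm1 p \<delta> - c + c * tailp p \<delta>))
      = \<i> * complex_of_real (t * (trm1 p \<delta> - c)) + \<i> * complex_of_real (t * (c * tailp p \<delta>))"
      by (simp only: distrib_left of_real_add)
    have alg: "(f + (x + y) + h) - x + v - h0 = (f + w) + (v - w) + y + (h - h0)" for f x y h v h0 w :: complex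
      by simp
    show ?thesis unfolding betac_split[of t \<delta>] c_def[symmetric] sp by (rule alg)
  qed
  \<comment> \<open>Of the two terms with \<open>c * tailp p \<delta>\<close>, one is the defect of
    the linear part and the other the shift of large values by \<open>c\<close>.\<close>
  have "norm ((E p ?f + complex_of_real (t\<^sup>2 / 2 * ?W))
      + (complex_of_real (t\<^sup>2 / 2 * trvar p \<delta>) - complex_of_real (t\<^sup>2 / 2 * ?W))
      + \<i> * complex_of_real (t * (c * tailp p \<delta>)) + (E p ?h - E p ?hh))
    \<le> \<bar>t\<bar>^3 * \<delta> / 6 * ?W + t\<^sup>2 / 2 * ((tailp p \<delta>)\<^sup>2 + c\<^sup>2 * tailp p \<delta>)
     + \<bar>t\<bar> * c * tailp p \<delta> + \<bar>t\<bar> * c * tailp p \<delta>"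
    by (rule order_trans[OF norm_triangle_ineq add_mono[OF order_trans[OF norm_triangle_ineq
            add_mono[OF order_trans[OF norm_triangle_ineq add_mono[OF 1 3]] 4]] 2]])
  moreover have "\<bar>t\<bar>^3 * \<delta> / 6 * ?W \<le> \<bar>t\<bar>^3 * \<delta> / 6 * (trvar p \<delta> + (tailp p \<delta>)\<^sup>2)"
    using \<delta> by (intro mult_left_mono[OF Wle]) auto
  ultimately show ?thesis unfolding eq by linarith
qed

lemma integrable_wt: "integrable (measure_pmf p) (\<lambda>y. wt (f y))"
proof (rule integrable_measure_pmf_bounded[of _ _ 2])
  show "norm (wt (f x)) \<le> 2" for x
    using wt_nonneg[of "f x"] wt_le[of "f x"] by (simp add: min_def split: if_splits)
qed

lemma integrable_wt2: "integrable (measure_pmf p) (\<lambda>x. E p (\<lambda>y. wt (x - y)))"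
proof (rule integrable_measure_pmf_bounded[of _ _ 2])
  fix x
  have "norm (E p (\<lambda>y. wt (x - y))) \<le> E p (\<lambda>y. 2)"
  proof (rule norm_expectation_le)
    show "norm (wt (x - y)) \<le> 2" for y
      using wt_nonneg[of "x - y"] wt_le[of "x - y"] by (simp add: min_def split: if_splits)
  qed simp
  then show "norm (E p (\<lambda>y. wt (x - y))) \<le> 2" by simp
qed

text \<open>If one copy exceeds 1 and the other is at most 1/2, they differ by at least 1/2 and
  \<open>wt\<close> is at least \<open>(1/4) / 8 = 1/32\<close>. The second event has probability at
  least 1/2, whence 64.\<close>

lemma tailp_le_symw:
  assumes "tailp p (1/2) \<le> 1/2"
  shows "tailp p 1 \<le> 64 * symw p"
proof -
  have "E p (\<lambda>x. 1/64 * indicator {1<..} x) \<le> symw p"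
    unfolding symw_def
  proof (rule expectation_mono[OF _ integrable_wt2])
    show "integrable (measure_pmf p) (\<lambda>x. 1/64 * indicator {1<..} x :: real)"
      by (intro integrable_mult_right integrable_trunc)
    show "1/64 * indicator {1<..} x \<le> E p (\<lambda>y. wt (x - y))" for x
    proof (cases "x > 1")
      case True
      have "1/64 \<le> 1/32 * (1 - tailp p (1/2))" using assms by simp
      also have "\<dots> = E p (\<lambda>y. 1/32 * indicator {..1/2} y)"
        by (simp only: integral_mult_right_zero expectation_atMost)
      also have "\<dots> \<le> E p (\<lambda>y. wt (x - y))"
      proof (rule expectation_mono[OF _ integrable_wt])
        show "integrable (measure_pmf p) (\<lambda>y. 1/32 * indicator {..1/2} y :: real)"
          by (intro integrable_mult_right integrable_trunc)
        show "1/32 * indicator {..1/2} y \<le> wt (x - y)" for y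
        proof (cases "y \<le> 1/2")
          case y: True
          then have "1/2 \<le> x - y" using True by simp
          then have "(1/2)\<^sup>2 \<le> (x - y)\<^sup>2" by (intro power_mono) auto
          then have "1/4 \<le> (x - y)\<^sup>2" by (simp add: power_divide)
          then show ?thesis using wt_ge[of "x - y"] y by (simp add: min_def split: if_splits)
        qed (simp add: wt_nonneg)
      qed
      finally show ?thesis using True by simp
    qed (simp add: integral_nonneg_AE wt_nonneg)
  qed
  then show ?thesis by (simp add: tailp_eq)
qed

text \<open>For two copies in \<open>[0, 1]\<close> the squared difference is at most
  \<open>8 * wt\<close>. Its expectation on that event is \<open>2 * V - 2 * T * trm2 p 1\<close>,
  so \<open>V\<close> is controlled up to the tail \<open>T\<close>.\<close>

lemma trvar_le_symw: "trvar p 1 \<le> 4 * symw p + tailp p 1"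
proof -
  define m where "m = trm1 p 1"
  define V where "V = trvar p 1"
  define T where "T = tailp p 1"
  have "E p (\<lambda>x. indicator {..1} x * (V + (x - m)\<^sup>2 - x\<^sup>2 * T)) \<le> E p (\<lambda>x. 8 * E p (\<lambda>y. wt (x - y)))"
  proof (rule expectation_mono)
    have "(\<lambda>x. indicator {..1} x * (V + (x - m)\<^sup>2 - x\<^sup>2 * T))
      = (\<lambda>x. V * indicator {..1} x + indicator {..1} x * (x - m)\<^sup>2 - T * (indicator {..1} x * x\<^sup>2))"
      by (auto simp: fun_eq_iff algebra_simps)
    then show "integrable (measure_pmf p) (\<lambda>x. indicator {..1} x * (V + (x - m)\<^sup>2 - x\<^sup>2 * T))"
      using integrable_trunc[of 1] centered_second(1)[of 1 m] by simp
    show "integrable (measure_pmf p) (\<lambda>x. 8 * E p (\<lambda>y. wt (x - y)))"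
      by (intro integrable_mult_right integrable_wt2)
    fix x assume x: "x \<in> set_pmf p"
    show "indicator {..1} x * (V + (x - m)\<^sup>2 - x\<^sup>2 * T) \<le> 8 * E p (\<lambda>y. wt (x - y))"
    proof (cases "x \<le> 1")
      case True
      have "V + (x - m)\<^sup>2 - x\<^sup>2 * T = E p (\<lambda>y. indicator {..1} y * (y - x)\<^sup>2)"
        unfolding centered_second(2) V_def T_def m_def by (simp add: power2_commute)
      also have "\<dots> \<le> E p (\<lambda>y. 8 * wt (x - y))"
      proof (rule expectation_mono[OF centered_second(1)])
        show "integrable (measure_pmf p) (\<lambda>y. 8 * wt (x - y))" by (intro integrable_mult_right integrable_wt)
        fix y assume y: "y \<in> set_pmf p"
        show "indicator {..1} y * (y - x)\<^sup>2 \<le> 8 * wt (x - y)"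
        proof (cases "y \<le> 1")
          case y1: True
          have "\<bar>x - y\<bar> \<le> 1" using True y1 nonneg[OF x] nonneg[OF y] by auto
          then have "(x - y)\<^sup>2 \<le> 1" by (simp add: abs_square_le_1)
          then show ?thesis using wt_ge[of "x - y"] y1 by (simp add: power2_commute min_def split: if_splits)
        qed (simp add: wt_nonneg)
      qed
      finally show ?thesis using True by simp
    qed (simp add: integral_nonneg_AE wt_nonneg)
  qed
  also have "E p (\<lambda>x. indicator {..1} x * (V + (x - m)\<^sup>2 - x\<^sup>2 * T))
     = V * (1 - T) + (V - m\<^sup>2 * T) - T * trm2 p 1"
  proof -
    have e: "(\<lambda>x. indicator {..1} x * (V + (x - m)\<^sup>2 - x\<^sup>2 * T))
      = (\<lambda>x. V * indicator {..1} x + indicator {..1} x * (x - m)\<^sup>2 - T * (indicator {..1} x * x\<^sup>2))"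
      by (auto simp: fun_eq_iff algebra_simps)
    have 1: "E p (\<lambda>x. indicator {..1} x * (x - m)\<^sup>2) = V - m\<^sup>2 * T"
      unfolding centered_second(2) by (simp add: m_def V_def T_def)
    have "E p (\<lambda>x. indicator {..1} x * (V + (x - m)\<^sup>2 - x\<^sup>2 * T))
      = V * E p (indicator {..1}) + E p (\<lambda>x. indicator {..1} x * (x - m)\<^sup>2) - T * E p (\<lambda>x. indicator {..1} x * x\<^sup>2)"
      unfolding e using integrable_trunc[of 1] centered_second(1)[of 1 m] by simp
    then show ?thesis unfolding 1 expectation_atMost by (simp add: trm2_def T_def)
  qed
  also have "\<dots> = 2 * V - 2 * (T * trm2 p 1)"
    by (simp add: V_def trvar_def m_def algebra_simps)
  finally have "2 * V - 2 * (T * trm2 p 1) \<le> 8 * symw p"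
    by (simp only: integral_mult_right_zero symw_def)
  moreover have "T * trm2 p 1 \<le> T * 1"
    using trm2_le trm1_bounds(2)[of 1] tailp_nonneg[of p 1] by (intro mult_left_mono) (auto simp: T_def)
  ultimately show ?thesis by (simp add: V_def T_def)
qed

text \<open>The constant is \<open>4 + 2 * 64\<close>, as the variance bound brings in the tail a
  second time.\<close>

lemma spread_le_symw: "tailp p (1/2) \<le> 1/2 \<Longrightarrow> spread p \<le> 132 * symw p"
  using tailp_le_symw trvar_le_symw by (simp add: spread_def)

end

section \<open>Null arrays: sufficiency\<close>

definition wmeas :: "real pmf \<Rightarrow> (real \<Rightarrow> real) \<Rightarrow> real measure" where
  "wmeas p g = density (distr (measure_pmf p) borel (\<lambda>x. x)) (\<lambda>x. ennreal (g x))"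

lemma sets_wmeas [measurable_cong, simp]: "sets (wmeas p g) = sets borel"
  by (simp add: wmeas_def)

lemma finite_measure_wmeas:
  assumes [measurable]: "g \<in> borel_measurable borel" and "\<And>x. g x \<le> B"
  shows "finite_measure (wmeas p g)"
proof
  have "emeasure (wmeas p g) (space (wmeas p g)) = (\<integral>\<^sup>+x. ennreal (g x) \<partial>measure_pmf p)"
    unfolding wmeas_def by (simp add: emeasure_density nn_integral_distr)
  also have "\<dots> \<le> (\<integral>\<^sup>+x. ennreal B \<partial>measure_pmf p)"
    by (intro nn_integral_mono ennreal_leI assms)
  also have "\<dots> < \<infinity>" by simp
  finally show "emeasure (wmeas p g) (space (wmeas p g)) \<noteq> \<infinity>" by simp
qed

lemma integral_wmeas:
  fixes f :: "real \<Rightarrow> 'b::{banach, second_countable_topology}"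
  assumes [measurable]: "g \<in> borel_measurable borel" "f \<in> borel_measurable borel" and "\<And>x. 0 \<le> g x"
  shows "(\<integral>x. f x \<partial>wmeas p g) = E p (\<lambda>x. g x *\<^sub>R f x)"
  unfolding wmeas_def using assms by (subst integral_density) (auto simp: integral_distr)

lemma measure_wmeas:
  assumes [measurable]: "g \<in> borel_measurable borel" "S \<in> sets borel" and "\<And>x. 0 \<le> g x"
  shows "measure (wmeas p g) S = E p (\<lambda>x. g x * indicator S x)"
  using integral_wmeas[of g "indicator S :: real \<Rightarrow> real" p] assms by simp

text \<open>Telescoping replaces one factor at a time; the modulus bound keeps the other factors
  from amplifying the difference.\<close>

lemma norm_prod_diff_le:
  fixes z w :: "'i \<Rightarrow> complex"
  assumes "finite I" "\<And>i. i \<in> I \<Longrightarrow> norm (z i) \<le> 1" "\<And>i. i \<in> I \<Longrightarrow> norm (w i) \<le> 1"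
  shows "norm ((\<Prod>i\<in>I. z i) - (\<Prod>i\<in>I. w i)) \<le> (\<Sum>i\<in>I. norm (z i - w i))"
  using assms
proof (induction rule: finite_induct)
  case (insert i I)
  have 1: "norm (\<Prod>i\<in>I. w i) \<le> 1"
    unfolding prod_norm[symmetric] using insert by (intro prod_le_1) auto
  have eq: "(\<Prod>i\<in>insert i I. z i) - (\<Prod>i\<in>insert i I. w i)
     = z i * ((\<Prod>i\<in>I. z i) - (\<Prod>i\<in>I. w i)) + (z i - w i) * (\<Prod>i\<in>I. w i)"
    using insert by (simp add: algebra_simps)
  have "norm (z i * ((\<Prod>i\<in>I. z i) - (\<Prod>i\<in>I. w i)) + (z i - w i) * (\<Prod>i\<in>I. w i))
    \<le> norm (z i) * norm ((\<Prod>i\<in>I. z i) - (\<Prod>i\<in>I. w i)) + norm (z i - w i) * norm (\<Prod>i\<in>I. w i)"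
    by (rule order_trans[OF norm_triangle_ineq]) (simp add: norm_mult)
  also have "\<dots> \<le> 1 * (\<Sum>i\<in>I. norm (z i - w i)) + norm (z i - w i) * 1"
    using insert 1 by (intro add_mono mult_mono) auto
  finally show ?case unfolding eq using insert by simp
qed simp

lemma norm_exp_linear_le:
  fixes z :: complex
  assumes "norm z \<le> 1"
  shows "norm (1 + z - exp z) \<le> 3 * (norm z)\<^sup>2"
proof -
  have "norm (exp z - (\<Sum>i\<le>1. z ^ i / fact i)) \<le> exp \<bar>Re z\<bar> * norm z ^ Suc 1 / fact 1"
    by (rule Taylor_exp)
  moreover have "exp \<bar>Re z\<bar> \<le> 3"
    using exp_le abs_Re_le_cmod[of z] assms by (meson exp_le_cancel_iff order_trans)
  ultimately have "norm (exp z - (1 + z)) \<le> 3 * (norm z)\<^sup>2"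
    using mult_right_mono[of "exp \<bar>Re z\<bar>" 3 "(norm z)\<^sup>2"] by (simp add: power2_eq_square)
  then show ?thesis by (simp add: norm_minus_commute)
qed

text \<open>Raising the threshold to 1 adds squares of size at most 1 on the strip, while the
  subtracted square of the mean can only grow.\<close>

lemma (in nonneg_pmf) trvar_le:
  assumes "\<tau> \<le> 1"
  shows "trvar p 1 \<le> trvar p \<tau> + tailp p \<tau>"
proof -
  have "trm2 p 1 \<le> E p (\<lambda>x. indicator {..\<tau>} x * x\<^sup>2 + indicator {\<tau><..} x)"
    unfolding trm2_def
  proof (rule expectation_mono[OF integrable_trunc(2)])
    show "integrable (measure_pmf p) (\<lambda>x. indicator {..\<tau>} x * x\<^sup>2 + indicator {\<tau><..} x)"
      by (intro Bochner_Integration.integrable_add integrable_trunc)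
    fix x assume "x \<in> set_pmf p"
    then show "indicator {..1} x * x\<^sup>2 \<le> indicator {..\<tau>} x * x\<^sup>2 + indicator {\<tau><..} x"
      using nonneg[of x] power_le_one[of x 2] assms by (auto split: split_indicator)
  qed
  also have "\<dots> = trm2 p \<tau> + tailp p \<tau>"
    unfolding trm2_def tailp_eq by (rule Bochner_Integration.integral_add) (rule integrable_trunc)+
  finally have "trm2 p 1 \<le> trm2 p \<tau> + tailp p \<tau>" .
  moreover have "(trm1 p \<tau>)\<^sup>2 \<le> (trm1 p 1)\<^sup>2"
    using trm1_diff(1)[OF assms] trm1_bounds(1)[of \<tau>] by (intro power_mono) auto
  ultimately show ?thesis by (simp add: trvar_def)
qed

section \<open>Rows of a null array, their sums and accompanying exponents\<close>

locale null_array = levy_exponent +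
  fixes Q :: "nat \<Rightarrow> nat \<Rightarrow> real pmf" and A :: "nat \<Rightarrow> real"
  assumes Q_nonneg: "\<And>d j x. x \<in> set_pmf (Q d j) \<Longrightarrow> 0 \<le> x"
    and null: "\<And>\<tau> e. \<tau> > 0 \<Longrightarrow> e > 0 \<Longrightarrow> \<forall>\<^sub>F d in sequentially. \<forall>j\<in>{1..d}. tailp (Q d j) \<tau> \<le> e"
begin

sublocale Q: nonneg_pmf "Q d j" for d j
  by unfold_locales (rule Q_nonneg)

definition Ft :: "nat \<Rightarrow> real \<Rightarrow> real" where "Ft d x = (\<Sum>j=1..d. tailp (Q d j) x)"
definition Sm :: "nat \<Rightarrow> real \<Rightarrow> real" where "Sm d \<tau> = (\<Sum>j=1..d. trm1 (Q d j) \<tau>)"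
definition Sv :: "nat \<Rightarrow> real \<Rightarrow> real" where "Sv d \<tau> = (\<Sum>j=1..d. trvar (Q d j) \<tau>)"
definition Ks :: "nat \<Rightarrow> real" where "Ks d = (\<Sum>j=1..d. spread (Q d j))"
definition charS :: "nat \<Rightarrow> real \<Rightarrow> complex" where
  "charS d t = (\<Prod>j=1..d. pchar (Q d j) t) * iexp (- t * A d)"
text \<open>The accompanying exponent: factors \<open>1 + betac\<close> give way to
  \<open>exp betac\<close>, and the centering constants are gathered in one linear term.\<close>

definition Ex :: "nat \<Rightarrow> real \<Rightarrow> complex" where
  "Ex d t = (\<Sum>j=1..d. betac (Q d j) t) + \<i> * complex_of_real (t * (Sm d 1 - A d))"

lemma center_null:
  assumes "e > 0" shows "\<forall>\<^sub>F d in sequentially. \<forall>j\<in>{1..d}. trm1 (Q d j) 1 \<le> e"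
  using null[of "e/2" "e/2"]
proof (rule eventually_mono)
  fix d assume h: "\<forall>j\<in>{1..d}. tailp (Q d j) (e/2) \<le> e/2"
  show "\<forall>j\<in>{1..d}. trm1 (Q d j) 1 \<le> e"
  proof
    fix j assume "j \<in> {1..d}"
    then have "tailp (Q d j) (e/2) \<le> e/2" using h by blast
    then show "trm1 (Q d j) 1 \<le> e" using Q.trm1_le[of "e/2" d j] assms by simp
  qed
qed (use assms in auto)

lemma spread_null:
  assumes "e > 0" shows "\<forall>\<^sub>F d in sequentially. \<forall>j\<in>{1..d}. spread (Q d j) \<le> e"
  using null[of "min 1 (e/2)" "e/4"]
proof (rule eventually_mono)
  fix d assume h: "\<forall>j\<in>{1..d}. tailp (Q d j) (min 1 (e/2)) \<le> e/4"
  show "\<forall>j\<in>{1..d}. spread (Q d j) \<le> e"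
  proof
    fix j assume "j \<in> {1..d}"
    then have "tailp (Q d j) (min 1 (e/2)) \<le> e/4" using h by blast
    then show "spread (Q d j) \<le> e" using Q.spread_le[of "min 1 (e/2)" d j] assms by simp
  qed
qed (use assms in auto)

lemma charS_eq: "charS d t = (\<Prod>j=1..d. 1 + betac (Q d j) t) * iexp (t * (Sm d 1 - A d))"
proof -
  have 1: "(\<Prod>j=1..d. 1 + betac (Q d j) t) = (\<Prod>j=1..d. iexp (- t * trm1 (Q d j) 1)) * (\<Prod>j=1..d. pchar (Q d j) t)"
    unfolding betac_pchar prod.distrib ..
  have 2: "(\<Prod>j=1..d. iexp (- t * trm1 (Q d j) 1)) = iexp (- t * Sm d 1)"
  proof -
    have "\<i> * complex_of_real (- t * Sm d 1) = (\<Sum>j=1..d. \<i> * complex_of_real (- t * trm1 (Q d j) 1))"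
      unfolding Sm_def sum_distrib_left of_real_sum ..
    then show ?thesis by (simp only: exp_sum[OF finite_atLeastAtMost])
  qed
  have 3: "iexp (- t * Sm d 1) * iexp (t * (Sm d 1 - A d)) = iexp (- t * A d)"
    unfolding exp_add[symmetric] distrib_left[symmetric] of_real_add[symmetric] by (simp add: algebra_simps)
  show ?thesis
    unfolding charS_def 1 2 3[symmetric] by (simp only: mult.assoc mult.commute mult.left_commute)
qed

lemma exp_Ex: "exp (Ex d t) = (\<Prod>j=1..d. exp (betac (Q d j) t)) * iexp (t * (Sm d 1 - A d))"
  by (simp add: Ex_def exp_add exp_sum)

text \<open>Each factor errs by at most \<open>3 * (K * spread)^2\<close>. One of the two spreads is
  uniformly small because the array is null, and the sum of the others is bounded.\<close>

lemma charS_approx: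
  assumes B: "\<forall>\<^sub>F d in sequentially. Ks d \<le> B" and "e > 0"
  shows "\<forall>\<^sub>F d in sequentially. \<forall>t. \<bar>t\<bar> \<le> R \<longrightarrow> norm (charS d t - exp (Ex d t)) \<le> e"
proof -
  define K where "K = R\<^sup>2 / 2 + \<bar>R\<bar> + 2"
  have K: "K \<ge> 2" by (simp add: K_def)
  \<comment> \<open>The first entry forces \<open>|betac| <= 1\<close>, where the Taylor estimate
    holds; the second makes the summed error at most \<open>e\<close>.\<close>
  define e1 where "e1 = min (1/K) (e / (3 * K\<^sup>2 * (\<bar>B\<bar> + 1)))"
  have e1: "e1 > 0" using K \<open>e > 0\<close> by (simp add: e1_def)
  have e1K: "K * e1 \<le> 1"
  proof -
    have "K * e1 \<le> K * (1/K)" using K by (intro mult_left_mono) (auto simp: e1_def)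
    then show ?thesis using K by simp
  qed
  have e1e: "3 * K\<^sup>2 * e1 * (\<bar>B\<bar> + 1) \<le> e"
  proof -
    have "3 * K\<^sup>2 * (\<bar>B\<bar> + 1) * e1 \<le> 3 * K\<^sup>2 * (\<bar>B\<bar> + 1) * (e / (3 * K\<^sup>2 * (\<bar>B\<bar> + 1)))"
      using K by (intro mult_left_mono) (auto simp: e1_def)
    also have "\<dots> = e" using K by (simp add: add_nonneg_eq_0_iff)
    finally show ?thesis by (simp add: mult_ac)
  qed
  show ?thesis
    using B spread_null[OF e1]
  proof eventually_elim
    case (elim d)
    show ?case
    proof (intro allI impI)
      fix t assume t: "\<bar>t\<bar> \<le> R"
      have tK: "t\<^sup>2 / 2 + \<bar>t\<bar> + 2 \<le> K"
      proof -
        have "t\<^sup>2 \<le> R\<^sup>2" using t by (simp add: abs_le_square_iff[symmetric])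
        then show ?thesis using t by (simp add: K_def)
      qed
      have b: "norm (betac (Q d j) t) \<le> K * spread (Q d j)" for j
        using Q.norm_betac_le[of d j t] mult_right_mono[OF tK Q.spread_nonneg[of d j]] by linarith
      have pj: "norm (1 + betac (Q d j) t - exp (betac (Q d j) t)) \<le> 3 * K\<^sup>2 * e1 * spread (Q d j)" if "j \<in> {1..d}" for j
      proof -
        have s: "0 \<le> spread (Q d j)" "spread (Q d j) \<le> e1" using elim that Q.spread_nonneg by auto
        have "K * spread (Q d j) \<le> K * e1" using s K by (intro mult_left_mono) auto
        then have "norm (betac (Q d j) t) \<le> 1" using b[of j] e1K by linarith
        then have "norm (1 + betac (Q d j) t - exp (betac (Q d j) t)) \<le> 3 * (norm (betac (Q d j) t))\<^sup>2"
          by (rule norm_exp_linear_le)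
        also have "(norm (betac (Q d j) t))\<^sup>2 \<le> (K * spread (Q d j))\<^sup>2"
          using b[of j] by (intro power_mono) auto
        also have "\<dots> = K\<^sup>2 * (spread (Q d j) * spread (Q d j))"
          by (simp add: power_mult_distrib power2_eq_square)
        also have "\<dots> \<le> K\<^sup>2 * (e1 * spread (Q d j))"
          using s by (intro mult_left_mono mult_right_mono) auto
        finally show ?thesis by (simp add: mult_ac)
      qed
      have "norm (charS d t - exp (Ex d t)) = norm ((\<Prod>j=1..d. 1 + betac (Q d j) t) - (\<Prod>j=1..d. exp (betac (Q d j) t)))"
        unfolding charS_eq exp_Ex left_diff_distrib[symmetric] norm_mult by simp
      also have "\<dots> \<le> (\<Sum>j=1..d. norm (1 + betac (Q d j) t - exp (betac (Q d j) t)))"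
        by (rule norm_prod_diff_le) (auto simp: norm_one_plus_betac Re_betac)
      also have "\<dots> \<le> (\<Sum>j=1..d. 3 * K\<^sup>2 * e1 * spread (Q d j))"
        by (rule sum_mono) (rule pj)
      also have "\<dots> = 3 * K\<^sup>2 * e1 * Ks d" by (simp add: Ks_def sum_distrib_left)
      also have "\<dots> \<le> 3 * K\<^sup>2 * e1 * (\<bar>B\<bar> + 1)" using elim e1 by (intro mult_left_mono) auto
      finally show "norm (charS d t - exp (Ex d t)) \<le> e" using e1e by linarith
    qed
  qed
qed

text \<open>Condition (A) says that the summed laws, restricted to \<open>{\<delta><..}\<close>,
  have distribution functions converging to that of the restricted jump measure. Restricting the
  measures instead of the function avoids the jump of the integrand at
  \<open>\<delta>\<close>.\<close>

lemma tail_integral_tendsto: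
  fixes f :: "real \<Rightarrow> complex"
  assumes hA: "\<And>x. x > 0 \<Longrightarrow> (\<lambda>d. Ft d x) \<longlonglongrightarrow> - L x"
    and f: "\<And>x. isCont f x" "\<And>x. norm (f x) \<le> B" and \<delta>: "\<delta> > 0"
  shows "(\<lambda>d. \<Sum>j=1..d. E (Q d j) (\<lambda>x. indicator {\<delta><..} x * f x)) \<longlonglongrightarrow> (CLINT x|\<nu>. indicator {\<delta><..} x * f x)"
proof -
  define W where "W d j = wmeas (Q d j) (indicator {\<delta><..})" for d j
  define H where "H d = msum {1..d} (W d)" for d
  define H0 where "H0 = density \<nu> (indicator {\<delta><..})"
  have fm[measurable]: "f \<in> borel_measurable borel"
    using f(1) by (intro borel_measurable_continuous_onI) (simp add: continuous_at_imp_continuous_on)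
  have Wf: "finite_measure (W d j)" for d j
    unfolding W_def by (rule finite_measure_wmeas[of _ 1]) (auto simp: indicator_def)
  have Ws: "sets (W d j) = sets borel" for d j by (simp add: W_def)
  have Hf: "finite_measure (H d)" for d
    unfolding H_def by (rule finite_measure_msum) (auto simp: Ws Wf)
  have Hs: "sets (H d) = sets borel" for d by (simp add: H_def)
  have H0s: "sets H0 = sets borel" by (simp add: H0_def)
  have emH0: "emeasure H0 S = emeasure \<nu> ({\<delta><..} \<inter> S)" if "S \<in> sets borel" for S
  proof -
    have "emeasure H0 S = (\<integral>\<^sup>+x. indicator {\<delta><..} x * indicator S x \<partial>\<nu>)"
      using that unfolding H0_def by (subst emeasure_density) auto
    also have "\<dots> = (\<integral>\<^sup>+x. indicator ({\<delta><..} \<inter> S) x \<partial>\<nu>)"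
      by (rule nn_integral_cong) (auto split: split_indicator)
    also have "\<dots> = emeasure \<nu> ({\<delta><..} \<inter> S)"
      using that by (intro nn_integral_indicator) auto
    finally show ?thesis .
  qed
  have H0f: "finite_measure H0"
  proof
    show "emeasure H0 (space H0) \<noteq> \<infinity>"
      using emH0[of UNIV] emeasure_nu_tail[OF \<delta>] sets_eq_imp_space_eq[OF H0s] by simp
  qed
  have mW: "measure (W d j) UNIV = tailp (Q d j) \<delta>"
    "measure (W d j) {..x} = tailp (Q d j) \<delta> - tailp (Q d j) (max \<delta> x)" for d j x
  proof -
    show "measure (W d j) UNIV = tailp (Q d j) \<delta>"
      unfolding W_def by (subst measure_wmeas) (auto simp: tailp_eq)
    have "(\<lambda>y. indicator {\<delta><..} y * indicator {..x} y :: real) = (\<lambda>y. indicator {\<delta><..} y - indicator {max \<delta> x<..} y)"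
      by (auto simp: fun_eq_iff split: split_indicator)
    then have "E (Q d j) (\<lambda>y. indicator {\<delta><..} y * indicator {..x} y :: real) = tailp (Q d j) \<delta> - tailp (Q d j) (max \<delta> x)"
      unfolding tailp_eq using Q.integrable_trunc(4)[of d j] by simp
    then show "measure (W d j) {..x} = tailp (Q d j) \<delta> - tailp (Q d j) (max \<delta> x)"
      unfolding W_def by (subst measure_wmeas) auto
  qed
  have mH: "measure (H d) S = (\<Sum>j=1..d. measure (W d j) S)" if "S \<in> sets borel" for d S
  proof -
    have "emeasure (H d) S = (\<Sum>j=1..d. ennreal (measure (W d j) S))"
      unfolding H_def using that Wf by (subst emeasure_msum) (auto simp: Ws finite_measure.emeasure_eq_measure)
    then show ?thesis by (simp add: measure_def sum_nonneg)
  qed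
  have "(\<lambda>d. \<integral>x. f x \<partial>H d) \<longlonglongrightarrow> (\<integral>x. f x \<partial>H0)"
  proof (rule finite_measure_cdf_tendsto[OF Hf Hs H0f H0s _ _ f])
    have "measure H0 UNIV = - L \<delta>"
      using emH0[of UNIV] measure_nu_tail[OF \<delta>] by (simp add: measure_def)
    then show "(\<lambda>d. measure (H d) UNIV) \<longlonglongrightarrow> measure H0 UNIV"
      using hA[OF \<delta>] by (simp add: mH mW Ft_def)
    fix x
    have "measure H0 {..x} = - L \<delta> - (- L (max \<delta> x))"
    proof (cases "x > \<delta>")
      case True
      have "{\<delta><..} \<inter> {..x} = {\<delta><..x}" by auto
      then have "emeasure H0 {..x} = ennreal (L x - L \<delta>)"
        using emH0[of "{..x}"] stj \<delta> True by (simp add: stieltjes_pos_def)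
      moreover have "L \<delta> \<le> L x" using L_mono True \<delta> by (auto simp: mono_on_def)
      ultimately show ?thesis using True by (simp add: measure_def max_def)
    next
      case False
      then have "{\<delta><..} \<inter> {..x} = {}" by auto
      then show ?thesis using emH0[of "{..x}"] False by (simp add: measure_def max_def)
    qed
    then show "(\<lambda>d. measure (H d) {..x}) \<longlonglongrightarrow> measure H0 {..x}"
      using tendsto_diff[OF hA[OF \<delta>] hA[of "max \<delta> x"]] \<delta> by (simp add: mH mW Ft_def sum_subtractf)
  qed
  moreover have "(\<integral>x. f x \<partial>H d) = (\<Sum>j=1..d. E (Q d j) (\<lambda>x. indicator {\<delta><..} x * f x))" for d
  proof -
    have "(\<integral>x. f x \<partial>H d) = (\<Sum>j=1..d. \<integral>x. f x \<partial>W d j)"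
      unfolding H_def by (rule integral_msum[OF _ _ _ fm f(2)]) (auto simp: Ws Wf)
    also have "\<dots> = (\<Sum>j=1..d. E (Q d j) (\<lambda>x. indicator {\<delta><..} x *\<^sub>R f x))"
      unfolding W_def by (intro sum.cong refl integral_wmeas) auto
    also have "(\<lambda>x. indicator {\<delta><..} x *\<^sub>R f x) = (\<lambda>x. indicator {\<delta><..} x * f x)"
      by (auto simp: fun_eq_iff split: split_indicator)
    finally show ?thesis .
  qed
  moreover have "(\<integral>x. f x \<partial>H0) = (CLINT x|\<nu>. indicator {\<delta><..} x * f x)"
  proof -
    have "H0 = density \<nu> (\<lambda>x. ennreal (indicator {\<delta><..} x))" unfolding H0_def
      by (rule arg_cong[of _ _ "density \<nu>"]) (auto simp: fun_eq_iff split: split_indicator)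
    then have "(\<integral>x. f x \<partial>H0) = (CLINT x|\<nu>. indicator {\<delta><..} x *\<^sub>R f x)"
      by (simp add: integral_density)
    also have "(\<lambda>x. indicator {\<delta><..} x *\<^sub>R f x) = (\<lambda>x. indicator {\<delta><..} x * f x)"
      by (auto simp: fun_eq_iff split: split_indicator)
    finally show ?thesis .
  qed
  ultimately show ?thesis by simp
qed

lemma weighted_tail_small:
  assumes "\<eta> \<ge> 0" "\<And>j. j \<in> {1..d} \<Longrightarrow> 0 \<le> u j" "\<And>j. j \<in> {1..d} \<Longrightarrow> u j \<le> \<eta>" "Ft d \<delta> \<le> B"
  shows "(\<Sum>j=1..d. u j * tailp (Q d j) \<delta>) \<le> \<eta> * B"
proof -
  have "(\<Sum>j=1..d. u j * tailp (Q d j) \<delta>) \<le> (\<Sum>j=1..d. \<eta> * tailp (Q d j) \<delta>)"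
    using assms tailp_nonneg by (intro sum_mono mult_right_mono) auto
  also have "\<dots> = \<eta> * Ft d \<delta>" by (simp add: Ft_def sum_distrib_left)
  also have "\<dots> \<le> \<eta> * B" using assms by (intro mult_left_mono) auto
  finally show ?thesis .
qed

text \<open>Summation of \<open>betac_small_jump_expansion\<close> over a row: \<open>Sm d 1\<close>
  cancels from the linear term, and apart from the variance part of the cubic error each remainder
  is a factor at most \<open>\<eta>\<close> times a tail, hence sums to at most
  \<open>\<eta> * B\<close>.\<close>

lemma Ex_expansion:
  assumes \<delta>: "0 < \<delta>" "\<delta> \<le> 1" and c: "\<forall>j\<in>{1..d}. trm1 (Q d j) 1 \<le> \<eta>" "\<eta> \<le> \<delta>" "0 \<le> \<eta>"
    and T: "\<forall>j\<in>{1..d}. tailp (Q d j) \<delta> \<le> \<eta>" and B: "Ft d \<delta> \<le> B"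
  shows "norm (Ex d t - \<i> * complex_of_real (t * (Sm d \<delta> - A d)) + complex_of_real (t\<^sup>2 / 2 * Sv d \<delta>)
      - (\<Sum>j=1..d. E (Q d j) (\<lambda>x. indicator {\<delta><..} x * (iexp (t * x) - 1))))
    \<le> \<bar>t\<bar>^3 * \<delta> / 6 * (Sv d \<delta> + \<eta> * B) + (2 * \<bar>t\<bar> + t\<^sup>2) * (\<eta> * B)"
proof -
  define e where "e j = E (Q d j) (\<lambda>x. indicator {\<delta><..} x * (iexp (t * x) - 1))" for j
  define c where "c j = trm1 (Q d j) 1" for j
  define T where "T j = tailp (Q d j) \<delta>" for j
  define z where "z j = betac (Q d j) t - \<i> * complex_of_real (t * (trm1 (Q d j) \<delta> - c j))
     + complex_of_real (t\<^sup>2 / 2 * trvar (Q d j) \<delta>) - e j" for j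
  have c0: "0 \<le> c j" for j using Q.trm1_bounds(1)[of d j 1] by (simp add: c_def)
  have eq: "Ex d t - \<i> * complex_of_real (t * (Sm d \<delta> - A d)) + complex_of_real (t\<^sup>2 / 2 * Sv d \<delta>) - (\<Sum>j=1..d. e j) = (\<Sum>j=1..d. z j)"
  proof -
    have "(\<Sum>j=1..d. z j) = (\<Sum>j=1..d. betac (Q d j) t) - \<i> * complex_of_real (t * (Sm d \<delta> - Sm d 1))
        + complex_of_real (t\<^sup>2 / 2 * Sv d \<delta>) - (\<Sum>j=1..d. e j)"
      unfolding z_def sum_subtractf sum.distrib Sm_def Sv_def c_def
      by (simp only: sum_distrib_left[symmetric] of_real_sum[symmetric] sum_subtractf[symmetric])
    moreover have "\<i> * complex_of_real (t * (Sm d \<delta> - A d))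
      = \<i> * complex_of_real (t * (Sm d \<delta> - Sm d 1)) + \<i> * complex_of_real (t * (Sm d 1 - A d))"
      by (simp add: algebra_simps)
    ultimately show ?thesis unfolding Ex_def by simp
  qed
  have zj: "norm (z j) \<le> \<bar>t\<bar>^3 * \<delta> / 6 * trvar (Q d j) \<delta> + \<bar>t\<bar>^3 * \<delta> / 6 * (T j * T j) + 2 * \<bar>t\<bar> * (c j * T j)
      + t\<^sup>2 / 2 * (T j * T j) + t\<^sup>2 / 2 * ((c j)\<^sup>2 * T j)" if "j \<in> {1..d}" for j
  proof -
    have "trm1 (Q d j) 1 \<le> \<delta>" using c that by force
    from Q.betac_small_jump_expansion[OF \<delta> this, of t]
    show ?thesis unfolding z_def e_def c_def T_def power2_eq_square[of "tailp (Q d j) \<delta>"] distrib_left mult.assoc by linarith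
  qed
  have cc: "c j \<le> \<eta>" "T j \<le> \<eta>" "(c j)\<^sup>2 \<le> \<eta>" if "j \<in> {1..d}" for j
  proof -
    show 1: "c j \<le> \<eta>" "T j \<le> \<eta>" using c assms(6) that by (auto simp: c_def T_def)
    have "(c j)\<^sup>2 = c j * c j" by (rule power2_eq_square)
    also have "\<dots> \<le> c j * 1" using 1 c0[of j] \<delta> assms(4) by (intro mult_left_mono) auto
    finally show "(c j)\<^sup>2 \<le> \<eta>" using 1 by simp
  qed
  have s1: "(\<Sum>j=1..d. T j * T j) \<le> \<eta> * B"
    using weighted_tail_small[of \<eta> d T \<delta> B] cc B assms(5) tailp_nonneg by (auto simp: T_def)
  have s2: "(\<Sum>j=1..d. c j * T j) \<le> \<eta> * B"
    using weighted_tail_small[of \<eta> d c \<delta> B] cc B assms(5) c0 by (auto simp: T_def)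
  have s3: "(\<Sum>j=1..d. (c j)\<^sup>2 * T j) \<le> \<eta> * B"
    using weighted_tail_small[of \<eta> d "\<lambda>j. (c j)\<^sup>2" \<delta> B] cc B assms(5) by (auto simp: T_def)
  have "norm (\<Sum>j=1..d. z j) \<le> (\<Sum>j=1..d. \<bar>t\<bar>^3 * \<delta> / 6 * trvar (Q d j) \<delta> + \<bar>t\<bar>^3 * \<delta> / 6 * (T j * T j) + 2 * \<bar>t\<bar> * (c j * T j)
      + t\<^sup>2 / 2 * (T j * T j) + t\<^sup>2 / 2 * ((c j)\<^sup>2 * T j))"
    by (rule sum_norm_le) (rule zj)
  also have "\<dots> = \<bar>t\<bar>^3 * \<delta> / 6 * Sv d \<delta> + \<bar>t\<bar>^3 * \<delta> / 6 * (\<Sum>j=1..d. T j * T j) + 2 * \<bar>t\<bar> * (\<Sum>j=1..d. c j * T j)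
      + t\<^sup>2 / 2 * (\<Sum>j=1..d. T j * T j) + t\<^sup>2 / 2 * (\<Sum>j=1..d. (c j)\<^sup>2 * T j)"
    by (simp only: sum.distrib sum_distrib_left[symmetric] Sv_def)
  also have "\<dots> \<le> \<bar>t\<bar>^3 * \<delta> / 6 * Sv d \<delta> + \<bar>t\<bar>^3 * \<delta> / 6 * (\<eta> * B) + 2 * \<bar>t\<bar> * (\<eta> * B)
      + t\<^sup>2 / 2 * (\<eta> * B) + t\<^sup>2 / 2 * (\<eta> * B)"
    using s1 s2 s3 \<delta> by (intro add_mono mult_left_mono order_refl) auto
  also have "\<dots> = \<bar>t\<bar>^3 * \<delta> / 6 * (Sv d \<delta> + \<eta> * B) + (2 * \<bar>t\<bar> + t\<^sup>2) * (\<eta> * B)"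
    by (simp add: algebra_simps)
  finally show ?thesis unfolding eq[unfolded e_def] .
qed

text \<open>The drift is subtracted instead of being assumed to converge, so the estimate serves
  both directions: it yields the exponents once (B) is known, and it yields (B) once the exponents
  converge.\<close>

lemma Ex_key:
  assumes hA: "\<And>x. x > 0 \<Longrightarrow> (\<lambda>d. Ft d x) \<longlonglongrightarrow> - L x"
    and hC: "\<And>e. e > 0 \<Longrightarrow> \<exists>\<tau>0>0. \<forall>\<tau>. 0 < \<tau> \<and> \<tau> < \<tau>0 \<longrightarrow> (\<forall>\<^sub>F d in sequentially. \<bar>Sv d \<tau> - \<sigma>2\<bar> \<le> e)"
    and "e > 0"
  shows "\<exists>\<delta>0>0. \<forall>\<delta>. 0 < \<delta> \<and> \<delta> < \<delta>0 \<longrightarrow> (\<forall>\<^sub>F d in sequentially.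
     norm (Ex d t - \<i> * complex_of_real (t * (Sm d \<delta> - A d - levy_shift \<delta>)) - levy_main \<delta> t) \<le> e)"
proof -
  define K where "K = 1 + \<bar>t\<bar> + t\<^sup>2 + \<bar>t\<bar>^3"
  have K: "1 \<le> K" "\<bar>t\<bar> \<le> K" "t\<^sup>2 \<le> K" "\<bar>t\<bar>^3 \<le> K" by (auto simp: K_def)
  define e1 where "e1 = min 1 (e / (8 * K * (\<sigma>2 + 2)))"
  have s2: "\<sigma>2 + 2 > 0" using s2_nonneg by simp
  have e1: "0 < e1" "e1 \<le> 1" using \<open>e > 0\<close> K s2 by (auto simp: e1_def)
  have Ke: "K * e1 * (\<sigma>2 + 2) \<le> e / 8"
  proof -
    have "8 * K * (\<sigma>2 + 2) * e1 \<le> 8 * K * (\<sigma>2 + 2) * (e / (8 * K * (\<sigma>2 + 2)))"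
      using K s2 by (intro mult_left_mono) (auto simp: e1_def)
    also have "\<dots> = e" using K s2 by simp
    finally show ?thesis by (simp add: mult_ac)
  qed
  have Ke2: "2 * (K * e1) \<le> e / 8"
  proof -
    have "K * e1 * 2 \<le> K * e1 * (\<sigma>2 + 2)" using K e1 s2_nonneg by (intro mult_left_mono) auto
    then show ?thesis using Ke by linarith
  qed
  obtain \<tau>0 where \<tau>0: "\<tau>0 > 0" "\<And>\<tau>. 0 < \<tau> \<Longrightarrow> \<tau> < \<tau>0 \<Longrightarrow> \<forall>\<^sub>F d in sequentially. \<bar>Sv d \<tau> - \<sigma>2\<bar> \<le> e1"
    using hC[OF e1(1)] by blast
  define \<delta>0 where "\<delta>0 = min \<tau>0 e1"
  have "\<forall>\<^sub>F d in sequentially. norm (Ex d t - \<i> * complex_of_real (t * (Sm d \<delta> - A d - levy_shift \<delta>)) - levy_main \<delta> t) \<le> e"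
    if \<delta>: "0 < \<delta>" "\<delta> < \<delta>0" for \<delta>
  proof -
    define B where "B = - L \<delta> + 1"
    have B: "B \<ge> 1" using L_nonpos[OF \<delta>(1)] by (simp add: B_def)
    \<comment> \<open>Chosen after \<open>\<delta>\<close>: the bound \<open>B\<close> on the tail
      sums may grow as \<open>\<delta>\<close> shrinks, and nullness of the array absorbs
      it.\<close>
    define \<eta> where "\<eta> = min \<delta> (e1 / B)"
    have \<eta>: "0 < \<eta>" "\<eta> \<le> \<delta>" "\<eta> * B \<le> e1"
    proof -
      show "0 < \<eta>" "\<eta> \<le> \<delta>" using \<delta> e1 B by (auto simp: \<eta>_def)
      have "\<eta> * B \<le> e1 / B * B" using B by (intro mult_right_mono) (auto simp: \<eta>_def)
      then show "\<eta> * B \<le> e1" using B by simp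
    qed
    define G where "G d = (\<Sum>j=1..d. E (Q d j) (\<lambda>x. indicator {\<delta><..} x * (iexp (t * x) - 1)))" for d
    define G0 where "G0 = (CLINT x|\<nu>. indicator {\<delta><..} x * (iexp (t * x) - 1))"
    have "G \<longlonglongrightarrow> G0"
      unfolding G_def G0_def
    proof (rule tail_integral_tendsto[OF hA, of _ 2])
      show "norm (iexp (t * x) - 1) \<le> 2" for x by (rule iexp_minus_one_le2)
      show "isCont (\<lambda>x. iexp (t * x) - 1) x" for x by (intro continuous_intros)
    qed (use \<delta> in auto)
    then have evG: "\<forall>\<^sub>F d in sequentially. norm (G d - G0) < e1"
      using e1 by (auto dest: tendstoD simp: dist_norm)
    have evB: "\<forall>\<^sub>F d in sequentially. Ft d \<delta> < B"
      by (rule order_tendstoD(2)[OF hA[OF \<delta>(1)]]) (simp add: B_def)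
    have evV: "\<forall>\<^sub>F d in sequentially. \<bar>Sv d \<delta> - \<sigma>2\<bar> \<le> e1"
      using \<tau>0(2)[of \<delta>] \<delta> by (simp add: \<delta>0_def)
    show ?thesis
      using evG evB evV center_null[OF \<eta>(1)] null[OF \<delta>(1) \<eta>(1)]
    proof eventually_elim
      case (elim d)
      have \<delta>1: "\<delta> \<le> 1" "\<delta> \<le> e1" using \<delta> e1 by (auto simp: \<delta>0_def)
      let ?X = "Ex d t - \<i> * complex_of_real (t * (Sm d \<delta> - A d)) + complex_of_real (t\<^sup>2 / 2 * Sv d \<delta>) - G d"
      have 1: "norm ?X \<le> \<bar>t\<bar>^3 * \<delta> / 6 * (Sv d \<delta> + \<eta> * B) + (2 * \<bar>t\<bar> + t\<^sup>2) * (\<eta> * B)"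
        unfolding G_def by (rule Ex_expansion[OF \<delta>(1) \<delta>1(1)]) (use elim \<eta> in auto)
      have "\<bar>t\<bar>^3 * \<delta> / 6 * (Sv d \<delta> + \<eta> * B) \<le> K * e1 * (\<sigma>2 + 2)"
      proof (rule mult_mono)
        have "\<bar>t\<bar>^3 * \<delta> \<le> K * e1" using K \<delta>1 \<delta> by (intro mult_mono) auto
        moreover have "0 \<le> \<bar>t\<bar>^3 * \<delta>" using \<delta> by simp
        ultimately show "\<bar>t\<bar>^3 * \<delta> / 6 \<le> K * e1" by linarith
        show "Sv d \<delta> + \<eta> * B \<le> \<sigma>2 + 2" using elim(3) \<eta>(3) e1 by linarith
        show "0 \<le> K * e1" using K e1 by simp
        have "0 \<le> Sv d \<delta>" unfolding Sv_def by (intro sum_nonneg Q.trvar_nonneg)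
        then show "0 \<le> Sv d \<delta> + \<eta> * B" using \<eta>(1) B by simp
      qed
      moreover have "(2 * \<bar>t\<bar> + t\<^sup>2) * (\<eta> * B) \<le> (3 * K) * e1"
        using K \<eta> B by (intro mult_mono) auto
      ultimately have 2: "norm ?X \<le> K * e1 * (\<sigma>2 + 2) + 3 * (K * e1)" using 1 by simp
      have 3: "norm (complex_of_real (t\<^sup>2 / 2 * \<sigma>2) - complex_of_real (t\<^sup>2 / 2 * Sv d \<delta>)) \<le> K * e1"
      proof -
        have "\<bar>t\<^sup>2 / 2 * \<sigma>2 - t\<^sup>2 / 2 * Sv d \<delta>\<bar> = t\<^sup>2 / 2 * \<bar>Sv d \<delta> - \<sigma>2\<bar>"
          unfolding right_diff_distrib[symmetric] abs_mult by (simp add: abs_minus_commute)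
        also have "\<dots> \<le> K * e1" using K elim(3) by (intro mult_mono) auto
        finally show ?thesis by (simp only: of_real_diff[symmetric] norm_of_real)
      qed
      have 4: "norm (G d - G0) \<le> K * e1"
        using elim(1) mult_right_mono[OF K(1), of e1] e1 by linarith
      have eq: "Ex d t - \<i> * complex_of_real (t * (Sm d \<delta> - A d - levy_shift \<delta>)) - levy_main \<delta> t
        = ?X + (complex_of_real (t\<^sup>2 / 2 * \<sigma>2) - complex_of_real (t\<^sup>2 / 2 * Sv d \<delta>)) + (G d - G0)"
        unfolding levy_main_def G0_def[symmetric] by (simp add: algebra_simps)
      have "norm (?X + (complex_of_real (t\<^sup>2 / 2 * \<sigma>2) - complex_of_real (t\<^sup>2 / 2 * Sv d \<delta>)) + (G d - G0))
        \<le> (K * e1 * (\<sigma>2 + 2) + 3 * (K * e1)) + K * e1 + K * e1"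
        by (rule order_trans[OF norm_triangle_ineq add_mono[OF order_trans[OF norm_triangle_ineq add_mono[OF 2 3]] 4]])
      also have "\<dots> \<le> e" using Ke Ke2 \<open>e > 0\<close> by linarith
      finally show ?case unfolding eq .
    qed
  qed
  moreover have "\<delta>0 > 0" using \<tau>0 e1 by (simp add: \<delta>0_def)
  ultimately show ?thesis by blast
qed

text \<open>One small threshold suffices: there (C) bounds the variance sums, and passing to
  threshold 1 costs tail sums that (A) bounds.\<close>

lemma Ks_bounded:
  assumes hA: "\<And>x. x > 0 \<Longrightarrow> (\<lambda>d. Ft d x) \<longlonglongrightarrow> - L x"
    and hC: "\<And>e. e > 0 \<Longrightarrow> \<exists>\<tau>0>0. \<forall>\<tau>. 0 < \<tau> \<and> \<tau> < \<tau>0 \<longrightarrow> (\<forall>\<^sub>F d in sequentially. \<bar>Sv d \<tau> - \<sigma>2\<bar> \<le> e)"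
  shows "\<exists>B. \<forall>\<^sub>F d in sequentially. Ks d \<le> B"
proof -
  obtain \<tau>0 where \<tau>0: "\<tau>0 > 0" "\<And>\<tau>. 0 < \<tau> \<Longrightarrow> \<tau> < \<tau>0 \<Longrightarrow> \<forall>\<^sub>F d in sequentially. \<bar>Sv d \<tau> - \<sigma>2\<bar> \<le> 1"
    using hC[of 1] by auto
  define \<tau> where "\<tau> = min 1 (\<tau>0 / 2)"
  have \<tau>: "0 < \<tau>" "\<tau> < \<tau>0" "\<tau> \<le> 1" using \<tau>0(1) by (auto simp: \<tau>_def)
  have "\<forall>\<^sub>F d in sequentially. Ft d \<tau> < - L \<tau> + 1"
    by (rule order_tendstoD(2)[OF hA[OF \<tau>(1)]]) simp
  then have "\<forall>\<^sub>F d in sequentially. Ks d \<le> \<sigma>2 + 1 + 2 * (- L \<tau> + 1)"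
    using \<tau>0(2)[OF \<tau>(1,2)]
  proof eventually_elim
    case (elim d)
    have "Ks d \<le> (\<Sum>j=1..d. trvar (Q d j) \<tau> + 2 * tailp (Q d j) \<tau>)"
      unfolding Ks_def
    proof (rule sum_mono)
      fix j
      show "spread (Q d j) \<le> trvar (Q d j) \<tau> + 2 * tailp (Q d j) \<tau>"
        using Q.trvar_le[OF \<tau>(3), of d j] tailp_antimono[OF \<tau>(3), of "Q d j"] by (simp add: spread_def)
    qed
    also have "\<dots> = Sv d \<tau> + 2 * Ft d \<tau>" by (simp add: Sv_def Ft_def sum.distrib sum_distrib_left)
    finally have "Ks d \<le> Sv d \<tau> + 2 * Ft d \<tau>" .
    also have "\<dots> \<le> (\<sigma>2 + 1) + 2 * (- L \<tau> + 1)"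
      by (rule add_mono) (use elim in \<open>simp_all add: abs_le_iff\<close>)
    finally show ?case .
  qed
  then show ?thesis by blast
qed

lemma small_jumps_choice:
  assumes "e > 0" "\<delta>0 > 0"
  obtains \<delta> where "0 < \<delta>" "\<delta> < \<delta>0" "norm (psi t - levy_main \<delta> t) \<le> e"
proof -
  have "((\<lambda>\<delta>. t\<^sup>2 / 2 * (LINT x|\<nu>. indicator {0<..\<delta>} x * x\<^sup>2)) \<longlongrightarrow> t\<^sup>2 / 2 * 0) (at_right 0)"
    by (intro tendsto_mult tendsto_const small_jumps_tendsto)
  then have "\<forall>\<^sub>F \<delta> in at_right 0. t\<^sup>2 / 2 * (LINT x|\<nu>. indicator {0<..\<delta>} x * x\<^sup>2) < e"
    by (rule order_tendstoD(2)) (use assms(1) in simp)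
  moreover have "\<forall>\<^sub>F \<delta> in at_right 0. \<delta> \<in> {0<..<\<delta>0}"
    using assms(2) by (rule eventually_at_right_real)
  ultimately have "\<forall>\<^sub>F \<delta> in at_right 0. \<delta> \<in> {0<..<\<delta>0} \<and> t\<^sup>2 / 2 * (LINT x|\<nu>. indicator {0<..\<delta>} x * x\<^sup>2) < e"
    by eventually_elim simp
  then obtain \<delta> where "\<delta> \<in> {0<..<\<delta>0}" "t\<^sup>2 / 2 * (LINT x|\<nu>. indicator {0<..\<delta>} x * x\<^sup>2) < e"
    using eventually_happens'[OF trivial_limit_at_right_real] by blast
  then show ?thesis using psi_levy_main[of \<delta> t] by (intro that) auto
qed

lemma Ex_tendsto:
  assumes hA: "\<And>x. x > 0 \<Longrightarrow> (\<lambda>d. Ft d x) \<longlonglongrightarrow> - L x"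
    and hB: "\<And>\<tau>. \<tau> > 0 \<Longrightarrow> (\<lambda>d. Sm d \<tau> - A d) \<longlonglongrightarrow> levy_shift \<tau>"
    and hC: "\<And>e. e > 0 \<Longrightarrow> \<exists>\<tau>0>0. \<forall>\<tau>. 0 < \<tau> \<and> \<tau> < \<tau>0 \<longrightarrow> (\<forall>\<^sub>F d in sequentially. \<bar>Sv d \<tau> - \<sigma>2\<bar> \<le> e)"
  shows "(\<lambda>d. Ex d t) \<longlonglongrightarrow> psi t"
proof (rule tendstoI)
  fix e :: real assume e: "e > 0"
  obtain \<delta>0 where \<delta>0: "\<delta>0 > 0" "\<And>\<delta>. 0 < \<delta> \<Longrightarrow> \<delta> < \<delta>0 \<Longrightarrow> \<forall>\<^sub>F d in sequentially.
     norm (Ex d t - \<i> * complex_of_real (t * (Sm d \<delta> - A d - levy_shift \<delta>)) - levy_main \<delta> t) \<le> e/4"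
    using Ex_key[OF hA hC, of "e/4" t] e by auto
  obtain \<delta> where \<delta>: "0 < \<delta>" "\<delta> < \<delta>0" "norm (psi t - levy_main \<delta> t) \<le> e/4"
    using small_jumps_choice[of "e/4" \<delta>0 t] e \<delta>0(1) by auto
  have "(\<lambda>d. \<i> * complex_of_real (t * (Sm d \<delta> - A d - levy_shift \<delta>))) \<longlonglongrightarrow> \<i> * complex_of_real (t * (levy_shift \<delta> - levy_shift \<delta>))"
    by (intro tendsto_intros hB \<delta>)
  from tendstoD[OF this, of "e/4"]
  have "\<forall>\<^sub>F d in sequentially. norm (\<i> * complex_of_real (t * (Sm d \<delta> - A d - levy_shift \<delta>))) < e/4"
    unfolding diff_self mult_zero_right of_real_0 dist_norm diff_zero using e by simp
  then show "\<forall>\<^sub>F d in sequentially. dist (Ex d t) (psi t) < e"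
    using \<delta>0(2)[OF \<delta>(1,2)]
  proof eventually_elim
    case (elim d)
    have tri: "norm (x - p) \<le> norm (x - s - m) + norm s + norm (p - m)" for x p s m :: complex
    proof -
      have "norm (((x - s - m) + s) - (p - m)) \<le> norm (x - s - m) + norm s + norm (p - m)"
        by (rule order_trans[OF norm_triangle_ineq4 add_right_mono[OF norm_triangle_ineq]])
      then show ?thesis by simp
    qed
    show ?case
      using tri[of "Ex d t" "psi t" "\<i> * complex_of_real (t * (Sm d \<delta> - A d - levy_shift \<delta>))" "levy_main \<delta> t"] elim \<delta>(3) e
      unfolding dist_norm by linarith
  qed
qed

lemma charS_tendsto:
  assumes hA: "\<And>x. x > 0 \<Longrightarrow> (\<lambda>d. Ft d x) \<longlonglongrightarrow> - L x"
    and hB: "\<And>\<tau>. \<tau> > 0 \<Longrightarrow> (\<lambda>d. Sm d \<tau> - A d) \<longlonglongrightarrow> levy_shift \<tau>"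
    and hC: "\<And>e. e > 0 \<Longrightarrow> \<exists>\<tau>0>0. \<forall>\<tau>. 0 < \<tau> \<and> \<tau> < \<tau>0 \<longrightarrow> (\<forall>\<^sub>F d in sequentially. \<bar>Sv d \<tau> - \<sigma>2\<bar> \<le> e)"
  shows "(\<lambda>d. charS d t) \<longlonglongrightarrow> exp (psi t)"
proof -
  obtain B where B: "\<forall>\<^sub>F d in sequentially. Ks d \<le> B" using Ks_bounded[OF hA hC] by blast
  have "(\<lambda>d. charS d t - exp (Ex d t)) \<longlonglongrightarrow> 0"
  proof (rule tendstoI)
    fix e :: real assume "e > 0"
    then show "\<forall>\<^sub>F d in sequentially. dist (charS d t - exp (Ex d t)) 0 < e"
      using charS_approx[OF B, of "e/2" "\<bar>t\<bar>"] by (auto elim!: eventually_mono)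
  qed
  moreover have "(\<lambda>d. exp (Ex d t)) \<longlonglongrightarrow> exp (psi t)"
    by (intro tendsto_exp Ex_tendsto hA hB hC)
  ultimately have "(\<lambda>d. (charS d t - exp (Ex d t)) + exp (Ex d t)) \<longlonglongrightarrow> 0 + exp (psi t)"
    by (rule tendsto_add)
  then show ?thesis by simp
qed

text \<open>By \<open>trm1_diff\<close> the strip sum is an integral of a continuous function above
  \<open>\<delta>\<close> minus a tail sum. Both converge under (A), and
  \<open>levy_shift_diff\<close> recognises the limit.\<close>

lemma Sm_diff_tendsto:
  assumes hA: "\<And>x. x > 0 \<Longrightarrow> (\<lambda>d. Ft d x) \<longlonglongrightarrow> - L x" and "0 < \<delta>" "\<delta> < \<tau>"
  shows "(\<lambda>d. Sm d \<tau> - Sm d \<delta>) \<longlonglongrightarrow> levy_shift \<tau> - levy_shift \<delta>"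
proof -
  define f where "f x = complex_of_real (min (max x 0) \<tau>)" for x
  have f: "isCont f x" "norm (f x) \<le> \<tau>" for x
    unfolding f_def using assms by (auto intro!: continuous_intros)
  have ind: "indicator {\<delta><..} x * f x = complex_of_real (indicator {\<delta><..} x * min x \<tau>)" for x
    using assms by (auto simp: f_def split: split_indicator)
  have "(\<lambda>d. Re (\<Sum>j=1..d. E (Q d j) (\<lambda>x. indicator {\<delta><..} x * f x))) \<longlonglongrightarrow> Re (CLINT x|\<nu>. indicator {\<delta><..} x * f x)"
    by (intro tendsto_Re tail_integral_tendsto[OF hA f] assms)
  then have "(\<lambda>d. \<Sum>j=1..d. E (Q d j) (\<lambda>x. indicator {\<delta><..} x * min x \<tau>)) \<longlonglongrightarrow> (LINT x|\<nu>. indicator {\<delta><..} x * min x \<tau>)"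
    unfolding ind integral_complex_of_real Re_sum Re_complex_of_real .
  then have "(\<lambda>d. (\<Sum>j=1..d. E (Q d j) (\<lambda>x. indicator {\<delta><..} x * min x \<tau>)) - \<tau> * Ft d \<tau>)
      \<longlonglongrightarrow> (LINT x|\<nu>. indicator {\<delta><..} x * min x \<tau>) - \<tau> * (- L \<tau>)"
    using assms by (intro tendsto_intros hA) auto
  moreover have "(\<Sum>j=1..d. E (Q d j) (\<lambda>x. indicator {\<delta><..} x * min x \<tau>)) - \<tau> * Ft d \<tau> = Sm d \<tau> - Sm d \<delta>" for d
    unfolding Sm_def Ft_def sum_subtractf[symmetric] sum_distrib_left
    by (intro sum.cong refl Q.trm1_diff(3)[symmetric]) (use assms in auto)
  moreover have "(LINT x|\<nu>. indicator {\<delta><..} x * min x \<tau>) - \<tau> * (- L \<tau>) = levy_shift \<tau> - levy_shift \<delta>"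
  proof -
    have i1: "integrable \<nu> (indicator {\<tau><..} :: real \<Rightarrow> real)"
      using emeasure_nu_tail[of \<tau>] assms by (intro integrable_real_indicator) auto
    have i2: "integrable \<nu> (\<lambda>x. indicator {\<delta><..\<tau>} x * x)"
    proof -
      have "integrable \<nu> (\<lambda>x. indicator {\<delta><..\<tau>} x * (x^3 / (1 + x\<^sup>2)) + indicator {\<delta><..\<tau>} x * (x / (1 + x\<^sup>2)))"
        by (intro Bochner_Integration.integrable_add integrable_cube_ratio integrable_linear_ratio[of \<delta>]) (use assms in auto)
      then show ?thesis unfolding distrib_left[symmetric] cube_plus_linear_ratio .
    qed
    have e: "(\<lambda>x. indicator {\<delta><..} x * min x \<tau>) = (\<lambda>x. indicator {\<delta><..\<tau>} x * x + \<tau> * indicator {\<tau><..} x)"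
      using assms by (auto simp: fun_eq_iff split: split_indicator)
    have "(LINT x|\<nu>. indicator {\<delta><..} x * min x \<tau>) = (LINT x|\<nu>. indicator {\<delta><..\<tau>} x * x) + \<tau> * measure \<nu> {\<tau><..}"
      unfolding e using i1 i2 by simp
    then show ?thesis
      using levy_shift_diff[OF assms(2,3)] measure_nu_tail[of \<tau>] assms by (simp add: set_integral_nu_eq)
  qed
  ultimately show ?thesis by simp
qed

text \<open>Read backwards at \<open>t = 1\<close>, \<open>Ex_key\<close> bounds the drift error by
  the distance of the exponents and the discarded small jumps. This settles a threshold
  \<open>\<delta>\<close> near 0; the strip up to \<open>\<tau>\<close> is left to
  \<open>Sm_diff_tendsto\<close>.\<close>

lemma Sm_tendsto:
  assumes hA: "\<And>x. x > 0 \<Longrightarrow> (\<lambda>d. Ft d x) \<longlonglongrightarrow> - L x"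
    and hC: "\<And>e. e > 0 \<Longrightarrow> \<exists>\<tau>0>0. \<forall>\<tau>. 0 < \<tau> \<and> \<tau> < \<tau>0 \<longrightarrow> (\<forall>\<^sub>F d in sequentially. \<bar>Sv d \<tau> - \<sigma>2\<bar> \<le> e)"
    and lim: "(\<lambda>d. Ex d 1) \<longlonglongrightarrow> psi 1" and \<tau>: "\<tau> > 0"
  shows "(\<lambda>d. Sm d \<tau> - A d) \<longlonglongrightarrow> levy_shift \<tau>"
proof (rule tendstoI)
  fix e :: real assume e: "e > 0"
  obtain \<delta>0 where \<delta>0: "\<delta>0 > 0" "\<And>\<delta>. 0 < \<delta> \<Longrightarrow> \<delta> < \<delta>0 \<Longrightarrow> \<forall>\<^sub>F d in sequentially.
     norm (Ex d 1 - \<i> * complex_of_real (1 * (Sm d \<delta> - A d - levy_shift \<delta>)) - levy_main \<delta> 1) \<le> e/5"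
    using Ex_key[OF hA hC, of "e/5" 1] e by auto
  obtain \<delta> where \<delta>: "0 < \<delta>" "\<delta> < min \<delta>0 \<tau>" "norm (psi 1 - levy_main \<delta> 1) \<le> e/5"
    using small_jumps_choice[of "e/5" "min \<delta>0 \<tau>" 1] e \<delta>0(1) \<tau> by auto
  have "\<forall>\<^sub>F d in sequentially. norm (Ex d 1 - psi 1) < e/5"
    using tendstoD[OF lim, of "e/5"] e by (simp add: dist_norm)
  moreover have "\<forall>\<^sub>F d in sequentially. \<bar>(Sm d \<tau> - Sm d \<delta>) - (levy_shift \<tau> - levy_shift \<delta>)\<bar> < e/5"
    using tendstoD[OF Sm_diff_tendsto[OF hA \<delta>(1), of \<tau>], of "e/5"] e \<delta> by (simp add: dist_real_def)
  moreover have "\<delta> < \<delta>0" using \<delta> by simp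
  note \<delta>0(2)[OF \<delta>(1) this]
  ultimately show "\<forall>\<^sub>F d in sequentially. dist (Sm d \<tau> - A d) (levy_shift \<tau>) < e"
  proof eventually_elim
    case (elim d)
    have tri: "norm s \<le> norm (x - s - m) + norm (x - p) + norm (p - m)" for x p s m :: complex
    proof -
      have "norm (((x - p) + (p - m)) - (x - s - m)) \<le> norm (x - p) + norm (p - m) + norm (x - s - m)"
        by (rule order_trans[OF norm_triangle_ineq4 add_right_mono[OF norm_triangle_ineq]])
      then show ?thesis by simp
    qed
    have "norm (\<i> * complex_of_real (1 * (Sm d \<delta> - A d - levy_shift \<delta>))) \<le> e/5 + e/5 + e/5"
      using tri[of "\<i> * complex_of_real (1 * (Sm d \<delta> - A d - levy_shift \<delta>))" "Ex d 1" "levy_main \<delta> 1" "psi 1"] elim \<delta>(3)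
      by linarith
    then have "\<bar>Sm d \<delta> - A d - levy_shift \<delta>\<bar> \<le> e/5 + e/5 + e/5"
      by (simp only: norm_mult norm_ii norm_of_real mult_1)
    then show ?case using elim(2) e unfolding dist_real_def by linarith
  qed
qed

end

section \<open>Null arrays: necessity\<close>

lemma isCont_pchar: "isCont (pchar p) t"
proof -
  have "pchar p = char (distr (measure_pmf p) borel (\<lambda>x. x))"
    using pchar_eq_char by (auto simp: fun_eq_iff)
  moreover have "real_distribution (distr (measure_pmf p) borel (\<lambda>x. x))"
    by (rule prob_space.real_distribution_distr[OF prob_space_measure_pmf]) simp
  ultimately show ?thesis using real_distribution.isCont_char by metis
qed

lemma isCont_betac: "isCont (betac p) t"
proof -
  have "betac p = (\<lambda>t. iexp (- t * trm1 p 1) * pchar p t - 1)"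
    using betac_pchar[of p] by (auto simp: fun_eq_iff algebra_simps)
  then show ?thesis using isCont_pchar by (auto intro!: continuous_intros)
qed

lemma norm_pchar_le: "norm (pchar p t) \<le> 1"
proof -
  have "norm (pchar p t) \<le> E p (\<lambda>x. 1)"
    unfolding pchar_def by (rule norm_expectation_le) auto
  then show ?thesis by simp
qed

lemma betac_second_difference:
  "betac p t - (betac p (t + s) + betac p (t - s)) / 2
    = E p (\<lambda>x. iexp (t * (x - trm1 p 1)) * complex_of_real (1 - cos (s * (x - trm1 p 1))))"
proof -
  have i: "complex_integrable (measure_pmf p) (\<lambda>x. iexp (u * (x - trm1 p 1)))" for u
    by (rule integrable_iexp_pmf)
  have "E p (\<lambda>x. iexp (t * (x - trm1 p 1)) * complex_of_real (1 - cos (s * (x - trm1 p 1))))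
    = E p (\<lambda>x. iexp (t * (x - trm1 p 1)) - (iexp ((t + s) * (x - trm1 p 1)) + iexp ((t - s) * (x - trm1 p 1))) / 2)"
    by (simp only: iexp_second_difference)
  also have "\<dots> = E p (\<lambda>x. iexp (t * (x - trm1 p 1))) - (E p (\<lambda>x. iexp ((t + s) * (x - trm1 p 1))) + E p (\<lambda>x. iexp ((t - s) * (x - trm1 p 1)))) / 2"
    using i[of t] i[of "t + s"] i[of "t - s"]
    by (subst Bochner_Integration.integral_diff)
      (simp_all only: Bochner_Integration.integral_add integral_divide_zero Bochner_Integration.integrable_add integrable_divide)
  also have "\<dots> = betac p t - (betac p (t + s) + betac p (t - s)) / 2"
    unfolding betac_def by (simp add: field_simps)
  finally show ?thesis by simp
qed

text \<open>Averaging turns the second difference into a characteristic function again, that of the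
  centered law with density \<open>wt\<close>.\<close>

lemma integral_betac_second_difference:
  "(CLINT s|unif. betac p t - (betac p (t + s) + betac p (t - s)) / 2)
    = E p (\<lambda>x. complex_of_real (wt (x - trm1 p 1)) * iexp (t * (x - trm1 p 1)))"
proof -
  let ?K = "distr (measure_pmf p) borel (\<lambda>x. x - trm1 p 1)"
  interpret K: prob_space ?K by (rule measure_pmf.prob_space_distr) simp
  have i: "integrable ?K (\<lambda>x. min 1 (x\<^sup>2))"
    by (rule K.integrable_const_bound[of _ 1]) auto
  have "(CLINT s|unif. CLINT x|?K. iexp (t * x) * complex_of_real (1 - cos (s * x)))
      = (CLINT x|?K. iexp (t * x) * complex_of_real (wt x))"
    by (rule integral_wt_iexp[OF K.sigma_finite_measure_axioms _ i]) simp
  moreover have "(CLINT x|?K. iexp (t * x) * complex_of_real (1 - cos (s * x)))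
     = betac p t - (betac p (t + s) + betac p (t - s)) / 2" for s
    unfolding betac_second_difference by (rule integral_distr) auto
  moreover have "(CLINT x|?K. iexp (t * x) * complex_of_real (wt x))
     = E p (\<lambda>x. iexp (t * (x - trm1 p 1)) * complex_of_real (wt (x - trm1 p 1)))"
    by (rule integral_distr) auto
  ultimately show ?thesis by (simp only: mult.commute)
qed

context null_array
begin

section \<open>Exponents recovered from characteristic functions\<close>

lemma isCont_Ex: "isCont (Ex d) t"
  unfolding Ex_def[abs_def] by (intro continuous_intros isCont_betac)

lemma psi_bounded: "\<exists>M. \<forall>t. \<bar>t\<bar> \<le> R \<longrightarrow> norm (psi t) \<le> M"
proof -
  have "compact (psi ` {-R..R})"
    by (intro compact_continuous_image continuous_at_imp_continuous_on ballI isCont_psi) simp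
  then obtain M where "\<forall>z\<in>psi ` {-R..R}. norm z \<le> M"
    using compact_imp_bounded bounded_iff by blast
  then show ?thesis by (intro exI[of _ M]) (auto simp: abs_le_iff minus_le_iff)
qed

context
  assumes unif_conv: "\<And>R e. e > 0 \<Longrightarrow> \<forall>\<^sub>F d in sequentially. \<forall>t. \<bar>t\<bar> \<le> R \<longrightarrow> norm (charS d t - exp (psi t)) < e"
begin

text \<open>The limit has no zeros on \<open>[-1, 1]\<close>, so \<open>|charS|\<close> stays above
  \<open>r\<close> there, and \<open>1 - u^2 <= - 2 * ln u\<close> bounds the sum of
  \<open>1 - |pchar|^2\<close> by \<open>- 2 * ln r\<close>. Averaging over \<open>[-1, 1]\<close>
  gives \<open>symw\<close>, which dominates \<open>spread\<close>.\<close>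

lemma Ks_bounded_of_conv: "\<exists>B. \<forall>\<^sub>F d in sequentially. Ks d \<le> B"
proof -
  obtain M where M: "\<And>t. \<bar>t\<bar> \<le> 1 \<Longrightarrow> norm (psi t) \<le> M" using psi_bounded[of 1] by blast
  \<comment> \<open>Half of the lower bound \<open>exp (- M)\<close> for the limit; the other half
    pays for the approximation error.\<close>
  define r where "r = exp (- M) / 2"
  have r: "r > 0" by (simp add: r_def)
  have low: "norm (exp (psi t)) \<ge> 2 * r" if "\<bar>t\<bar> \<le> 1" for t
    using M[OF that] abs_Re_le_cmod[of "psi t"] by (simp add: r_def)
  define B0 where "B0 = - 2 * ln r"
  have "\<forall>\<^sub>F d in sequentially. Ks d \<le> 132 * B0"
    using unif_conv[OF r, of 1] null[of "1/2" "1/2", simplified]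
  proof eventually_elim
    case (elim d)
    have g: "(\<Sum>j=1..d. 1 - (norm (pchar (Q d j) s))\<^sup>2) \<le> B0" if s: "\<bar>s\<bar> \<le> 1" for s
    proof -
      have "norm (exp (psi s)) - norm (charS d s) \<le> norm (charS d s - exp (psi s))"
        by (metis norm_minus_commute norm_triangle_ineq2)
      moreover have "norm (charS d s - exp (psi s)) < r" using elim(1) s by blast
      ultimately have "r \<le> norm (charS d s)" using low[OF s] by linarith
      then have P: "r \<le> (\<Prod>j=1..d. norm (pchar (Q d j) s))"
        by (simp add: charS_def norm_mult prod_norm)
      have pos: "norm (pchar (Q d j) s) > 0" if j: "j \<in> {1..d}" for j
      proof (rule ccontr)
        assume "\<not> norm (pchar (Q d j) s) > 0"
        then have "norm (pchar (Q d j) s) = 0" using norm_ge_zero[of "pchar (Q d j) s"] by linarith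
        then have "(\<Prod>j=1..d. norm (pchar (Q d j) s)) = 0" using j by (intro prod_zero) auto
        then show False using P r by linarith
      qed
      have "(\<Sum>j=1..d. 1 - (norm (pchar (Q d j) s))\<^sup>2) \<le> (\<Sum>j=1..d. - 2 * ln (norm (pchar (Q d j) s)))"
      proof (rule sum_mono)
        fix j assume j: "j \<in> {1..d}"
        have "ln ((norm (pchar (Q d j) s))\<^sup>2) \<le> (norm (pchar (Q d j) s))\<^sup>2 - 1"
          using pos[OF j] by (intro ln_le_minus_one) simp
        then show "1 - (norm (pchar (Q d j) s))\<^sup>2 \<le> - 2 * ln (norm (pchar (Q d j) s))"
          using pos[OF j] by (simp add: ln_realpow)
      qed
      also have "\<dots> = - 2 * ln (\<Prod>j=1..d. norm (pchar (Q d j) s))"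
        using pos by (subst ln_prod) (auto simp: sum_distrib_left)
      also have "\<dots> \<le> B0" using P r by (simp add: B0_def)
      finally show ?thesis .
    qed
    have m: "(\<lambda>s. 1 - (norm (pchar (Q d j) s))\<^sup>2) \<in> borel_measurable borel" for j
      by (intro borel_measurable_continuous_onI continuous_at_imp_continuous_on ballI continuous_intros isCont_pchar)
    have i: "integrable unif (\<lambda>s. 1 - (norm (pchar (Q d j) s))\<^sup>2)" for j
    proof (rule unif.integrable_const_bound[of _ 1])
      show "AE s in unif. norm (1 - (norm (pchar (Q d j) s))\<^sup>2) \<le> 1"
        using norm_pchar_le[of "Q d j"] by (intro AE_I2) (simp add: abs_le_iff power_le_one)
    qed (use m in \<open>simp add: measurable_cong_sets[OF sets_unif refl]\<close>)
    have "(\<Sum>j=1..d. symw (Q d j)) = (\<integral>s. (\<Sum>j=1..d. 1 - (norm (pchar (Q d j) s))\<^sup>2) \<partial>unif)"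
      unfolding integral_unif_pchar[symmetric] by (rule Bochner_Integration.integral_sum[symmetric]) (rule i)
    also have "\<dots> \<le> (\<integral>s. B0 \<partial>unif)"
    proof (rule integral_mono_AE)
      show "AE s in unif. (\<Sum>j=1..d. 1 - (norm (pchar (Q d j) s))\<^sup>2) \<le> B0"
        using AE_unif by eventually_elim (rule g)
    qed (auto intro!: Bochner_Integration.integrable_sum i)
    also have "\<dots> = B0" using unif.prob_space by simp
    finally have sb: "(\<Sum>j=1..d. symw (Q d j)) \<le> B0" .
    have "Ks d \<le> (\<Sum>j=1..d. 132 * symw (Q d j))"
      unfolding Ks_def by (intro sum_mono Q.spread_le_symw) (use elim(2) in auto)
    then show ?case using sb by (simp add: sum_distrib_left[symmetric])
  qed
  then show ?thesis by blast
qed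

text \<open>Dividing by the limit, which has no zeros, gives \<open>exp (D d u)\<close> close to 1
  uniformly on \<open>[-R, R]\<close>. As \<open>D d\<close> is continuous and vanishes at 0, its
  imaginary part cannot leave \<open>(-pi/2, pi/2)\<close>, where the principal logarithm inverts
  the exponential.\<close>

lemma Ex_tendsto_of_conv: "(\<lambda>d. Ex d t) \<longlonglongrightarrow> psi t"
proof -
  define R where "R = \<bar>t\<bar>"
  obtain B where B: "\<forall>\<^sub>F d in sequentially. Ks d \<le> B" using Ks_bounded_of_conv by blast
  obtain M where M: "\<And>u. \<bar>u\<bar> \<le> R \<Longrightarrow> norm (psi u) \<le> M" using psi_bounded[of R] by blast
  define D where "D d u = Ex d u - psi u" for d u
  have key: "\<forall>\<^sub>F d in sequentially. \<forall>u. \<bar>u\<bar> \<le> R \<longrightarrow> norm (exp (D d u) - 1) < e" if "e > 0" for e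
  proof -
    define e' where "e' = e * exp (- M) / 3"
    have e': "e' > 0" using that by (simp add: e'_def)
    show ?thesis
      using unif_conv[OF e', of R] charS_approx[OF B e', of R]
    proof eventually_elim
      case (elim d)
      show ?case
      proof (intro allI impI)
        fix u assume u: "\<bar>u\<bar> \<le> R"
        have "norm ((charS d u - exp (psi u)) - (charS d u - exp (Ex d u))) \<le> e' + e'"
          by (rule order_trans[OF norm_triangle_ineq4 add_mono]) (use elim u in \<open>auto intro: less_imp_le\<close>)
        then have 1: "norm (exp (Ex d u) - exp (psi u)) \<le> 2 * e'" by simp
        have 2: "exp (D d u) - 1 = (exp (Ex d u) - exp (psi u)) * exp (- psi u)"
          by (simp add: D_def exp_diff exp_minus field_simps)
        have 3: "norm (exp (- psi u)) \<le> exp M"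
          using M[OF u] abs_Re_le_cmod[of "psi u"] by simp
        have "norm (exp (D d u) - 1) \<le> (2 * e') * exp M"
          unfolding 2 norm_mult using 1 3 e' by (intro mult_mono) auto
        also have "\<dots> = 2 * e / 3" by (simp add: e'_def exp_minus field_simps)
        also have "\<dots> < e" using that by simp
        finally show "norm (exp (D d u) - 1) < e" .
      qed
    qed
  qed
  have tR: "\<bar>t\<bar> \<le> R" by (simp add: R_def)
  have "(\<lambda>d. exp (D d t)) \<longlonglongrightarrow> 1"
  proof (rule tendstoI)
    fix e :: real assume "e > 0"
    from key[OF this] show "\<forall>\<^sub>F d in sequentially. dist (exp (D d t)) 1 < e"
      unfolding dist_norm by eventually_elim (use tR in blast)
  qed
  then have "(\<lambda>d. Ln (exp (D d t))) \<longlonglongrightarrow> Ln 1"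
    by (intro tendsto_Ln) auto
  moreover have "\<forall>\<^sub>F d in sequentially. Ln (exp (D d t)) = D d t"
    using key[of 1, OF zero_less_one]
  proof eventually_elim
    case (elim d)
    have cosp: "cos (Im (D d u)) > 0" if "\<bar>u\<bar> \<le> R" for u
    proof -
      have "\<bar>Re (exp (D d u) - 1)\<bar> < 1" using elim that abs_Re_le_cmod order_le_less_trans by blast
      then have "0 < Re (exp (D d u))" by simp
      then show ?thesis by (simp add: Re_exp zero_less_mult_iff)
    qed
    \<comment> \<open>The segment from 0 to \<open>t\<close> is parametrised by \<open>v\<close>. If
      \<open>h\<close> reached \<open>pi/2\<close> somewhere, the cosine would vanish there, against
      \<open>cosp\<close>.\<close>
    define h where "h v = \<bar>Im (D d (v * t))\<bar>" for v
    have hc: "isCont h v" for v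
    proof -
      have "isCont (\<lambda>v. D d (v * t)) v"
        unfolding D_def by (intro continuous_intros isCont_o2[OF _ isCont_Ex] isCont_o2[OF _ isCont_psi])
      then show ?thesis unfolding h_def by (intro continuous_rabs isCont_Im)
    qed
    have h0: "h 0 = 0" by (simp add: h_def D_def Ex_def betac_def psi_0)
    have "h 1 < pi/2"
    proof (rule ccontr)
      assume "\<not> h 1 < pi/2"
      then have "pi/2 \<le> h 1" by simp
      moreover have "h 0 \<le> pi/2" using h0 by simp
      ultimately obtain v where v: "0 \<le> v" "v \<le> 1" "h v = pi/2"
        using IVT[of h 0 "pi/2" 1] hc by auto
      have "\<bar>v * t\<bar> \<le> R" using v by (simp add: abs_mult R_def mult_left_le_one_le)
      then have "cos (Im (D d (v * t))) > 0" by (rule cosp)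
      moreover have "cos (Im (D d (v * t))) = cos (h v)" unfolding h_def by (simp add: cos_abs_real)
      ultimately show False using v(3) by simp
    qed
    then have a: "\<bar>Im (D d t)\<bar> < pi / 2" by (simp add: h_def)
    have "- pi < Im (D d t)" "Im (D d t) \<le> pi" using a pi_gt_zero by (auto simp: abs_less_iff)
    then show ?case by (rule Ln_exp)
  qed
  ultimately have "(\<lambda>d. D d t) \<longlonglongrightarrow> 0"
    using Lim_transform_eventually by fastforce
  then show ?thesis unfolding D_def by (rule LIM_zero_cancel)
qed

end

text \<open>Testing the sums against \<open>F\<close> amounts to testing the finite measures with density
  \<open>wt\<close> against \<open>F / wt\<close>; their characteristic functions are averaged second differences of
  \<open>Ex d\<close>, from which the centering constants cancel.\<close>

lemma sum_expectation_tendsto: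
  fixes F :: "real \<Rightarrow> real"
  assumes B: "\<forall>\<^sub>F d in sequentially. Ks d \<le> B" and lim: "\<And>t. (\<lambda>d. Ex d t) \<longlonglongrightarrow> psi t"
    and Fc: "\<And>x. isCont F x" and Fb: "\<And>x. \<bar>F x\<bar> \<le> C * min 1 (x\<^sup>2)"
    and Fl: "((\<lambda>x. F x / x\<^sup>2) \<longlongrightarrow> l) (at 0)"
  shows "(\<lambda>d. \<Sum>j=1..d. E (Q d j) (\<lambda>x. F (x - trm1 (Q d j) 1))) \<longlonglongrightarrow> l * \<sigma>2 + (LINT x|\<nu>. F x)"
proof -
  define R where "R d j = map_pmf (\<lambda>x. x - trm1 (Q d j) 1) (Q d j)" for d j
  define H where "H d = msum {1..d} (\<lambda>j. wmeas (R d j) wt)" for d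
  \<comment> \<open>The limit measure has two parts, indexed by \<open>bool\<close>: an atom of mass
    \<open>\<sigma>2 / 6\<close> at 0 and the jump measure with density \<open>wt\<close>.\<close>
  define N0 :: "bool \<Rightarrow> real measure" where
    "N0 i = (if i then wmeas (return_pmf 0) (\<lambda>_. \<sigma>2 / 6) else density \<nu> (\<lambda>x. ennreal (wt x)))" for i
  define H0 where "H0 = msum UNIV N0"
  have wt2: "wt x \<le> 2" for x using wt_le[of x] by (simp add: min_def split: if_splits)
  have iwt: "integrable \<nu> wt"
    by (rule integrable_nu_bound[where C=2]) (auto simp: wt_nonneg wt_le)
  have wf: "finite_measure (wmeas (R d j) wt)" for d j
    by (rule finite_measure_wmeas[of _ 2]) (auto simp: wt2)
  have N0s: "sets (N0 i) = sets borel" for i by (simp add: N0_def)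
  have N0f: "finite_measure (N0 i)" for i
  proof (cases i)
    case True
    then show ?thesis unfolding N0_def by (auto intro!: finite_measure_wmeas[of _ "\<sigma>2/6"])
  next
    case False
    have "(\<integral>\<^sup>+x. ennreal (wt x) \<partial>\<nu>) < \<infinity>"
      using integrableD(2)[OF iwt] by (simp add: wt_nonneg less_top)
    then show ?thesis using False unfolding N0_def
      by (intro finite_measureI) (auto simp: emeasure_density)
  qed
  have Hf: "finite_measure (H d)" "sets (H d) = sets borel" for d
    unfolding H_def by (auto intro!: finite_measure_msum simp: wf)
  have H0f: "finite_measure H0" "sets H0 = sets borel"
    unfolding H0_def by (auto intro!: finite_measure_msum simp: N0f N0s)
  have UB: "(UNIV::bool set) = {True, False}" by auto
  have intH: "(\<integral>x. f x \<partial>H d) = (\<Sum>j=1..d. E (Q d j) (\<lambda>x. complex_of_real (wt (x - trm1 (Q d j) 1)) * f (x - trm1 (Q d j) 1)))"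
    if fm: "f \<in> borel_measurable borel" "\<And>x. norm (f x) \<le> b" for f :: "real \<Rightarrow> complex" and b d
  proof -
    have "(\<integral>x. f x \<partial>H d) = (\<Sum>j=1..d. \<integral>x. f x \<partial>wmeas (R d j) wt)"
      unfolding H_def by (rule integral_msum[OF _ _ _ fm]) (auto simp: wf)
    also have "\<dots> = (\<Sum>j=1..d. E (R d j) (\<lambda>x. wt x *\<^sub>R f x))"
      by (intro sum.cong refl integral_wmeas) (auto simp: wt_nonneg fm)
    finally show ?thesis unfolding R_def by (simp add: integral_map_pmf scaleR_conv_of_real)
  qed
  have intH0: "(\<integral>x. f x \<partial>H0) = complex_of_real (\<sigma>2/6) * f 0 + (CLINT x|\<nu>. complex_of_real (wt x) * f x)"
    if fm[measurable]: "f \<in> borel_measurable borel" and "\<And>x. norm (f x) \<le> b" for f :: "real \<Rightarrow> complex" and b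
  proof -
    have "(\<integral>x. f x \<partial>H0) = (\<Sum>i\<in>UNIV. \<integral>x. f x \<partial>N0 i)"
      unfolding H0_def by (rule integral_msum[OF _ _ _ that]) (auto simp: N0f N0s)
    also have "\<dots> = (\<integral>x. f x \<partial>N0 True) + (\<integral>x. f x \<partial>N0 False)"
      unfolding UB by simp
    also have "(\<integral>x. f x \<partial>N0 True) = complex_of_real (\<sigma>2/6) * f 0"
      unfolding N0_def using s2_nonneg by (simp add: integral_wmeas scaleR_conv_of_real)
    also have "(\<integral>x. f x \<partial>N0 False) = (CLINT x|\<nu>. complex_of_real (wt x) * f x)"
      unfolding N0_def by (simp add: integral_density wt_nonneg scaleR_conv_of_real)
    finally show ?thesis .
  qed
  have betam: "betac p \<in> borel_measurable borel" for p
    by (intro borel_measurable_continuous_onI continuous_at_imp_continuous_on ballI isCont_betac)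
  have Exm: "Ex d \<in> borel_measurable borel" for d
    by (intro borel_measurable_continuous_onI continuous_at_imp_continuous_on ballI isCont_Ex)
  have psim: "psi \<in> borel_measurable borel"
    by (intro borel_measurable_continuous_onI continuous_at_imp_continuous_on ballI isCont_psi)
  note [measurable] = betam Exm psim
  define SD where "SD g t s = g t - (g (t + s) + g (t - s)) / 2" for g :: "real \<Rightarrow> complex" and t s
  have SDb: "norm (SD (betac (Q d j)) t s) \<le> 2 * ((\<bar>t\<bar> + 1)\<^sup>2 / 2 + (\<bar>t\<bar> + 1) + 2) * spread (Q d j)"
    if s: "\<bar>s\<bar> \<le> 1" for d j t s
  proof -
    define b where "b = ((\<bar>t\<bar> + 1)\<^sup>2 / 2 + (\<bar>t\<bar> + 1) + 2) * spread (Q d j)"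
    have bb: "norm (betac (Q d j) u) \<le> b" if "\<bar>u\<bar> \<le> \<bar>t\<bar> + 1" for u
    proof -
      have "u\<^sup>2 \<le> (\<bar>t\<bar> + 1)\<^sup>2" using that by (simp add: abs_le_square_iff[symmetric])
      then have "(u\<^sup>2 / 2 + \<bar>u\<bar> + 2) * spread (Q d j) \<le> b"
        unfolding b_def using that Q.spread_nonneg[of d j] by (intro mult_right_mono) auto
      then show ?thesis using Q.norm_betac_le[of d j u] by linarith
    qed
    have 1: "norm (betac (Q d j) t) \<le> b" "norm (betac (Q d j) (t + s)) \<le> b" "norm (betac (Q d j) (t - s)) \<le> b"
      using s by (auto intro!: bb)
    have "norm (SD (betac (Q d j)) t s) \<le> norm (betac (Q d j) t) + norm (betac (Q d j) (t + s) + betac (Q d j) (t - s)) / 2"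
      unfolding SD_def using norm_triangle_ineq4[of "betac (Q d j) t" "(betac (Q d j) (t + s) + betac (Q d j) (t - s)) / 2"]
      by (simp add: norm_divide)
    then show ?thesis
      using 1 norm_triangle_ineq[of "betac (Q d j) (t + s)" "betac (Q d j) (t - s)"] unfolding b_def by linarith
  qed
  have SDi: "complex_integrable unif (SD (betac (Q d j)) t)" for d j t
  proof (rule unif.integrable_const_bound)
    show "AE s in unif. norm (SD (betac (Q d j)) t s) \<le> 2 * ((\<bar>t\<bar> + 1)\<^sup>2 / 2 + (\<bar>t\<bar> + 1) + 2) * spread (Q d j)"
      using AE_unif by eventually_elim (rule SDb)
    show "SD (betac (Q d j)) t \<in> borel_measurable unif" unfolding SD_def by measurable
  qed
  have SDEx: "SD (Ex d) t s = (\<Sum>j=1..d. SD (betac (Q d j)) t s)" for d t s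
  proof -
    have alg: "(x + a) - ((y + b) + (z + c)) / 2 = (x - (y + z) / 2) + (a - (b + c) / 2)" for x y z a b c :: complex
      by (simp add: field_simps)
    have lin: "\<i> * complex_of_real (t * w) - (\<i> * complex_of_real ((t + s) * w) + \<i> * complex_of_real ((t - s) * w)) / 2 = 0" for w
      by (simp add: field_simps)
    show ?thesis
      unfolding SD_def Ex_def alg lin sum_subtractf sum_divide_distrib[symmetric] sum.distrib by simp
  qed
  have charH: "(CLINT x|H d. iexp (t * x)) = (CLINT s|unif. SD (Ex d) t s)" for d t
  proof -
    have "(CLINT x|H d. iexp (t * x)) = (\<Sum>j=1..d. CLINT s|unif. SD (betac (Q d j)) t s)"
      unfolding SD_def integral_betac_second_difference by (rule intH[of _ 1]) auto
    also have "\<dots> = (CLINT s|unif. SD (Ex d) t s)"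
      unfolding SDEx by (rule Bochner_Integration.integral_sum[symmetric]) (rule SDi)
    finally show ?thesis .
  qed
  have charH0: "(CLINT x|H0. iexp (t * x)) = (CLINT s|unif. SD psi t s)" for t
  proof -
    have "(CLINT x|H0. iexp (t * x)) = complex_of_real (\<sigma>2/6) * iexp (t * 0) + (CLINT x|\<nu>. complex_of_real (wt x) * iexp (t * x))"
      by (rule intH0[of _ 1]) auto
    then show ?thesis unfolding SD_def integral_psi_second_difference by (simp add: mult.commute)
  qed
  \<comment> \<open>The bound on \<open>Ks\<close> holds from some index on; shifting the sequence
    by it makes one dominating constant valid throughout.\<close>
  obtain n0 where n0: "\<And>d. d \<ge> n0 \<Longrightarrow> Ks d \<le> B" using B unfolding eventually_sequentially by blast
  have conv: "(\<lambda>d. CLINT x|H d. iexp (t * x)) \<longlonglongrightarrow> (CLINT x|H0. iexp (t * x))" for t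
    unfolding charH charH0
  proof (rule LIMSEQ_offset[where k=n0], rule integral_dominated_convergence[where w="\<lambda>_. 2 * ((\<bar>t\<bar> + 1)\<^sup>2 / 2 + (\<bar>t\<bar> + 1) + 2) * B"])
    show "AE s in unif. (\<lambda>d. SD (Ex (d + n0)) t s) \<longlonglongrightarrow> SD psi t s"
      unfolding SD_def by (intro AE_I2 tendsto_intros LIMSEQ_ignore_initial_segment lim) simp
    show "AE s in unif. norm (SD (Ex (d + n0)) t s) \<le> 2 * ((\<bar>t\<bar> + 1)\<^sup>2 / 2 + (\<bar>t\<bar> + 1) + 2) * B" for d
      using AE_unif
    proof eventually_elim
      case (elim s)
      have "norm (SD (Ex (d + n0)) t s) \<le> (\<Sum>j=1..d + n0. 2 * ((\<bar>t\<bar> + 1)\<^sup>2 / 2 + (\<bar>t\<bar> + 1) + 2) * spread (Q (d + n0) j))"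
        unfolding SDEx by (rule sum_norm_le) (rule SDb[OF elim])
      also have "\<dots> = 2 * ((\<bar>t\<bar> + 1)\<^sup>2 / 2 + (\<bar>t\<bar> + 1) + 2) * Ks (d + n0)"
        by (simp only: Ks_def sum_distrib_left)
      also have "\<dots> \<le> 2 * ((\<bar>t\<bar> + 1)\<^sup>2 / 2 + (\<bar>t\<bar> + 1) + 2) * B"
        using n0[of "d + n0"] by (intro mult_left_mono) auto
      finally show ?case .
    qed
    show "SD psi t \<in> borel_measurable unif" unfolding SD_def by measurable
    show "SD (Ex (d + n0)) t \<in> borel_measurable unif" for d unfolding SD_def by measurable
  qed simp
  \<comment> \<open>Since \<open>F x / wt x = (F x / x^2) * (x^2 / wt x)\<close> tends to
    \<open>l * 6\<close>, this value at 0 makes the quotient continuous; against the atom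
    \<open>\<sigma>2 / 6\<close> it produces \<open>l * \<sigma>2\<close>.\<close>
  define f where "f x = (if x = 0 then 6 * l else F x / wt x)" for x
  have F0: "F 0 = 0" using Fb[of 0] by simp
  have C0: "C \<ge> 0" using Fb[of 1] by simp
  have fF: "wt x * f x = F x" for x using wt_pos[of x] F0 by (cases "x = 0") (auto simp: f_def wt_def)
  have fb: "\<bar>f x\<bar> \<le> 8 * C + \<bar>6 * l\<bar>" for x
  proof (cases "x = 0")
    case False
    have "\<bar>F x\<bar> \<le> C * (8 * wt x)" using Fb[of x] wt_ge[of x] C0 mult_left_mono[of "min 1 (x\<^sup>2)" "8 * wt x" C] by linarith
    then have "\<bar>F x\<bar> / wt x \<le> 8 * C" using wt_pos[OF False] by (simp add: divide_le_eq mult_ac)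
    then show ?thesis using False wt_pos[OF False] by (simp add: f_def abs_divide)
  qed (use C0 in \<open>simp add: f_def\<close>)
  have fc: "isCont f x" for x
  proof (cases "x = 0")
    case True
    have "((\<lambda>x. F x / x\<^sup>2 * (x\<^sup>2 / wt x)) \<longlongrightarrow> l * 6) (at 0)"
      by (rule tendsto_mult[OF Fl wt_over_square])
    moreover have "\<forall>\<^sub>F x in at 0. F x / x\<^sup>2 * (x\<^sup>2 / wt x) = f x"
      unfolding eventually_at by (intro exI[of _ 1]) (auto simp: f_def)
    ultimately have "(f \<longlongrightarrow> l * 6) (at 0)" by (rule Lim_transform_eventually)
    then show ?thesis using True by (simp add: isCont_def f_def mult.commute)
  next
    case False
    have "isCont (\<lambda>x. F x / wt x) x"
      using wt_pos[OF False] by (intro continuous_divide Fc isCont_wt) auto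
    moreover have ev: "\<forall>\<^sub>F y in nhds x. f y = F y / wt y"
      using t1_space_nhds[OF False] by eventually_elim (simp add: f_def)
    ultimately show ?thesis unfolding isCont_cong[OF ev] by simp
  qed
  have fm: "f \<in> borel_measurable borel"
    by (intro borel_measurable_continuous_onI continuous_at_imp_continuous_on ballI fc)
  have "(\<lambda>d. \<integral>x. complex_of_real (f x) \<partial>H d) \<longlonglongrightarrow> (\<integral>x. complex_of_real (f x) \<partial>H0)"
    by (rule finite_measure_levy_continuity[OF Hf H0f conv, of _ "8 * C + \<bar>6 * l\<bar>"])
      (use fb fc in \<open>auto intro!: continuous_intros\<close>)
  moreover have "(\<integral>x. complex_of_real (f x) \<partial>H d) = complex_of_real (\<Sum>j=1..d. E (Q d j) (\<lambda>x. F (x - trm1 (Q d j) 1)))" for d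
    using fb fm by (subst intH[of _ "8 * C + \<bar>6 * l\<bar>"])
      (auto simp: fF integral_complex_of_real simp flip: of_real_mult)
  moreover have "(\<integral>x. complex_of_real (f x) \<partial>H0) = complex_of_real (l * \<sigma>2 + (LINT x|\<nu>. F x))"
  proof -
    have "(\<integral>x. complex_of_real (f x) \<partial>H0) = complex_of_real (\<sigma>2/6) * complex_of_real (f 0) + (CLINT x|\<nu>. complex_of_real (wt x) * complex_of_real (f x))"
      using fb fm by (intro intH0[of _ "8 * C + \<bar>6 * l\<bar>"]) auto
    also have "\<dots> = complex_of_real (\<sigma>2/6 * f 0 + (LINT x|\<nu>. F x))"
      unfolding of_real_mult[symmetric] fF integral_complex_of_real by simp
    also have "\<sigma>2/6 * f 0 = l * \<sigma>2" by (simp add: f_def)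
    finally show ?thesis .
  qed
  ultimately show ?thesis by (simp only: tendsto_of_real_iff)
qed

text \<open>A ramp is continuous and vanishes near 0, so the Gaussian part contributes nothing
  (\<open>l = 0\<close>), and the limit lies between the tails of the jump measure at the two ends
  of the ramp.\<close>

lemma ramp_sum_tendsto:
  assumes B: "\<forall>\<^sub>F d in sequentially. Ks d \<le> B" and lim: "\<And>t. (\<lambda>d. Ex d t) \<longlonglongrightarrow> psi t"
    and uv: "0 < u" "u < v"
  defines "r \<equiv> \<lambda>x. min 1 (max 0 ((x - u) / (v - u)))"
  obtains I where "(\<lambda>d. \<Sum>j=1..d. E (Q d j) (\<lambda>x. r (x - trm1 (Q d j) 1))) \<longlonglongrightarrow> I" "- L v \<le> I" "I \<le> - L u"
proof (rule that)
  have r0: "r x = 0" if "x \<le> u" for x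
  proof -
    have "(x - u) / (v - u) \<le> 0" using that uv by (intro divide_nonpos_pos) auto
    then show ?thesis by (simp add: r_def)
  qed
  have r1: "r x = 1" if "v \<le> x" for x using that uv by (auto simp: r_def min_def le_divide_eq)
  have rb: "0 \<le> r x" "r x \<le> 1" for x by (auto simp: r_def)
  have "(\<lambda>d. \<Sum>j=1..d. E (Q d j) (\<lambda>x. r (x - trm1 (Q d j) 1))) \<longlonglongrightarrow> 0 * \<sigma>2 + (LINT x|\<nu>. r x)"
  proof (rule sum_expectation_tendsto[OF B lim])
    show "isCont r x" for x unfolding r_def using uv by (intro continuous_intros) auto
    show "\<bar>r x\<bar> \<le> (1 + 1/u\<^sup>2) * min 1 (x\<^sup>2)" for x
    proof (cases "x \<le> u")
      case False
      then have "u\<^sup>2 \<le> x\<^sup>2" using uv by (intro power_mono) auto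
      then have "1 \<le> (1/u\<^sup>2) * x\<^sup>2" using uv by (simp add: field_simps)
      then have "1 \<le> (1 + 1/u\<^sup>2) * x\<^sup>2" unfolding distrib_right using zero_le_power2[of x] by linarith
      moreover have "1 \<le> 1 + 1/u\<^sup>2" by simp
      ultimately have "1 \<le> (1 + 1/u\<^sup>2) * min 1 (x\<^sup>2)" by (simp add: min_def)
      then show ?thesis using rb[of x] by simp
    qed (simp add: r0 min_def)
    have "\<forall>\<^sub>F x in at 0. r x / x\<^sup>2 = 0"
      unfolding eventually_at using uv by (intro exI[of _ u]) (auto simp: dist_real_def r0)
    then show "((\<lambda>x. r x / x\<^sup>2) \<longlongrightarrow> 0) (at 0)" by (rule tendsto_eventually)
  qed
  then show "(\<lambda>d. \<Sum>j=1..d. E (Q d j) (\<lambda>x. r (x - trm1 (Q d j) 1))) \<longlonglongrightarrow> (LINT x|\<nu>. r x)" by simp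
  have ii: "integrable \<nu> (indicator {y<..} :: real \<Rightarrow> real)" if "y > 0" for y
    using emeasure_nu_tail[OF that] by (intro integrable_real_indicator) auto
  have rm: "r \<in> borel_measurable borel" unfolding r_def by measurable
  have ri: "integrable \<nu> r"
    by (rule Bochner_Integration.integrable_bound[OF ii[OF uv(1)]])
      (use rb r0 rm in \<open>auto simp: measurable_cong_sets[OF sets_nu refl] split: split_indicator\<close>)
  have "measure \<nu> {v<..} = (LINT x|\<nu>. indicator {v<..} x)" by simp
  also have "\<dots> \<le> (LINT x|\<nu>. r x)"
    using uv by (intro integral_mono ii ri) (auto simp: rb r1 split: split_indicator)
  finally show "- L v \<le> (LINT x|\<nu>. r x)" using measure_nu_tail[of v] uv by simp
  have "(LINT x|\<nu>. r x) \<le> (LINT x|\<nu>. indicator {u<..} x)"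
    using uv by (intro integral_mono ii ri) (auto simp: rb r0 split: split_indicator)
  then show "(LINT x|\<nu>. r x) \<le> - L u" using measure_nu_tail[of u] uv by simp
qed

lemma integrable_pmf_unit:
  fixes f :: "real \<Rightarrow> real"
  assumes "\<And>x. 0 \<le> f x" "\<And>x. f x \<le> b"
  shows "integrable (measure_pmf p) (\<lambda>x. f (g x))"
  by (rule integrable_measure_pmf_bounded[of _ _ b]) (use assms in auto)

text \<open>Test functions act on centered values, and the centering constants eventually lie in
  \<open>[0, h]\<close>. After this shift a ramp that reaches 1 at \<open>y - h\<close> dominates
  the indicator of \<open>{y<..}\<close>, while one that starts at \<open>y\<close> stays below it;
  continuity of \<open>L\<close> at \<open>y\<close> closes the gap.\<close>

lemma Ft_tendsto_isCont:
  assumes B: "\<forall>\<^sub>F d in sequentially. Ks d \<le> B" and lim: "\<And>t. (\<lambda>d. Ex d t) \<longlonglongrightarrow> psi t"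
    and y: "y > 0" and cont: "isCont L y"
  shows "(\<lambda>d. Ft d y) \<longlonglongrightarrow> - L y"
proof (rule tendstoI)
  fix e :: real assume e: "e > 0"
  obtain s where s: "s > 0" "\<And>x. \<bar>x - y\<bar> < s \<Longrightarrow> \<bar>L x - L y\<bar> < e/2"
    using cont e unfolding isCont_def LIM_eq by (metis abs_zero cancel_comm_monoid_add_class.diff_cancel half_gt_zero_iff real_norm_def)
  define h where "h = min (s/4) (y/4)"
  have h: "h > 0" "2 * h < s" "2 * h < y" using s y by (auto simp: h_def)
  obtain I where I: "(\<lambda>d. \<Sum>j=1..d. E (Q d j) (\<lambda>x. min 1 (max 0 ((x - trm1 (Q d j) 1 - (y - 2*h)) / ((y - h) - (y - 2*h)))))) \<longlonglongrightarrow> I"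
    "- L (y - h) \<le> I" "I \<le> - L (y - 2 * h)"
    by (rule ramp_sum_tendsto[OF B lim, of "y - 2*h" "y - h"]) (use h in auto)
  obtain I' where I': "(\<lambda>d. \<Sum>j=1..d. E (Q d j) (\<lambda>x. min 1 (max 0 ((x - trm1 (Q d j) 1 - y) / ((y + h) - y))))) \<longlonglongrightarrow> I'"
    "- L (y + h) \<le> I'" "I' \<le> - L y"
    by (rule ramp_sum_tendsto[OF B lim, of y "y + h"]) (use h y in auto)
  have Lb: "- L (y - 2 * h) < - L y + e/2" "- L (y + h) > - L y - e/2"
  proof -
    have "\<bar>L (y - 2 * h) - L y\<bar> < e/2" "\<bar>L (y + h) - L y\<bar> < e/2" by (rule s(2), use h in simp)+
    then show "- L (y - 2 * h) < - L y + e/2" "- L (y + h) > - L y - e/2" by linarith+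
  qed
  have "\<forall>\<^sub>F d in sequentially. (\<Sum>j=1..d. E (Q d j) (\<lambda>x. min 1 (max 0 ((x - trm1 (Q d j) 1 - (y - 2*h)) / ((y - h) - (y - 2*h)))))) < - L y + e"
    by (rule order_tendstoD(2)[OF I(1)]) (use I Lb e in linarith)
  moreover have "\<forall>\<^sub>F d in sequentially. (\<Sum>j=1..d. E (Q d j) (\<lambda>x. min 1 (max 0 ((x - trm1 (Q d j) 1 - y) / ((y + h) - y))))) > - L y - e"
    by (rule order_tendstoD(1)[OF I'(1)]) (use I' Lb e in linarith)
  ultimately show "\<forall>\<^sub>F d in sequentially. dist (Ft d y) (- L y) < e"
    using center_null[OF h(1)]
  proof eventually_elim
    case (elim d)
    have up: "Ft d y \<le> (\<Sum>j=1..d. E (Q d j) (\<lambda>x. min 1 (max 0 ((x - trm1 (Q d j) 1 - (y - 2*h)) / ((y - h) - (y - 2*h))))))"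
      unfolding Ft_def tailp_eq
    proof (rule sum_mono, rule expectation_mono[OF Q.integrable_trunc(4)])
      fix j x assume j: "j \<in> {1..d}"
      then have c: "trm1 (Q d j) 1 \<le> h" using elim by blast
      have "1 \<le> (x - trm1 (Q d j) 1 - (y - 2*h)) / ((y - h) - (y - 2*h))" if "x > y"
        using that c h by (simp add: le_divide_eq)
      then show "indicator {y<..} x \<le> min 1 (max 0 ((x - trm1 (Q d j) 1 - (y - 2*h)) / ((y - h) - (y - 2*h))))"
        by (auto split: split_indicator)
    next
      show "integrable (measure_pmf (Q d j)) (\<lambda>x. min 1 (max 0 ((x - trm1 (Q d j) 1 - (y - 2*h)) / ((y - h) - (y - 2*h)))))" for j
        by (rule integrable_measure_pmf_bounded[of _ _ 1]) auto
    qed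
    have lo: "Ft d y \<ge> (\<Sum>j=1..d. E (Q d j) (\<lambda>x. min 1 (max 0 ((x - trm1 (Q d j) 1 - y) / ((y + h) - y)))))"
      unfolding Ft_def tailp_eq
    proof (rule sum_mono, rule expectation_mono[OF _ Q.integrable_trunc(4)])
      fix j x
      have c: "0 \<le> trm1 (Q d j) 1" by (rule Q.trm1_bounds)
      have "(x - trm1 (Q d j) 1 - y) / ((y + h) - y) \<le> 0" if "\<not> x > y"
        using that c h by (intro divide_nonpos_pos) auto
      then show "min 1 (max 0 ((x - trm1 (Q d j) 1 - y) / ((y + h) - y))) \<le> indicator {y<..} x"
        by (auto split: split_indicator simp: max_def)
    next
      show "integrable (measure_pmf (Q d j)) (\<lambda>x. min 1 (max 0 ((x - trm1 (Q d j) 1 - y) / ((y + h) - y))))" for j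
        by (rule integrable_measure_pmf_bounded[of _ _ 1]) auto
    qed
    show ?case using up lo elim unfolding dist_real_def by linarith
  qed
qed

text \<open>The function \<open>F \<tau>\<close> is \<open>x^2\<close> with a linear cutoff between
  \<open>\<tau>\<close> and \<open>2 * \<tau>\<close>, so its sums tend to \<open>\<sigma>2\<close>
  plus an integral that is small with \<open>\<tau>\<close>. The centered second moments truncated
  at \<open>\<tau>\<close> are squeezed between the sums of \<open>F (\<tau>/4)\<close> and
  \<open>F \<tau>\<close>.\<close>

lemma Sv_limit:
  assumes B: "\<forall>\<^sub>F d in sequentially. Ks d \<le> B" and lim: "\<And>t. (\<lambda>d. Ex d t) \<longlonglongrightarrow> psi t"
    and hA: "\<And>x. x > 0 \<Longrightarrow> (\<lambda>d. Ft d x) \<longlonglongrightarrow> - L x" and "e > 0"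
  shows "\<exists>\<tau>0>0. \<forall>\<tau>. 0 < \<tau> \<and> \<tau> < \<tau>0 \<longrightarrow> (\<forall>\<^sub>F d in sequentially. \<bar>Sv d \<tau> - \<sigma>2\<bar> \<le> e)"
proof -
  define F where "F \<tau> x = x\<^sup>2 * min 1 (max 0 (2 - \<bar>x\<bar> / \<tau>))" for \<tau> x :: real
  have F0: "0 \<le> F \<tau> x" "F \<tau> x \<le> x\<^sup>2" for \<tau> x
    unfolding F_def by (auto intro!: mult_nonneg_nonneg mult_left_le)
  have Fz: "F \<tau> x = 0" if "0 < \<tau>" "2 * \<tau> \<le> \<bar>x\<bar>" for \<tau> x
    using that by (simp add: F_def max_def field_simps)
  have Fo: "F \<tau> x = x\<^sup>2" if "0 < \<tau>" "\<bar>x\<bar> \<le> \<tau>" for \<tau> x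
  proof -
    have "\<bar>x\<bar> / \<tau> \<le> 1" using that by simp
    then show ?thesis by (simp add: F_def)
  qed
  have Fb: "\<bar>F \<tau> x\<bar> \<le> (1 + 4 * \<tau>\<^sup>2) * min 1 (x\<^sup>2)" if \<tau>: "0 < \<tau>" for \<tau> x
  proof (cases "2 * \<tau> \<le> \<bar>x\<bar>")
    case False
    then have "\<bar>x\<bar> \<le> \<bar>2 * \<tau>\<bar>" using \<tau> by simp
    then have "x\<^sup>2 \<le> (2 * \<tau>)\<^sup>2" by (simp only: abs_le_square_iff)
    then have a: "x\<^sup>2 \<le> 1 + 4 * \<tau>\<^sup>2" by (simp add: power_mult_distrib)
    have b: "x\<^sup>2 \<le> (1 + 4 * \<tau>\<^sup>2) * x\<^sup>2" by (simp add: distrib_right)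
    show ?thesis using F0[where \<tau>=\<tau> and x=x] a b by (auto simp: min_def intro: order_trans)
  qed (use Fz[OF \<tau>] in \<open>simp add: min_def\<close>)
  have Ftend: "(\<lambda>d. \<Sum>j=1..d. E (Q d j) (\<lambda>x. F \<tau> (x - trm1 (Q d j) 1))) \<longlonglongrightarrow> 1 * \<sigma>2 + (LINT x|\<nu>. F \<tau> x)" if \<tau>: "0 < \<tau>" for \<tau>
  proof (rule sum_expectation_tendsto[OF B lim _ Fb[OF \<tau>]])
    show "isCont (F \<tau>) x" for x unfolding F_def using \<tau> by (intro continuous_intros) auto
    have "\<forall>\<^sub>F x in at 0. F \<tau> x / x\<^sup>2 = 1"
      unfolding eventually_at using \<tau> by (intro exI[of _ \<tau>]) (auto simp: dist_real_def Fo)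
    then show "((\<lambda>x. F \<tau> x / x\<^sup>2) \<longlongrightarrow> 1) (at 0)" by (rule tendsto_eventually)
  qed
  have Fm: "F \<tau> \<in> borel_measurable borel" for \<tau> unfolding F_def by measurable
  have FI: "integrable \<nu> (F \<tau>)" if \<tau>: "0 < \<tau>" for \<tau>
    by (rule integrable_nu_bound[OF Fm, of _ "1 + 4 * \<tau>\<^sup>2"]) (use Fb[OF \<tau>] in auto)
  have q: "integrable \<nu> (\<lambda>x. indicator {0<..\<tau>} x * x\<^sup>2)" for \<tau>
  proof (rule integrable_nu_bound[where C="1 + \<tau>\<^sup>2"])
    fix x :: real assume x: "x > 0"
    show "norm (indicator {0<..\<tau>} x * x\<^sup>2) \<le> (1 + \<tau>\<^sup>2) * min 1 (x\<^sup>2)"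
    proof (cases "x \<le> \<tau>")
      case True
      then have "x\<^sup>2 \<le> \<tau>\<^sup>2" using x by (intro power_mono) auto
      then have a: "x\<^sup>2 \<le> 1 + \<tau>\<^sup>2" by simp
      have b: "x\<^sup>2 \<le> (1 + \<tau>\<^sup>2) * x\<^sup>2" by (simp add: distrib_right)
      show ?thesis using True x a b by (simp add: min_def)
    qed (simp add: min_def indicator_def)
  qed measurable
  have FU: "(LINT x|\<nu>. F \<tau> x) \<le> (LINT x|\<nu>. indicator {0<..2*\<tau>} x * x\<^sup>2)" if \<tau>: "0 < \<tau>" for \<tau>
  proof (rule integral_mono_AE[OF FI[OF \<tau>] q])
    show "AE x in \<nu>. F \<tau> x \<le> indicator {0<..2*\<tau>} x * x\<^sup>2"
      using AE_nu_pos by eventually_elim (use F0 Fz[OF \<tau>] in \<open>auto split: split_indicator\<close>)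
  qed
  have FL: "0 \<le> (LINT x|\<nu>. F \<tau> x)" for \<tau> by (intro integral_nonneg_AE AE_I2 F0)
  have "\<forall>\<^sub>F \<tau> in at_right 0. (LINT x|\<nu>. indicator {0<..\<tau>} x * x\<^sup>2) < e/4"
    by (rule order_tendstoD(2)[OF small_jumps_tendsto]) (use \<open>e > 0\<close> in simp)
  then obtain s where s: "s > 0" "\<And>\<tau>. 0 < \<tau> \<Longrightarrow> \<tau> < s \<Longrightarrow> (LINT x|\<nu>. indicator {0<..\<tau>} x * x\<^sup>2) < e/4"
    unfolding eventually_at_right_field by blast
  define \<tau>0 where "\<tau>0 = min 1 (s/2)"
  have "\<forall>\<^sub>F d in sequentially. \<bar>Sv d \<tau> - \<sigma>2\<bar> \<le> e" if \<tau>: "0 < \<tau>" "\<tau> < \<tau>0" for \<tau>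
  proof -
    have \<tau>1: "\<tau> \<le> 1" "2 * \<tau> < s" using \<tau> by (auto simp: \<tau>0_def)
    define Bt where "Bt = - L \<tau> + 1"
    have Bt: "Bt \<ge> 1" using L_nonpos[OF \<tau>(1)] by (simp add: Bt_def)
    \<comment> \<open>Centering by at most \<open>\<tau>/2\<close> keeps values above
      \<open>\<tau>\<close> above \<open>\<tau>/2\<close>, where \<open>F (\<tau>/4)\<close>
      vanishes; the other entry keeps products with tail sums below \<open>e/4\<close>.\<close>
    define \<eta> where "\<eta> = min (\<tau>/2) (e / (4 * Bt))"
    have \<eta>: "0 < \<eta>" "\<eta> \<le> \<tau>/2" "\<eta> * Bt \<le> e/4"
    proof -
      show "0 < \<eta>" "\<eta> \<le> \<tau>/2" using \<tau> Bt \<open>e > 0\<close> by (auto simp: \<eta>_def)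
      have "\<eta> * Bt \<le> e / (4 * Bt) * Bt" using Bt by (intro mult_right_mono) (auto simp: \<eta>_def)
      then show "\<eta> * Bt \<le> e/4" using Bt by simp
    qed
    have ev1: "\<forall>\<^sub>F d in sequentially. (\<Sum>j=1..d. E (Q d j) (\<lambda>x. F \<tau> (x - trm1 (Q d j) 1))) < \<sigma>2 + e/2"
      by (rule order_tendstoD(2)[OF Ftend[OF \<tau>(1)]]) (use FU[OF \<tau>(1)] s(2)[of "2 * \<tau>"] \<tau>(1) \<tau>1 \<open>e > 0\<close> in linarith)
    have t4: "0 < \<tau>/4" using \<tau> by simp
    have ev2: "\<forall>\<^sub>F d in sequentially. (\<Sum>j=1..d. E (Q d j) (\<lambda>x. F (\<tau>/4) (x - trm1 (Q d j) 1))) > \<sigma>2 - e/2"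
      by (rule order_tendstoD(1)[OF Ftend[OF t4]]) (use FL[of "\<tau>/4"] \<open>e > 0\<close> in linarith)
    have ev3: "\<forall>\<^sub>F d in sequentially. Ft d \<tau> < Bt"
      by (rule order_tendstoD(2)[OF hA[OF \<tau>(1)]]) (simp add: Bt_def)
    show ?thesis
      using ev1 ev2 ev3 center_null[OF \<eta>(1)] null[OF \<tau>(1) \<eta>(1)]
    proof eventually_elim
      case (elim d)
      define c where "c j = trm1 (Q d j) 1" for j
      define W where "W = (\<Sum>j=1..d. E (Q d j) (\<lambda>x. indicator {..\<tau>} x * (x - c j)\<^sup>2))"
      have c0: "0 \<le> c j" for j using Q.trm1_bounds(1)[of d j 1] by (simp add: c_def)
      have c1: "c j \<le> \<eta>" if "j \<in> {1..d}" for j using elim(4) that by (simp add: c_def)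
      have FIp: "integrable (measure_pmf (Q d j)) (\<lambda>x. F u (x - c j))" if "0 < u" for u j
      proof (rule integrable_pmf_unit[OF F0(1), where b="1 + 4 * u\<^sup>2"])
        show "F u x \<le> 1 + 4 * u\<^sup>2" for x
        proof -
          have "(1 + 4 * u\<^sup>2) * min 1 (x\<^sup>2) \<le> (1 + 4 * u\<^sup>2) * 1" by (intro mult_left_mono) auto
          then show ?thesis using order_trans[OF abs_ge_self Fb[OF that, of x]] by simp
        qed
      qed
      have WU: "W \<le> (\<Sum>j=1..d. E (Q d j) (\<lambda>x. F \<tau> (x - c j)))"
        unfolding W_def
      proof (rule sum_mono, rule expectation_mono[OF Q.centered_second(1) FIp[OF \<tau>(1)]])
        fix j x assume j: "j \<in> {1..d}" and x: "x \<in> set_pmf (Q d j)"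
        have "F \<tau> (x - c j) = (x - c j)\<^sup>2" if "x \<le> \<tau>"
          using that Q_nonneg[OF x] c0[of j] c1[OF j] \<eta> by (intro Fo[OF \<tau>(1)]) (auto simp: abs_le_iff)
        then show "indicator {..\<tau>} x * (x - c j)\<^sup>2 \<le> F \<tau> (x - c j)"
          using F0(1)[of \<tau>] by (auto split: split_indicator)
      qed
      have WL: "(\<Sum>j=1..d. E (Q d j) (\<lambda>x. F (\<tau>/4) (x - c j))) \<le> W"
        unfolding W_def
      proof (rule sum_mono, rule expectation_mono[OF FIp[OF t4] Q.centered_second(1)])
        fix j x assume j: "j \<in> {1..d}"
        have "F (\<tau>/4) (x - c j) = 0" if "\<not> x \<le> \<tau>"
          using that c0[of j] c1[OF j] \<eta> by (intro Fz[OF t4]) auto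
        then show "F (\<tau>/4) (x - c j) \<le> indicator {..\<tau>} x * (x - c j)\<^sup>2"
          using F0(2)[of "\<tau>/4" "x - c j"] by (auto split: split_indicator)
      qed
      have WS: "W = Sv d \<tau> + (\<Sum>j=1..d. (trm1 (Q d j) \<tau> - c j)\<^sup>2) - (\<Sum>j=1..d. (c j)\<^sup>2 * tailp (Q d j) \<tau>)"
        unfolding W_def Q.centered_second(2) sum_subtractf sum.distrib Sv_def ..
      have s3: "(\<Sum>j=1..d. (c j)\<^sup>2 * tailp (Q d j) \<tau>) \<le> \<eta> * Bt"
      proof (rule weighted_tail_small)
        fix j assume j: "j \<in> {1..d}"
        have "(c j)\<^sup>2 = c j * c j" by (rule power2_eq_square)
        also have "\<dots> \<le> c j * 1" using c1[OF j] c0[of j] \<eta> \<tau>1 by (intro mult_left_mono) auto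
        finally show "(c j)\<^sup>2 \<le> \<eta>" using c1[OF j] by simp
      qed (use \<eta> elim in auto)
      have s4: "(\<Sum>j=1..d. (trm1 (Q d j) \<tau> - c j)\<^sup>2) \<le> \<eta> * Bt"
      proof -
        have "(\<Sum>j=1..d. (trm1 (Q d j) \<tau> - c j)\<^sup>2) \<le> (\<Sum>j=1..d. tailp (Q d j) \<tau> * tailp (Q d j) \<tau>)"
        proof (rule sum_mono)
          fix j
          have "\<bar>trm1 (Q d j) \<tau> - c j\<bar> \<le> \<bar>tailp (Q d j) \<tau>\<bar>"
            using Q.trm1_diff(1,2)[OF \<tau>1(1), of d j] tailp_nonneg[of "Q d j" \<tau>] unfolding c_def by linarith
          then show "(trm1 (Q d j) \<tau> - c j)\<^sup>2 \<le> tailp (Q d j) \<tau> * tailp (Q d j) \<tau>"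
            unfolding abs_le_square_iff power2_eq_square .
        qed
        also have "\<dots> \<le> \<eta> * Bt"
          using elim \<eta> by (intro weighted_tail_small) (auto simp: tailp_nonneg)
        finally show ?thesis .
      qed
      have p: "0 \<le> (\<Sum>j=1..d. (trm1 (Q d j) \<tau> - c j)\<^sup>2)" "0 \<le> (\<Sum>j=1..d. (c j)\<^sup>2 * tailp (Q d j) \<tau>)"
        by (auto intro!: sum_nonneg mult_nonneg_nonneg tailp_nonneg)
      have "W < \<sigma>2 + e/2" "W > \<sigma>2 - e/2" using WU WL elim(1,2) unfolding c_def by linarith+
      then show ?case using WS s3 s4 p \<eta>(3) \<open>e > 0\<close> by linarith
    qed
  qed
  moreover have "\<tau>0 > 0" using s by (simp add: \<tau>0_def)
  ultimately show ?thesis by blast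
qed

end

section \<open>Absence of jumps in the limit\<close>

lemma mono_not_isCont_jump:
  fixes L :: "real \<Rightarrow> real"
  assumes mono: "mono_on {0<..} L" and x: "x > 0" and nc: "\<not> isCont L x"
  obtains \<kappa> where "\<kappa> > 0" "\<And>u v. 0 < u \<Longrightarrow> u < x \<Longrightarrow> x < v \<Longrightarrow> \<kappa> \<le> L v - L u"
proof -
  have "\<exists>\<kappa>>0. \<forall>u v. 0 < u \<and> u < x \<and> x < v \<longrightarrow> \<kappa> \<le> L v - L u"
  proof (rule ccontr)
    assume neg: "\<not> ?thesis"
    have "isCont L x"
      unfolding isCont_def
    proof (rule tendstoI)
      fix e :: real assume "e > 0"
      then obtain u v where uv: "0 < u" "u < x" "x < v" "L v - L u < e" using neg by (auto simp: not_le)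
      have "\<forall>\<^sub>F y in nhds x. y \<in> {u<..<v}" using uv by (intro eventually_nhds_in_open) auto
      then have "\<forall>\<^sub>F y in at x. y \<in> {u<..<v}" by (simp add: eventually_at_filter eventually_mono)
      then show "\<forall>\<^sub>F y in at x. dist (L y) (L x) < e"
      proof eventually_elim
        case (elim y)
        have "L u \<le> L y" "L y \<le> L v" "L u \<le> L x" "L x \<le> L v"
          using elim uv mono by (auto simp: mono_on_def)
        then show ?case using uv(4) unfolding dist_real_def by linarith
      qed
    qed
    then show False using nc by simp
  qed
  then show ?thesis using that by blast
qed

text \<open>A limit tail function of normalised sums of a single sequence cannot jump: consecutive norming
  constants are asymptotically equal, so every smaller scale is met along the sequence, and a jump
  at \<open>x0\<close> would be inherited by all points of \<open>(0, x0)\<close>.\<close>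

lemma limit_tail_isCont:
  fixes L :: "real \<Rightarrow> real" and N :: "nat \<Rightarrow> real \<Rightarrow> real" and b :: "nat \<Rightarrow> real"
  assumes L_mono: "mono_on {0<..} L" and L_lim: "(L \<longlongrightarrow> 0) at_top"
    and b_pos: "\<And>d. b d > 0" and b_lim: "filterlim b at_top sequentially"
    and anti: "\<And>d s t. s \<le> t \<Longrightarrow> N d t \<le> N d s"
    and incr: "\<And>d d' s t. d \<le> d' \<Longrightarrow> s \<le> t \<Longrightarrow> N d s - N d t \<le> N d' s - N d' t"
    and conv: "\<And>x. x > 0 \<Longrightarrow> isCont L x \<Longrightarrow> (\<lambda>d. N d (x * b d)) \<longlonglongrightarrow> - L x"
    and step: "\<And>x. x > 0 \<Longrightarrow> (\<lambda>d. N (Suc d) (x * b (Suc d)) - N d (x * b (Suc d))) \<longlonglongrightarrow> 0"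
    and x0: "x0 > 0"
  shows "isCont L x0"
proof (rule ccontr)
  assume nc: "\<not> isCont L x0"
  obtain \<kappa> where \<kappa>: "\<kappa> > 0" "\<And>u v. 0 < u \<Longrightarrow> u < x0 \<Longrightarrow> x0 < v \<Longrightarrow> \<kappa> \<le> L v - L u"
    using mono_not_isCont_jump[OF L_mono x0 nc] by blast
  define D where "D = {x\<in>{0<..}. \<not> isCont L x}"
  have D: "countable D" unfolding D_def by (rule mono_on_ctble_discont_open[OF _ L_mono]) simp
  have Lle: "L x \<le> L y" if "0 < x" "x \<le> y" for x y using L_mono that by (auto simp: mono_on_def)
  have Lneg: "L x \<le> 0" if "x > 0" for x
  proof (rule tendsto_lowerbound[OF L_lim])
    show "\<forall>\<^sub>F y in at_top. L x \<le> L y"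
      using eventually_ge_at_top[of x] by eventually_elim (use Lle that in auto)
  qed simp
  have pick: "\<exists>x. u < x \<and> x < v \<and> isCont L x" if "0 \<le> u" "u < v" for u v
  proof -
    have "\<exists>x\<in>{u<..<v}. x \<notin> D" by (rule open_minus_countable[OF D]) (use that in auto)
    then show ?thesis using that by (auto simp: D_def)
  qed
  \<comment> \<open>If the ratio were at least \<open>1 + \<eta>\<close> infinitely often, comparing
    the scales \<open>b d\<close> and \<open>b (Suc d)\<close> would give
    \<open>L ((1 + \<eta>) * y) <= L y\<close> at continuity points. Then \<open>L\<close> is
    constant along a geometric sequence running to infinity, hence 0 at a point left of the jump,
    which monotonicity forbids.\<close>
  have ratio: "\<forall>\<^sub>F d in sequentially. b (Suc d) < (1 + \<eta>) * b d" if \<eta>: "\<eta> > 0" for \<eta>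
  proof (rule ccontr)
    assume "\<not> ?thesis"
    then have freq: "\<exists>\<^sub>F d in sequentially. (1 + \<eta>) * b d \<le> b (Suc d)"
      by (simp add: not_eventually not_less)
    \<comment> \<open>Avoiding countably many starting points makes all points
      \<open>(1 + \<eta>) ^ n * x\<close> continuity points at once.\<close>
    define DD where "DD = (\<Union>n. (\<lambda>y. y / (1 + \<eta>) ^ n) ` D)"
    have "countable DD" unfolding DD_def using D by auto
    then have "\<exists>x\<in>{0<..<x0}. x \<notin> DD" by (rule open_minus_countable) (use x0 in auto)
    then obtain x where x: "0 < x" "x < x0" "x \<notin> DD" by auto
    define y where "y n = (1 + \<eta>) ^ n * x" for n
    have ypos: "y n > 0" for n using x \<eta> by (simp add: y_def)
    have yc: "isCont L (y n)" for n
    proof (rule ccontr)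
      assume "\<not> isCont L (y n)"
      then have "y n \<in> D" using ypos by (simp add: D_def)
      then have "y n / (1 + \<eta>) ^ n \<in> DD" unfolding DD_def by blast
      moreover have "y n / (1 + \<eta>) ^ n = x" using \<eta> by (simp add: y_def)
      ultimately show False using x by simp
    qed
    have eq: "L (y n) = L (y (Suc n))" for n
    proof (rule antisym)
      show "L (y n) \<le> L (y (Suc n))"
      proof (rule Lle[OF ypos])
        have "y (Suc n) = y n + \<eta> * y n" by (simp add: y_def algebra_simps)
        then show "y n \<le> y (Suc n)" using ypos[of n] \<eta> by simp
      qed
      \<comment> \<open>\<open>N (Suc d)\<close> may be replaced by \<open>N d\<close> here, because
        \<open>step\<close> makes the last summand negligible.\<close>
      have l1: "(\<lambda>d. N d (y n * b (Suc d))) \<longlonglongrightarrow> - L (y n)"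
        using tendsto_diff[OF LIMSEQ_Suc[OF conv[OF ypos[of n] yc[of n]]] step[OF ypos[of n]]] by simp
      have l2: "(\<lambda>d. N d (y (Suc n) * b d)) \<longlonglongrightarrow> - L (y (Suc n))" by (rule conv[OF ypos yc])
      show "L (y (Suc n)) \<le> L (y n)"
      proof (rule ccontr)
        assume "\<not> ?thesis"
        then have "- L (y (Suc n)) < - L (y n)" by simp
        then obtain m where m: "- L (y (Suc n)) < m" "m < - L (y n)" using dense by blast
        have "\<forall>\<^sub>F d in sequentially. N d (y (Suc n) * b d) < N d (y n * b (Suc d))"
          using order_tendstoD(1)[OF l1 m(2)] order_tendstoD(2)[OF l2 m(1)] by eventually_elim simp
        then have "\<exists>\<^sub>F d in sequentially. (1 + \<eta>) * b d \<le> b (Suc d) \<and> N d (y (Suc n) * b d) < N d (y n * b (Suc d))"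
          using freq by (intro frequently_rev_mp[OF freq]) (auto elim: eventually_mono)
        then obtain d where d: "(1 + \<eta>) * b d \<le> b (Suc d)" "N d (y (Suc n) * b d) < N d (y n * b (Suc d))"
          using frequently_ex by blast
        have "y (Suc n) * b d = y n * ((1 + \<eta>) * b d)" by (simp add: y_def)
        also have "\<dots> \<le> y n * b (Suc d)" using d(1) ypos[of n] by (intro mult_left_mono) auto
        finally show False using anti[of "y (Suc n) * b d" "y n * b (Suc d)" d] d(2) by simp
      qed
    qed
    have const: "L (y n) = L x" for n
    proof (induction n)
      case 0 show ?case by (simp add: y_def)
    next
      case (Suc n) then show ?case using eq[of n] by simp
    qed
    have "filterlim (\<lambda>n. real n * (\<eta> * x)) at_top sequentially"
      using x \<eta> by (intro filterlim_at_top_mult_tendsto_pos[OF tendsto_const _ filterlim_real_sequentially]) auto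
    then have "filterlim y at_top sequentially"
    proof (rule filterlim_at_top_mono, intro always_eventually allI)
      fix n
      have "(1 + real n * \<eta>) * x \<le> (1 + \<eta>) ^ n * x"
        using x \<eta> by (intro mult_right_mono Bernoulli_inequality) auto
      moreover have "(1 + real n * \<eta>) * x = x + real n * (\<eta> * x)" by (simp add: algebra_simps)
      ultimately show "real n * (\<eta> * x) \<le> y n" using x unfolding y_def by linarith
    qed
    from filterlim_compose[OF L_lim this] have "L x = 0" unfolding const LIMSEQ_const_iff .
    then show False using \<kappa>(2)[of x "x0 + 1"] x \<kappa>(1) Lneg[of "x0 + 1"] x0 by simp
  qed
  \<comment> \<open>Suppose \<open>L\<close> is continuous at \<open>y\<close>. At a late index
    \<open>d0\<close> the window around \<open>x0 * b d0\<close> carries more than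
    \<open>\<kappa>/2\<close>. At a later \<open>d\<close> with \<open>r * b d\<close> close to
    \<open>b d0\<close> it carries at least as much, by \<open>incr\<close>; but on the scale of
    \<open>b d\<close> it lies near \<open>y\<close>, where \<open>L\<close> varies by less than
    \<open>\<kappa>/2\<close>.\<close>
  have "y \<in> D" if y: "0 < y" "y < x0" for y
  proof (rule ccontr)
    assume "y \<notin> D"
    then have cy: "isCont L y" using y by (simp add: D_def)
    define r where "r = y / x0"
    have r: "0 < r" "r < 1" using y x0 by (auto simp: r_def)
    have rx: "r * x0 = y" using x0 by (simp add: r_def)
    obtain s where s: "s > 0" "\<And>x. \<bar>x - y\<bar> < s \<Longrightarrow> \<bar>L x - L y\<bar> < \<kappa>/8"
      using cy \<kappa>(1) unfolding isCont_def LIM_eq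
      by (metis abs_zero cancel_comm_monoid_add_class.diff_cancel real_norm_def zero_less_divide_iff zero_less_numeral)
    define u where "u = y - min (s/2) (y/2)"
    define v where "v = y + s/2"
    have uv: "0 < u" "u < y" "y < v" "\<bar>u - y\<bar> < s" "\<bar>v - y\<bar> < s" using s y by (auto simp: u_def v_def)
    have Luv: "L v - L u < \<kappa>/2" using s(2)[OF uv(4)] s(2)[OF uv(5)] \<kappa>(1) by linarith
    have "u / r < x0" using uv r rx by (simp add: divide_less_eq mult.commute)
    then obtain a1 where a1: "u / r < a1" "a1 < x0" "isCont L a1"
      using pick[of "u/r" x0] uv r by auto
    have "x0 < v / r" using uv r rx by (simp add: less_divide_eq mult.commute)
    then obtain a2 where a2: "x0 < a2" "a2 < v / r" "isCont L a2"
      using pick[of x0 "v/r"] x0 by auto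
    have ua: "u < a1 * r" using a1(1) r by (simp add: divide_less_eq)
    have va: "a2 * r < v" using a2(2) r by (simp add: less_divide_eq)
    \<comment> \<open>Room for the overshoot of the norming constants: even after division by
      \<open>1 + \<eta>\<close> the left end \<open>a1 * r\<close> stays above
      \<open>u\<close>.\<close>
    define \<eta> where "\<eta> = (a1 * r / u - 1) / 2"
    have \<eta>: "\<eta> > 0" using ua uv by (simp add: \<eta>_def less_divide_eq)
    have "u * (1 + \<eta>) < a1 * r"
    proof -
      have "u * (1 + \<eta>) = (u + a1 * r) / 2" using uv by (simp add: \<eta>_def field_simps)
      then show ?thesis using ua by simp
    qed
    then have "u < a1 * r / (1 + \<eta>)" using \<eta> by (simp add: less_divide_eq)
    then obtain p where p: "u < p" "p < a1 * r / (1 + \<eta>)" "isCont L p" using pick[of u] uv by auto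
    obtain q where q: "a2 * r < q" "q < v" "isCont L q" using pick[of "a2 * r" v] va a2 x0 r by auto
    have pos: "0 < a1" "0 < a2" "0 < p" "0 < q"
    proof -
      have "0 < u / r" using uv r by simp
      then show "0 < a1" using a1 by linarith
      show "0 < a2" "0 < p" using a2 x0 p uv by linarith+
      have "0 < a2 * r" using a2 x0 r by simp
      then show "0 < q" using q by linarith
    qed
    have "(\<lambda>d. N d (a1 * b d) - N d (a2 * b d)) \<longlonglongrightarrow> - L a1 - - L a2"
      by (intro tendsto_diff conv pos a1 a2)
    moreover have "- L a1 - - L a2 > \<kappa>/2" using \<kappa>(2)[of a1 a2] pos a1 a2 \<kappa>(1) by simp
    ultimately have e1: "\<forall>\<^sub>F d in sequentially. N d (a1 * b d) - N d (a2 * b d) > \<kappa>/2" by (rule order_tendstoD(1))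
    have "(\<lambda>d. N d (p * b d) - N d (q * b d)) \<longlonglongrightarrow> - L p - - L q"
      by (intro tendsto_diff conv pos p q)
    moreover have "- L p - - L q < \<kappa>/2" using Lle[of u p] Lle[of q v] uv p q pos Luv by simp
    ultimately have e2: "\<forall>\<^sub>F d in sequentially. N d (p * b d) - N d (q * b d) < \<kappa>/2" by (rule order_tendstoD(2))
    obtain d0 where d0: "\<And>d. d \<ge> d0 \<Longrightarrow> N d (a1 * b d) - N d (a2 * b d) > \<kappa>/2 \<and> N d (p * b d) - N d (q * b d) < \<kappa>/2 \<and> b (Suc d) < (1 + \<eta>) * b d"
      using eventually_conj[OF e1 eventually_conj[OF e2 ratio[OF \<eta>]]] unfolding eventually_sequentially by blast
    have "\<forall>\<^sub>F d in sequentially. b d0 / r \<le> b d" using b_lim unfolding filterlim_at_top by blast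
    then obtain n where n: "\<And>d. d \<ge> n \<Longrightarrow> b d0 / r \<le> b d" unfolding eventually_sequentially by blast
    \<comment> \<open>The first index at which the norming constant has grown by the factor
      \<open>1 / r\<close>; by \<open>ratio\<close> it overshoots by less than
      \<open>1 + \<eta>\<close>.\<close>
    define k where "k = (LEAST k. b d0 / r \<le> b (d0 + k))"
    have k1: "b d0 / r \<le> b (d0 + k)" unfolding k_def by (rule LeastI[of _ n]) (simp add: n)
    have b0: "b d0 < b d0 / r" using r b_pos[of d0] by (simp add: less_divide_eq)
    have "k \<noteq> 0" using k1 b0 by (intro notI) simp
    then obtain k' where k': "k = Suc k'" using not0_implies_Suc by blast
    have "\<not> b d0 / r \<le> b (d0 + k')" unfolding k' using not_less_Least[of k' "\<lambda>k. b d0 / r \<le> b (d0 + k)"] k' by (simp add: k_def)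
    then have k2: "b (d0 + k') < b d0 / r" by simp
    define d where "d = d0 + k"
    have "b d < (1 + \<eta>) * b (d0 + k')" using d0[of "d0 + k'"] by (simp add: d_def k')
    also have "\<dots> < (1 + \<eta>) * (b d0 / r)" using k2 \<eta> by (intro mult_strict_left_mono) auto
    finally have bd: "b d * r / (1 + \<eta>) \<le> b d0" using r \<eta> by (simp add: field_simps)
    have bd': "b d0 \<le> r * b d" using k1 r by (simp add: d_def divide_le_eq mult.commute)
    have "N d0 (a1 * b d0) - N d0 (a2 * b d0) \<le> N d (a1 * b d0) - N d (a2 * b d0)"
      using a1 a2 b_pos[of d0] by (intro incr mult_right_mono) (auto simp: d_def)
    moreover have "N d (a1 * b d0) \<le> N d (p * b d)"
    proof (rule anti)
      have "p * b d \<le> a1 * r / (1 + \<eta>) * b d" using p b_pos[of d] by (intro mult_right_mono) auto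
      also have "\<dots> = a1 * (b d * r / (1 + \<eta>))" by simp
      also have "\<dots> \<le> a1 * b d0" using bd pos by (intro mult_left_mono) auto
      finally show "p * b d \<le> a1 * b d0" .
    qed
    moreover have "N d (q * b d) \<le> N d (a2 * b d0)"
    proof (rule anti)
      have "a2 * b d0 \<le> a2 * (r * b d)" using bd' pos by (intro mult_left_mono) auto
      also have "\<dots> = (a2 * r) * b d" by simp
      also have "\<dots> \<le> q * b d" using q b_pos[of d] by (intro mult_right_mono) auto
      finally show "a2 * b d0 \<le> q * b d" .
    qed
    ultimately show False using d0[of d0] d0[of d] by (simp add: d_def)
  qed
  then have "{0<..<x0} \<subseteq> D" by auto
  then have "countable {0<..<x0}" using D countable_subset by blast
  then show False using uncountable_open_interval[of 0 x0] x0 by simp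
qed

section \<open>Laws of independent sums and the necessity of the three conditions\<close>

lemma pchar_sum_Pi_pmf:
  fixes g :: "'i \<Rightarrow> 'a \<Rightarrow> real"
  assumes fin: "finite I"
  shows "pchar (map_pmf (\<lambda>f. (\<Sum>j\<in>I. g j (f j)) + c) (Pi_pmf I dflt p)) t
    = (\<Prod>j\<in>I. pchar (map_pmf (g j) (p j)) t) * iexp (t * c)"
proof -
  let ?P = "measure_pmf (Pi_pmf I dflt p)"
  have "prob_space.indep_vars ?P (\<lambda>_. borel) (\<lambda>j f. g j (f j)) I"
    by (rule prob_space.indep_vars_compose2[OF prob_space_measure_pmf indep_vars_Pi_pmf[OF fin]]) simp
  then have "char (distr ?P borel (\<lambda>f. \<Sum>j\<in>I. g j (f j))) t = (\<Prod>j\<in>I. char (distr ?P borel (\<lambda>f. g j (f j))) t)"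
    by (rule prob_space.char_distr_sum[OF prob_space_measure_pmf])
  moreover have "char (distr ?P borel (\<lambda>f. \<Sum>j\<in>I. g j (f j))) t = E (Pi_pmf I dflt p) (\<lambda>f. iexp (t * (\<Sum>j\<in>I. g j (f j))))"
    unfolding char_def by (rule integral_distr) auto
  moreover have "char (distr ?P borel (\<lambda>f. g j (f j))) t = pchar (map_pmf (g j) (p j)) t" if "j \<in> I" for j
  proof -
    have "char (distr ?P borel (\<lambda>f. g j (f j))) t = E (Pi_pmf I dflt p) (\<lambda>f. iexp (t * g j (f j)))"
      unfolding char_def by (rule integral_distr) auto
    also have "\<dots> = E (map_pmf (\<lambda>f. f j) (Pi_pmf I dflt p)) (\<lambda>x. iexp (t * g j x))"
      by (simp add: integral_map_pmf)
    also have "map_pmf (\<lambda>f. f j) (Pi_pmf I dflt p) = p j" unfolding Pi_pmf_component[OF fin] using that by simp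
    finally show ?thesis by (simp add: pchar_def integral_map_pmf)
  qed
  ultimately have 1: "E (Pi_pmf I dflt p) (\<lambda>f. iexp (t * (\<Sum>j\<in>I. g j (f j)))) = (\<Prod>j\<in>I. pchar (map_pmf (g j) (p j)) t)"
    by simp
  have "iexp (t * (S + c)) = iexp (t * S) * iexp (t * c)" for S
    by (simp only: distrib_left of_real_add exp_add)
  then have "pchar (map_pmf (\<lambda>f. (\<Sum>j\<in>I. g j (f j)) + c) (Pi_pmf I dflt p)) t
    = E (Pi_pmf I dflt p) (\<lambda>f. iexp (t * (\<Sum>j\<in>I. g j (f j))) * iexp (t * c))"
    unfolding pchar_def integral_map_pmf by (simp only:)
  then show ?thesis unfolding integral_mult_left_zero 1 .
qed

abbreviation pmf_law :: "real pmf \<Rightarrow> real measure" where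
  "pmf_law p \<equiv> distr (measure_pmf p) borel (\<lambda>x. x)"

lemma real_distribution_pmf_law: "real_distribution (pmf_law p)"
  by (rule prob_space.real_distribution_distr[OF prob_space_measure_pmf]) simp

context null_array
begin

text \<open>Null arrays can have limits whose \<open>L\<close> jumps, Poisson limits for instance.
  Continuity of \<open>L\<close> is therefore delegated to the hypothesis \<open>cont\<close>, which
  may start from the tail convergence at continuity points that is already available.\<close>

lemma necessity:
  assumes M: "real_distribution M" and charM: "\<And>t. char M t = exp (psi t)"
    and conv: "\<And>t. (\<lambda>d. charS d t) \<longlonglongrightarrow> exp (psi t)"
    and cont: "(\<And>y. y > 0 \<Longrightarrow> isCont L y \<Longrightarrow> (\<lambda>d. Ft d y) \<longlonglongrightarrow> - L y) \<Longrightarrow> (\<And>y. y > 0 \<Longrightarrow> isCont L y)"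
  shows "(\<forall>x>0. (\<lambda>d. Ft d x) \<longlonglongrightarrow> - L x) \<and> (\<forall>\<tau>>0. (\<lambda>d. Sm d \<tau> - A d) \<longlonglongrightarrow> levy_shift \<tau>)
    \<and> (\<forall>e>0. \<exists>\<tau>0>0. \<forall>\<tau>. 0 < \<tau> \<and> \<tau> < \<tau>0 \<longrightarrow> (\<forall>\<^sub>F d in sequentially. \<bar>Sv d \<tau> - \<sigma>2\<bar> \<le> e))"
proof -
  define S where "S d = map_pmf (\<lambda>f. (\<Sum>j\<in>{1..d}. f j) + - A d) (Pi_pmf {1..d} 0 (Q d))" for d
  have S: "char (pmf_law (S d)) t = charS d t" for d t
    unfolding pchar_eq_char[symmetric] S_def charS_def
    using pchar_sum_Pi_pmf[of "{1..d}" "\<lambda>_ x. x" "- A d" 0 "Q d" t] by (simp add: map_pmf_ident)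
  have "weak_conv_m (\<lambda>d. pmf_law (S d)) M"
    by (rule levy_continuity[OF real_distribution_pmf_law M]) (simp add: S charM conv)
  then have u: "\<forall>\<^sub>F d in sequentially. \<forall>t. \<bar>t\<bar> \<le> R \<longrightarrow> norm (charS d t - exp (psi t)) < e" if "e > 0" for R e
    using weak_conv_char_uniform[OF real_distribution_pmf_law M _ that, of S R] unfolding S charM by blast
  obtain B where B: "\<forall>\<^sub>F d in sequentially. Ks d \<le> B" using Ks_bounded_of_conv[OF u] by blast
  have lim: "(\<lambda>d. Ex d t) \<longlonglongrightarrow> psi t" for t by (rule Ex_tendsto_of_conv[OF u])
  have c: "isCont L y" if "y > 0" for y
    by (rule cont[OF _ that]) (rule Ft_tendsto_isCont[OF B lim])
  have hA: "(\<lambda>d. Ft d y) \<longlonglongrightarrow> - L y" if "y > 0" for y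
    by (rule Ft_tendsto_isCont[OF B lim that c[OF that]])
  note hC = Sv_limit[OF B lim hA]
  have "(\<lambda>d. Sm d \<tau> - A d) \<longlonglongrightarrow> levy_shift \<tau>" if "\<tau> > 0" for \<tau>
    by (rule Sm_tendsto[OF hA hC lim that])
  then show ?thesis using hA hC by blast
qed

end

section \<open>Quantiles and self-decomposability\<close>

text \<open>By Fubini the integral in the definition is the probability of
  \<open>{y + z <= x}\<close> for independent \<open>y\<close> and \<open>z\<close>, so the identity
  of distribution functions is a convolution identity of laws.\<close>

lemma self_decomposable_convolution:
  assumes M: "real_distribution M" and K: "real_distribution K" and "\<alpha> > 0"
    and eq: "\<And>x. cdf M x = (\<integral>y. cdf K (x - y) \<partial>(distr M borel (\<lambda>y. y / \<alpha>)))"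
  shows "M = distr (distr M borel (\<lambda>y. y / \<alpha>) \<Otimes>\<^sub>M K) borel (\<lambda>(y, z). y + z)"
proof -
  interpret M: real_distribution M by fact
  interpret K: real_distribution K by fact
  let ?M = "distr M borel (\<lambda>y. y / \<alpha>)"
  interpret M': real_distribution ?M by (rule M.real_distribution_distr) simp
  interpret P: pair_prob_space ?M K ..
  have [measurable_cong]: "sets K = sets borel" by simp
  let ?D = "distr (?M \<Otimes>\<^sub>M K) borel (\<lambda>(y, z). y + z)"
  have D: "real_distribution ?D" by (rule P.real_distribution_distr) measurable
  have "cdf M = cdf ?D"
  proof
    fix x
    let ?S = "{(y, z). y + z \<le> x} :: (real \<times> real) set"
    have S: "?S \<in> sets (?M \<Otimes>\<^sub>M K)"
    proof -
      have "{w \<in> space (?M \<Otimes>\<^sub>M K). fst w + snd w \<le> x} \<in> sets (?M \<Otimes>\<^sub>M K)" by measurable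
      moreover have "{w \<in> space (?M \<Otimes>\<^sub>M K). fst w + snd w \<le> x} = ?S" by (auto simp: space_pair_measure)
      ultimately show ?thesis by simp
    qed
    have "emeasure ?D {..x} = emeasure (?M \<Otimes>\<^sub>M K) ?S"
      by (subst emeasure_distr) (auto simp: space_pair_measure intro!: arg_cong2[of _ _ _ _ emeasure])
    also have "\<dots> = (\<integral>\<^sup>+y. emeasure K (Pair y -` ?S) \<partial>?M)"
      by (rule K.emeasure_pair_measure_alt[OF S])
    also have "\<dots> = (\<integral>\<^sup>+y. ennreal (cdf K (x - y)) \<partial>?M)"
      by (intro nn_integral_cong) (auto simp: cdf_def K.emeasure_eq_measure le_diff_eq add.commute intro!: arg_cong2[of _ _ _ _ Sigma_Algebra.measure])
    also have "\<dots> = ennreal (\<integral>y. cdf K (x - y) \<partial>?M)"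
    proof (rule nn_integral_eq_integral)
      have m: "cdf K \<in> borel_measurable borel"
        by (rule borel_measurable_mono) (auto simp: mono_def K.cdf_nondecreasing)
      show "integrable ?M (\<lambda>y. cdf K (x - y))"
        by (rule M'.integrable_const_bound[of _ 1]) (auto simp: K.cdf_nonneg K.cdf_bounded_prob intro: measurable_compose[OF _ m])
    qed (simp add: K.cdf_nonneg)
    finally have "emeasure ?D {..x} = ennreal (cdf M x)" by (simp add: eq)
    then show "cdf M x = cdf ?D x" using M.cdf_nonneg by (simp add: cdf_def measure_def)
  qed
  then show ?thesis using cdf_unique[OF M D] by simp
qed

lemma char_self_decomposable:
  assumes M: "real_distribution M" and K: "real_distribution K" and "\<alpha> > 0"
    and eq: "M = distr (distr M borel (\<lambda>y. y / \<alpha>) \<Otimes>\<^sub>M K) borel (\<lambda>(y, z). y + z)"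
  shows "char M t = char M (t / \<alpha>) * char K t"
proof -
  interpret M: real_distribution M by fact
  interpret K: real_distribution K by fact
  let ?M = "distr M borel (\<lambda>y. y / \<alpha>)"
  interpret M': real_distribution ?M by (rule M.real_distribution_distr) simp
  interpret P: pair_prob_space ?M K ..
  have [measurable_cong]: "sets K = sets borel" by simp
  have "char M t = (CLINT w|?M \<Otimes>\<^sub>M K. iexp (t * (case w of (y, z) \<Rightarrow> y + z)))"
    by (subst eq) (simp add: char_def integral_distr)
  also have "\<dots> = (CLINT w|?M \<Otimes>\<^sub>M K. (case w of (y, z) \<Rightarrow> iexp (t * y) * iexp (t * z)))"
    by (rule Bochner_Integration.integral_cong) (auto simp: distrib_left exp_add split: prod.split)
  also have "\<dots> = (CLINT y|?M. CLINT z|K. iexp (t * y) * iexp (t * z))"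
    by (rule P.integral_fst[symmetric], rule P.integrable_const_bound[of _ 1]) (auto simp: norm_mult)
  also have "\<dots> = char ?M t * char K t"
    by (simp add: char_def)
  also have "char ?M t = char M (t / \<alpha>)"
    unfolding char_def by (subst integral_distr) auto
  finally show ?thesis .
qed

text \<open>Let \<open>(s1, s2)\<close> be the maximal gap at the flat level and \<open>Z\<close>
  the summand added to \<open>Y / \<alpha>\<close>. As the characteristic function of the law has no
  zeros, that of \<open>Z\<close> tends to 1 with \<open>\<alpha>\<close> tending to 1, so
  \<open>Z\<close> concentrates at 0. Since \<open>Y\<close> charges neighbourhoods of
  \<open>s2\<close>, \<open>Z\<close> avoids a range below \<open>s2 - s2 / \<alpha>\<close>; since
  it charges those of \<open>s1\<close>, \<open>Z\<close> avoids a range above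
  \<open>s1 - s1 / \<alpha>\<close>. The first number is the larger one, so the two ranges cover a
  neighbourhood of 0.\<close>

lemma self_decomposable_cdf_strict:
  assumes sd: "self_decomposable M" and nz: "\<And>t. char M t \<noteq> 0"
    and xy: "x < y" and g: "0 < cdf M x" "cdf M x < 1"
  shows "cdf M x < cdf M y"
proof (rule ccontr)
  assume neg: "\<not> cdf M x < cdf M y"
  have M: "real_distribution M" using sd by (simp add: self_decomposable_def)
  interpret M: real_distribution M by fact
  define g where "g = cdf M x"
  have gy: "cdf M y = g" using neg M.cdf_nondecreasing[of x y] xy by (simp add: g_def)
  define S1 where "S1 = {z. cdf M z \<ge> g}"
  define S2 where "S2 = {z. cdf M z > g}"
  have "\<forall>\<^sub>F z in at_bot. cdf M z < g" using order_tendstoD(2)[OF M.cdf_lim_at_bot] assms by (simp add: g_def)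
  then obtain z0 where z0: "\<And>z. z \<le> z0 \<Longrightarrow> cdf M z < g" unfolding eventually_at_bot_linorder by blast
  have S1b: "z0 \<le> z" if "z \<in> S1" for z using z0[of z] that by (force simp: S1_def)
  have S2b: "y \<le> z" if "z \<in> S2" for z
    using that M.cdf_nondecreasing[of z y] gy by (force simp: S2_def)
  have "\<forall>\<^sub>F z in at_top. g < cdf M z" using order_tendstoD(1)[OF M.cdf_lim_at_top_prob] assms by (simp add: g_def)
  then have S2n: "S2 \<noteq> {}" unfolding S2_def eventually_at_top_linorder by blast
  have xS1: "x \<in> S1" by (simp add: S1_def g_def)
  have bd1: "bdd_below S1" and bd2: "bdd_below S2" using S1b S2b by (auto simp: bdd_below_def)
  define s1 where "s1 = Inf S1"
  define s2 where "s2 = Inf S2"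
  have s1x: "s1 \<le> x" unfolding s1_def by (rule cInf_lower[OF xS1 bd1])
  have s2y: "y \<le> s2" unfolding s2_def by (rule cInf_greatest[OF S2n S2b])
  have below1: "cdf M z < g" if "z < s1" for z
  proof (rule ccontr)
    assume "\<not> cdf M z < g"
    then have "z \<in> S1" by (simp add: S1_def)
    then have "s1 \<le> z" unfolding s1_def by (intro cInf_lower bd1)
    then show False using that by simp
  qed
  have above1: "g \<le> cdf M z" if z: "s1 < z" for z
  proof -
    obtain w where "w \<in> S1" "w < z" using z cInf_less_iff[OF _ bd1, of z] xS1 unfolding s1_def by blast
    then show ?thesis using M.cdf_nondecreasing[of w z] by (simp add: S1_def)
  qed
  have below2: "cdf M z \<le> g" if "z < s2" for z
  proof (rule ccontr)
    assume "\<not> cdf M z \<le> g"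
    then have "z \<in> S2" by (simp add: S2_def)
    then have "s2 \<le> z" unfolding s2_def by (intro cInf_lower bd2)
    then show False using that by simp
  qed
  have above2: "g < cdf M z" if z: "s2 < z" for z
  proof -
    obtain w where "w \<in> S2" "w < z" using z cInf_less_iff[OF S2n bd2, of z] unfolding s2_def by blast
    then show ?thesis using M.cdf_nondecreasing[of w z] by (simp add: S2_def)
  qed
  define G where "G = s2 - s1"
  have G: "G > 0" using s1x s2y xy by (simp add: G_def)
  have gap: "measure M {s1<..<s2} = 0"
  proof -
    have "measure M {u<..v} = 0" if "s1 < u" "u \<le> v" "v < s2" for u v
    proof -
      have "measure M {u<..v} = cdf M v - cdf M u"
        using M.cdf_diff_eq[of u v] that by (cases "u = v") auto
      also have "\<dots> \<le> 0" using above1[of u] below2[of v] that by simp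
      finally show ?thesis using measure_nonneg[of M "{u<..v}"] by linarith
    qed note z = this
    \<comment> \<open>With denominators from 3 on, the left end of each exhausting interval stays
      below its right end.\<close>
    have "{s1<..<s2} = (\<Union>n. {s1 + G / (real n + 3)<..s2 - G / (real n + 3)})"
    proof safe
      fix w assume w: "w \<in> {s1<..<s2}"
      define m where "m = min (w - s1) (s2 - w)"
      have m: "m > 0" using w by (simp add: m_def)
      obtain n :: nat where n: "G / m < real n" using reals_Archimedean2 by blast
      have "G < real n * m" using n m by (simp add: divide_less_eq)
      then have "G < (real n + 3) * m" using m by (simp add: distrib_right)
      then have "G / (real n + 3) < m" by (simp add: divide_less_eq mult.commute)
      then show "w \<in> (\<Union>n. {s1 + G / (real n + 3)<..s2 - G / (real n + 3)})" by (auto simp: m_def intro!: exI[of _ n])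
    next
      fix w n assume "w \<in> {s1 + G / (real n + 3)<..s2 - G / (real n + 3)}"
      moreover have "0 < G / (real n + 3)" using G by simp
      ultimately show "w \<in> {s1<..<s2}" by auto
    qed
    moreover have "emeasure M (\<Union>n. {s1 + G / (real n + 3)<..s2 - G / (real n + 3)}) = 0"
    proof (rule emeasure_UN_eq_0)
      fix n
      have e: "0 < G / (real n + 3)" "2 * (G / (real n + 3)) \<le> G" using G by (auto simp: field_simps)
      have "measure M {s1 + G / (real n + 3)<..s2 - G / (real n + 3)} = 0"
        using e by (intro z) (auto simp: G_def)
      then show "emeasure M {s1 + G / (real n + 3)<..s2 - G / (real n + 3)} = 0"
        by (simp add: M.emeasure_eq_measure)
    qed auto
    ultimately show ?thesis by (simp add: M.emeasure_eq_measure)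
  qed
  have near1: "measure M {s1 - r<..<s1 + r} > 0" if r: "r > 0" "r \<le> G" for r
  proof -
    have "0 < cdf M (s1 + r/2) - cdf M (s1 - r/2)" using below1[of "s1 - r/2"] above1[of "s1 + r/2"] r by simp
    also have "\<dots> = measure M {s1 - r/2<..s1 + r/2}" using r by (intro M.cdf_diff_eq) simp
    also have "\<dots> \<le> measure M {s1 - r<..<s1 + r}" using r by (intro M.finite_measure_mono) auto
    finally show ?thesis .
  qed
  have near2: "measure M {s2 - r<..<s2 + r} > 0" if r: "r > 0" "r \<le> G" for r
  proof -
    have "0 < cdf M (s2 + r/2) - cdf M (s2 - r/2)" using below2[of "s2 - r/2"] above2[of "s2 + r/2"] r by simp
    also have "\<dots> = measure M {s2 - r/2<..s2 + r/2}" using r by (intro M.cdf_diff_eq) simp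
    also have "\<dots> \<le> measure M {s2 - r<..<s2 + r}" using r by (intro M.finite_measure_mono) auto
    finally show ?thesis .
  qed
  define \<alpha> where "\<alpha> n = 1 + 1 / (real n + 1)" for n
  have \<alpha>: "\<alpha> n > 1" for n by (simp add: \<alpha>_def)
  have \<alpha>1: "\<alpha> \<longlonglongrightarrow> 1"
  proof -
    have "(\<lambda>n. 1 + 1 / real (Suc n)) \<longlonglongrightarrow> 1 + 0" by (intro tendsto_add tendsto_const LIMSEQ_Suc[OF lim_1_over_n])
    then show ?thesis unfolding \<alpha>_def by (simp add: add.commute)
  qed
  have "\<forall>n. \<exists>K. real_distribution K \<and> (\<forall>x. cdf M x = (\<integral>y. cdf K (x - y) \<partial>(distr M borel (\<lambda>y. y / \<alpha> n))))"
    using sd \<alpha> unfolding self_decomposable_def by blast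
  then obtain K where K: "\<And>n. real_distribution (K n)"
    "\<And>n x. cdf M x = (\<integral>y. cdf (K n) (x - y) \<partial>(distr M borel (\<lambda>y. y / \<alpha> n)))" by metis
  have \<alpha>0: "\<alpha> n > 0" for n using \<alpha>[of n] by simp
  have conv: "M = distr (distr M borel (\<lambda>y. y / \<alpha> n) \<Otimes>\<^sub>M K n) borel (\<lambda>(y, z). y + z)" for n
    by (rule self_decomposable_convolution[OF M K(1) \<alpha>0 K(2)])
  have "weak_conv_m K (return borel 0)"
  proof (rule levy_continuity[OF K(1)])
    show "real_distribution (return borel 0)"
      unfolding real_distribution_def real_distribution_axioms_def by (auto intro: prob_space_return)
    fix t
    have "(\<lambda>n. t / \<alpha> n) \<longlonglongrightarrow> t / 1" by (intro tendsto_divide tendsto_const \<alpha>1) simp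
    then have "(\<lambda>n. char M (t / \<alpha> n)) \<longlonglongrightarrow> char M t"
      using isCont_tendsto_compose[OF M.isCont_char[of t]] by simp
    then have "(\<lambda>n. char M t / char M (t / \<alpha> n)) \<longlonglongrightarrow> char M t / char M t"
      by (intro tendsto_divide tendsto_const nz)
    moreover have "char M t / char M (t / \<alpha> n) = char (K n) t" for n
      using char_self_decomposable[OF M K(1) \<alpha>0 conv, of t n] nz by (simp add: field_simps)
    ultimately show "(\<lambda>n. char (K n) t) \<longlonglongrightarrow> char (return borel 0) t"
      using nz[of t] by (simp add: char_def integral_return)
  qed
  then have wc: "(\<lambda>n. cdf (K n) z) \<longlonglongrightarrow> cdf (return borel 0) z" if "z \<noteq> 0" for z
  proof -
    have "isCont (cdf (return borel 0)) z"
    proof (subst finite_borel_measure.isCont_cdf)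
      show "finite_borel_measure (return borel 0)"
        unfolding finite_borel_measure_def finite_borel_measure_axioms_def
        using prob_space_return[of 0 borel] by (auto simp: prob_space_def)
      show "measure (return borel 0) {z} = 0" using that by (simp add: measure_return)
    qed
    then show ?thesis using \<open>weak_conv_m K (return borel 0)\<close> by (auto simp: weak_conv_m_def weak_conv_def)
  qed
  have "(\<lambda>n. cdf (K n) (G/16) - cdf (K n) (- G/16)) \<longlonglongrightarrow> cdf (return borel 0) (G/16) - cdf (return borel 0) (- G/16)"
    using G by (intro tendsto_diff wc) auto
  moreover have "cdf (return borel 0) (G/16) - cdf (return borel 0) (- G/16) = 1"
    using G by (simp add: cdf_def measure_return indicator_def)
  ultimately have "\<forall>\<^sub>F n in sequentially. 0 < cdf (K n) (G/16) - cdf (K n) (- G/16)"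
    by (intro order_tendstoD(1)) auto
  moreover have sh: "\<forall>\<^sub>F n in sequentially. \<bar>s - s / \<alpha> n\<bar> < G/8" for s
  proof -
    have "(\<lambda>n. s - s / \<alpha> n) \<longlonglongrightarrow> s - s / 1" by (intro tendsto_diff tendsto_divide tendsto_const \<alpha>1) simp
    from tendstoD[OF this, of "G/8"] G show ?thesis by (simp add: dist_real_def)
  qed
  ultimately have "\<forall>\<^sub>F n in sequentially. 0 < cdf (K n) (G/16) - cdf (K n) (- G/16) \<and> \<bar>s1 - s1 / \<alpha> n\<bar> < G/8 \<and> \<bar>s2 - s2 / \<alpha> n\<bar> < G/8"
    by (intro eventually_conj) auto
  then obtain n where n: "0 < cdf (K n) (G/16) - cdf (K n) (- G/16)" "\<bar>s1 - s1 / \<alpha> n\<bar> < G/8" "\<bar>s2 - s2 / \<alpha> n\<bar> < G/8"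
    using eventually_happens' by (metis (no_types, lifting) sequentially_bot)
  interpret K: real_distribution "K n" by (rule K)
  let ?M = "distr M borel (\<lambda>y. y / \<alpha> n)"
  interpret M': real_distribution ?M by (rule M.real_distribution_distr) simp
  interpret P: pair_prob_space ?M "K n" ..
  have [measurable_cong]: "sets (K n) = sets borel" by simp
  \<comment> \<open>If all sums from \<open>Y\<close> and \<open>Z\<close> fall into the gap,
    independence bounds the product of their masses by the mass of the gap, which is 0.\<close>
  have prod0: "measure (K n) Z = 0"
    if Y: "Y \<in> sets borel" "measure M Y > 0" and Z: "Z \<in> sets borel"
      and imp: "\<And>y z. y \<in> Y \<Longrightarrow> z \<in> Z \<Longrightarrow> y / \<alpha> n + z \<in> {s1<..<s2}" for Y Z
  proof -
    let ?Y = "{u. u * \<alpha> n \<in> Y}"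
    have Ym: "?Y \<in> sets borel"
    proof -
      have "{u \<in> space borel. u * \<alpha> n \<in> Y} \<in> sets borel" using Y(1) by measurable
      then show ?thesis by simp
    qed
    have "emeasure ?M ?Y = emeasure M ((\<lambda>y. y / \<alpha> n) -` ?Y \<inter> space M)"
      using Ym by (intro emeasure_distr) auto
    also have "(\<lambda>y. y / \<alpha> n) -` ?Y \<inter> space M = Y" using \<alpha>0[of n] by auto
    finally have mY: "emeasure ?M ?Y = emeasure M Y" .
    have "emeasure ?M ?Y * emeasure (K n) Z = emeasure (?M \<Otimes>\<^sub>M K n) (?Y \<times> Z)"
      by (rule K.emeasure_pair_measure_Times[symmetric]) (use Ym Z in auto)
    also have "\<dots> \<le> emeasure (?M \<Otimes>\<^sub>M K n) ((\<lambda>(y, z). y + z) -` {s1<..<s2} \<inter> space (?M \<Otimes>\<^sub>M K n))"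
    proof (rule emeasure_mono)
      show "?Y \<times> Z \<subseteq> (\<lambda>(y, z). y + z) -` {s1<..<s2} \<inter> space (?M \<Otimes>\<^sub>M K n)"
      proof
        fix w assume "w \<in> ?Y \<times> Z"
        then obtain u z where w: "w = (u, z)" "u * \<alpha> n \<in> Y" "z \<in> Z" by auto
        have "u * \<alpha> n / \<alpha> n + z \<in> {s1<..<s2}" by (rule imp[OF w(2,3)])
        then show "w \<in> (\<lambda>(y, z). y + z) -` {s1<..<s2} \<inter> space (?M \<Otimes>\<^sub>M K n)"
          using \<alpha>0[of n] w(1) by (auto simp: space_pair_measure)
      qed
      show "(\<lambda>(y, z). y + z) -` {s1<..<s2} \<inter> space (?M \<Otimes>\<^sub>M K n) \<in> sets (?M \<Otimes>\<^sub>M K n)" by measurable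
    qed
    also have "\<dots> = emeasure M {s1<..<s2}"
      by (subst (2) conv[of n], rule emeasure_distr[symmetric]) measurable
    also have "\<dots> = 0" using gap by (simp add: M.emeasure_eq_measure)
    finally have "emeasure M Y * emeasure (K n) Z = 0" unfolding mY by simp
    then show ?thesis using Y(2) by (auto simp: M.emeasure_eq_measure K.emeasure_eq_measure ennreal_mult[symmetric])
  qed
  \<comment> \<open>The shift of \<open>s2\<close>, the radius \<open>r\<close> and the left bound
    of the range are each at most \<open>G/8\<close> in size, so the sum cannot drop out of the gap
    at its far end.\<close>
  have low: "measure (K n) {- G/8<..<s2 - s2 / \<alpha> n - r} = 0" if r: "r > 0" "r \<le> G/8" for r
  proof (rule prod0[of "{s2 - r<..<s2 + r}"])
    show "0 < measure M {s2 - r<..<s2 + r}" using near2[of r] r G by simp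
    fix y z assume y: "y \<in> {s2 - r<..<s2 + r}" and z: "z \<in> {- G/8<..<s2 - s2 / \<alpha> n - r}"
    have "\<bar>y / \<alpha> n - s2 / \<alpha> n\<bar> \<le> \<bar>y - s2\<bar>"
    proof -
      have "y / \<alpha> n - s2 / \<alpha> n = (y - s2) / \<alpha> n" by (simp add: diff_divide_distrib)
      then show ?thesis using \<alpha>[of n] by (simp add: abs_divide divide_le_eq mult_le_cancel_left1)
    qed
    then have "\<bar>y / \<alpha> n - s2 / \<alpha> n\<bar> < r" using y by auto
    moreover have "- (G/8) < z" "z < s2 - s2 / \<alpha> n - r" using z by auto
    moreover have "s2 = s1 + G" by (simp add: G_def)
    ultimately have "s1 < y / \<alpha> n + z" "y / \<alpha> n + z < s2" using n(3) r G by linarith+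
    then show "y / \<alpha> n + z \<in> {s1<..<s2}" by simp
  qed auto
  have high: "measure (K n) {s1 - s1 / \<alpha> n + r<..<G/8} = 0" if r: "r > 0" "r \<le> G/8" for r
  proof (rule prod0[of "{s1 - r<..<s1 + r}"])
    show "0 < measure M {s1 - r<..<s1 + r}" using near1[of r] r G by simp
    fix y z assume y: "y \<in> {s1 - r<..<s1 + r}" and z: "z \<in> {s1 - s1 / \<alpha> n + r<..<G/8}"
    have "\<bar>y / \<alpha> n - s1 / \<alpha> n\<bar> \<le> \<bar>y - s1\<bar>"
    proof -
      have "y / \<alpha> n - s1 / \<alpha> n = (y - s1) / \<alpha> n" by (simp add: diff_divide_distrib)
      then show ?thesis using \<alpha>[of n] by (simp add: abs_divide divide_le_eq mult_le_cancel_left1)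
    qed
    then have "\<bar>y / \<alpha> n - s1 / \<alpha> n\<bar> < r" using y by auto
    moreover have "s1 - s1 / \<alpha> n + r < z" "z < G/8" using z by auto
    moreover have "s2 = s1 + G" by (simp add: G_def)
    ultimately have "s1 < y / \<alpha> n + z" "y / \<alpha> n + z < s2" using n(2) r G by linarith+
    then show "y / \<alpha> n + z \<in> {s1<..<s2}" by simp
  qed auto
  define w1 where "w1 = s1 - s1 / \<alpha> n"
  define w2 where "w2 = s2 - s2 / \<alpha> n"
  have w: "w1 < w2"
  proof -
    have "w2 - w1 = (s2 - s1) - (s2 - s1) / \<alpha> n" by (simp add: w1_def w2_def diff_divide_distrib)
    also have "\<dots> = G * (1 - 1 / \<alpha> n)" by (simp add: G_def right_diff_distrib)
    also have "\<dots> > 0" using G \<alpha>[of n] by simp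
    finally show ?thesis by simp
  qed
  \<comment> \<open>With at most a quarter of the distance, the ranges ending at
    \<open>w2 - r\<close> and starting at \<open>w1 + r\<close> overlap.\<close>
  define r where "r = min (G/8) ((w2 - w1) / 4)"
  have r: "r > 0" "r \<le> G/8" using G w by (auto simp: r_def)
  have "0 < measure (K n) {- G/16<..G/16}" using n(1) K.cdf_diff_eq[of "- G/16" "G/16"] G by simp
  also have "\<dots> \<le> measure (K n) ({- G/8<..<w2 - r} \<union> {w1 + r<..<G/8})"
  proof (rule K.finite_measure_mono)
    have "r \<le> (w2 - w1) / 4" unfolding r_def by (rule min.cobounded2)
    then have "r + r \<le> (w2 - w1) / 4 + (w2 - w1) / 4" by (intro add_mono)
    also have "\<dots> < w2 - w1" using w by simp
    finally have "w1 + r < w2 - r" by (simp only: less_diff_eq add.assoc add.commute)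
    then show "{- G/16<..G/16} \<subseteq> {- G/8<..<w2 - r} \<union> {w1 + r<..<G/8}" using G by auto
  qed auto
  also have "\<dots> \<le> measure (K n) {- G/8<..<w2 - r} + measure (K n) {w1 + r<..<G/8}"
    by (rule measure_Un_le) auto
  also have "\<dots> = 0" using low[OF r] high[OF r] by (simp add: w1_def w2_def)
  finally show False by simp
qed

text \<open>Hypotheses \<open>up\<close> and \<open>lo\<close> tie \<open>cx\<close> to the
  quantiles of \<open>V d\<close> up to an exponential error. As \<open>b d\<close> tends to
  infinity, moving \<open>y\<close> by a fixed amount makes this error negligible. Strict increase
  of the limit gives \<open>m < G y\<close> for every \<open>y\<close> to the right of the
  quantile.\<close>

lemma quantile_asymptotics_iff_weak_conv:
  fixes cx :: "nat \<Rightarrow> real \<Rightarrow> real" and V :: "nat \<Rightarrow> real measure" and a b :: "nat \<Rightarrow> real" and q :: "real \<Rightarrow> real"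
  assumes b_pos: "\<forall>d. b d > 0" and b_lim: "filterlim b at_top sequentially"
    and M: "real_distribution M" and V: "\<And>d. real_distribution (V d)"
    and strict: "\<And>x y. x < y \<Longrightarrow> 0 < cdf M x \<Longrightarrow> cdf M x < 1 \<Longrightarrow> cdf M x < cdf M y"
    and q_def: "\<forall>\<epsilon>\<in>{0<..<1}. q \<epsilon> = gen_inv (cdf M) (1 - \<epsilon>\<^sup>2)"
    and up: "\<And>d \<epsilon> y. 0 < \<epsilon> \<Longrightarrow> \<epsilon> < 1 \<Longrightarrow> 1 - \<epsilon>\<^sup>2 \<le> cdf (V d) y \<Longrightarrow> cx d \<epsilon> \<le> a d + y * b d"
    and lo: "\<And>d \<epsilon> y. 0 < \<epsilon> \<Longrightarrow> \<epsilon> < 1 \<Longrightarrow> 1 - \<epsilon>\<^sup>2 \<le> cdf (V d) y + exp (cx d \<epsilon> - a d - y * b d)"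
  shows "(\<forall>\<epsilon>\<in>{0<..<1}. (\<lambda>d. cx d \<epsilon> - a d - q \<epsilon> * b d) \<in> o(b)) \<longleftrightarrow> weak_conv_m V M"
proof -
  interpret M: real_distribution M by fact
  have bnz: "\<forall>\<^sub>F d in sequentially. b d \<noteq> 0" by (intro always_eventually allI) (use b_pos in \<open>simp add: less_imp_neq[THEN not_sym]\<close>)
  have small: "(\<lambda>d. cx d \<epsilon> - a d - q \<epsilon> * b d) \<in> o(b) \<longleftrightarrow> (\<lambda>d. (cx d \<epsilon> - a d) / b d) \<longlonglongrightarrow> q \<epsilon>" for \<epsilon>
  proof -
    have e: "(cx d \<epsilon> - a d - q \<epsilon> * b d) / b d = (cx d \<epsilon> - a d) / b d - q \<epsilon>" for d
      using b_pos[rule_format, of d] by (simp add: diff_divide_distrib)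
    have "(\<lambda>d. cx d \<epsilon> - a d - q \<epsilon> * b d) \<in> o(b) \<longleftrightarrow> (\<lambda>d. (cx d \<epsilon> - a d - q \<epsilon> * b d) / b d) \<longlonglongrightarrow> 0"
      by (rule iffI, erule smalloD_tendsto, erule smalloI_tendsto[OF _ bnz])
    also have "\<dots> \<longleftrightarrow> (\<lambda>d. (cx d \<epsilon> - a d) / b d) \<longlonglongrightarrow> q \<epsilon>"
      unfolding e by (rule LIM_zero_iff)
    finally show ?thesis .
  qed
  define G where "G = cdf M"
  have Gmono: "G x \<le> G y" if "x \<le> y" for x y unfolding G_def using that by (rule M.cdf_nondecreasing)
  \<comment> \<open>Right continuity makes the infimum attained, so that \<open>m <= G x\<close>
    holds exactly when \<open>gen_inv G m <= x\<close>.\<close>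
  have Q1: "m \<le> G (gen_inv G m)" and Q2: "m \<le> G x \<Longrightarrow> gen_inv G m \<le> x" if m: "0 < m" "m < 1" for m x
  proof -
    define S where "S = {x. m \<le> G x}"
    have "\<forall>\<^sub>F z in at_bot. G z < m" unfolding G_def using order_tendstoD(2)[OF M.cdf_lim_at_bot] m by simp
    then obtain z0 where z0: "\<And>z. z \<le> z0 \<Longrightarrow> G z < m" unfolding eventually_at_bot_linorder by blast
    have "z0 \<le> z" if "z \<in> S" for z using z0[of z] that by (force simp: S_def)
    then have bd: "bdd_below S" by (auto simp: bdd_below_def)
    have "\<forall>\<^sub>F z in at_top. m < G z" unfolding G_def using order_tendstoD(1)[OF M.cdf_lim_at_top_prob] m by simp
    then have ne: "S \<noteq> {}" unfolding S_def eventually_at_top_linorder by (auto intro: less_imp_le)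
    have Inf: "gen_inv G m = Inf S" by (simp add: gen_inv_def S_def)
    show "gen_inv G m \<le> x" if "m \<le> G x" unfolding Inf using that bd by (intro cInf_lower) (auto simp: S_def)
    have "(G \<longlongrightarrow> G (Inf S)) (at_right (Inf S))"
      using M.cdf_is_right_cont[of "Inf S"] unfolding G_def continuous_within .
    moreover have "\<forall>\<^sub>F z in at_right (Inf S). m \<le> G z"
    proof (rule eventually_at_right_less[THEN eventually_mono])
      fix z assume "Inf S < z"
      then obtain w where "w \<in> S" "w < z" using cInf_less_iff[OF ne bd] by blast
      then show "m \<le> G z" using Gmono[of w z] by (simp add: S_def)
    qed
    ultimately show "m \<le> G (gen_inv G m)" unfolding Inf by (rule tendsto_lowerbound) simp
  qed
  have qG: "q \<epsilon> = gen_inv G (1 - \<epsilon>\<^sup>2)" if "0 < \<epsilon>" "\<epsilon> < 1" for \<epsilon> using q_def that by (simp add: G_def)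
  have e2: "0 < 1 - \<epsilon>\<^sup>2" "1 - \<epsilon>\<^sup>2 < 1" if "0 < \<epsilon>" "\<epsilon> < 1" for \<epsilon> :: real
    using that by (auto simp: power_less_one_iff)
  have pick: "\<exists>x. u < x \<and> x < v \<and> isCont G x" if "u < v" for u v
  proof -
    have c: "countable {x. \<not> isCont G x}"
      unfolding G_def M.isCont_cdf using M.countable_support by simp
    have "\<exists>x\<in>{u<..<v}. x \<notin> {x. \<not> isCont G x}" by (rule open_minus_countable[OF c]) (use that in auto)
    then show ?thesis by auto
  qed
  show ?thesis
  proof
    assume "weak_conv_m V M"
    then have wc: "(\<lambda>d. cdf (V d) y) \<longlonglongrightarrow> G y" if "isCont G y" for y
      using that by (auto simp: weak_conv_m_def weak_conv_def G_def)
    show "\<forall>\<epsilon>\<in>{0<..<1}. (\<lambda>d. cx d \<epsilon> - a d - q \<epsilon> * b d) \<in> o(b)"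
    proof
      fix \<epsilon> :: real assume "\<epsilon> \<in> {0<..<1}"
      then have \<epsilon>: "0 < \<epsilon>" "\<epsilon> < 1" by auto
      define m where "m = 1 - \<epsilon>\<^sup>2"
      have m: "0 < m" "m < 1" using e2[OF \<epsilon>] by (auto simp: m_def)
      have qm: "q \<epsilon> = gen_inv G m" by (simp add: qG[OF \<epsilon>] m_def)
      show "(\<lambda>d. cx d \<epsilon> - a d - q \<epsilon> * b d) \<in> o(b)"
        unfolding small
      proof (rule order_tendstoI)
        fix u assume "q \<epsilon> < u"
        then obtain y where y: "q \<epsilon> < y" "y < u" "isCont G y" using pick by blast
        have "m < G y"
        proof (cases "m < G (q \<epsilon>)")
          case True
          then show ?thesis using Gmono[of "q \<epsilon>" y] y by linarith
        next
          case False
          then have "G (q \<epsilon>) = m" using Q1[OF m] qm by simp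
          then show ?thesis using strict[of "q \<epsilon>" y] y m by (simp add: G_def)
        qed
        from order_tendstoD(1)[OF wc[OF y(3)] this]
        show "\<forall>\<^sub>F d in sequentially. (cx d \<epsilon> - a d) / b d < u"
        proof eventually_elim
          case (elim d)
          then have "cx d \<epsilon> \<le> a d + y * b d" using up[OF \<epsilon>, of d y] by (simp add: m_def)
          then have "(cx d \<epsilon> - a d) / b d \<le> y" using b_pos[rule_format, of d] by (simp add: divide_le_eq)
          then show ?case using y by simp
        qed
      next
        fix u assume "u < q \<epsilon>"
        then obtain y where y: "u < y" "y < q \<epsilon>" "isCont G y" using pick by blast
        have Gy: "G y < m"
        proof (rule ccontr)
          assume "\<not> G y < m"
          then have "gen_inv G m \<le> y" by (intro Q2[OF m]) simp
          then show False using y qm by simp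
        qed
        \<comment> \<open>Half of the deficit \<open>m - G y\<close> is left for the exponential in
          \<open>lo\<close>; its exponent is then at least \<open>ln \<delta>\<close>, which is
          negligible against \<open>b d\<close>.\<close>
        define \<delta> where "\<delta> = (m - G y) / 2"
        have \<delta>: "\<delta> > 0" "G y < m - \<delta>" using Gy by (auto simp: \<delta>_def field_simps)
        have "(\<lambda>d. ln \<delta> / b d) \<longlonglongrightarrow> 0"
          by (rule tendsto_divide_0[OF tendsto_const filterlim_at_top_imp_at_infinity[OF b_lim]])
        then have "\<forall>\<^sub>F d in sequentially. u - y < ln \<delta> / b d" by (rule order_tendstoD(1)) (use y in simp)
        with order_tendstoD(2)[OF wc[OF y(3)] \<delta>(2)]
        show "\<forall>\<^sub>F d in sequentially. u < (cx d \<epsilon> - a d) / b d"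
        proof eventually_elim
          case (elim d)
          have "\<delta> \<le> exp (cx d \<epsilon> - a d - y * b d)" using lo[OF \<epsilon>, of d y] elim(1) by (simp add: m_def)
          from ln_mono[OF this \<delta>(1)] have "ln \<delta> \<le> cx d \<epsilon> - a d - y * b d" by (simp only: ln_exp)
          then have "ln \<delta> / b d \<le> (cx d \<epsilon> - a d - y * b d) / b d"
            using b_pos[rule_format, of d] by (intro divide_right_mono) auto
          also have "\<dots> = (cx d \<epsilon> - a d) / b d - y"
            using b_pos[rule_format, of d] by (simp add: diff_divide_distrib)
          finally show ?case using elim(2) by linarith
        qed
      qed
    qed
  next
    assume L: "\<forall>\<epsilon>\<in>{0<..<1}. (\<lambda>d. cx d \<epsilon> - a d - q \<epsilon> * b d) \<in> o(b)"
    have lim: "(\<lambda>d. (cx d \<epsilon> - a d) / b d) \<longlonglongrightarrow> q \<epsilon>" if "0 < \<epsilon>" "\<epsilon> < 1" for \<epsilon>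
      using L that small by auto
    \<comment> \<open>All levels in \<open>(0, 1)\<close> occur, so the asymptotics for every
      \<open>\<epsilon>\<close> control every quantile.\<close>
    have ex: "\<exists>\<epsilon>. 0 < \<epsilon> \<and> \<epsilon> < 1 \<and> 1 - \<epsilon>\<^sup>2 = m" if "0 < m" "m < 1" for m :: real
      using that by (intro exI[of _ "sqrt (1 - m)"]) auto
    show "weak_conv_m V M"
      unfolding weak_conv_m_def weak_conv_def
    proof (intro allI impI)
      fix y assume "isCont (cdf M) y"
      then have cont: "isCont G y" by (simp add: G_def)
      have "(\<lambda>d. cdf (V d) y) \<longlonglongrightarrow> G y"
      proof (rule order_tendstoI)
        fix m assume m: "G y < m"
        show "\<forall>\<^sub>F d in sequentially. cdf (V d) y < m"
        proof (cases "m > 1")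
          case True
          have "cdf (V d) y < m" for d
            using real_distribution.cdf_bounded_prob[OF V, of d y] True by linarith
          then show ?thesis by simp
        next
          case False
          obtain m' where m': "G y < m'" "m' < m" using m dense by blast
          have "0 \<le> G y" unfolding G_def by (rule M.cdf_nonneg)
          then have mm: "0 < m'" "m' < 1" using m' False by auto
          obtain \<epsilon> where \<epsilon>: "0 < \<epsilon>" "\<epsilon> < 1" "1 - \<epsilon>\<^sup>2 = m'" using ex[OF mm] by blast
          have "y < q \<epsilon>"
          proof (rule ccontr)
            assume "\<not> y < q \<epsilon>"
            then have "G (q \<epsilon>) \<le> G y" by (intro Gmono) simp
            then show False using Q1[OF mm] qG[OF \<epsilon>(1,2)] \<epsilon>(3) m' by simp
          qed
          from order_tendstoD(1)[OF lim[OF \<epsilon>(1,2)] this] show ?thesis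
          proof eventually_elim
            case (elim d)
            then have "a d + y * b d < cx d \<epsilon>" using b_pos[rule_format, of d] by (simp add: less_divide_eq)
            then have "\<not> m' \<le> cdf (V d) y" using up[OF \<epsilon>(1,2), of d y] \<epsilon>(3) by auto
            then show ?case using m' by simp
          qed
        qed
      next
        fix m assume m: "m < G y"
        show "\<forall>\<^sub>F d in sequentially. m < cdf (V d) y"
        proof (cases "m < 0")
          case True
          have "0 \<le> cdf (V d) y" for d by (simp add: cdf_def)
          then have "m < cdf (V d) y" for d using True less_le_trans by blast
          then show ?thesis by simp
        next
          case False
          have "(G \<longlongrightarrow> G y) (at_left y)" using cont unfolding isCont_def by (rule filterlim_mono[OF _ order_refl at_le]) simp
          from order_tendstoD(1)[OF this m] have ev: "\<forall>\<^sub>F z in at_left y. m < G z" .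
          have "\<forall>\<^sub>F z in at_left y. m < G z \<and> z < y"
            using ev by (intro eventually_conj) (auto simp: eventually_at_filter)
          then obtain y' where y': "m < G y'" "y' < y"
            using eventually_happens'[OF trivial_limit_at_left_real] by blast
          obtain m' where m': "m < m'" "m' < G y'" using y' dense by blast
          have "G y' \<le> 1" unfolding G_def by (rule M.cdf_bounded_prob)
          then have mm: "0 < m'" "m' < 1" using m' False by auto
          obtain \<epsilon> where \<epsilon>: "0 < \<epsilon>" "\<epsilon> < 1" "1 - \<epsilon>\<^sup>2 = m'" using ex[OF mm] by blast
          have qy: "q \<epsilon> \<le> y'" using Q2[OF mm, of y'] m' qG[OF \<epsilon>(1,2)] \<epsilon>(3) by simp
          \<comment> \<open>With this margin the exponential in \<open>lo\<close> is below
            \<open>exp (- h * b d)\<close>, and hence below \<open>m' - m\<close> for large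
            \<open>d\<close>.\<close>
          define h where "h = (y - y') / 2"
          have h: "h > 0" "q \<epsilon> < y - h" using y' qy by (auto simp: h_def field_simps)
          have "\<forall>\<^sub>F d in sequentially. (- ln (m' - m)) / h \<le> b d" using b_lim unfolding filterlim_at_top by blast
          with order_tendstoD(2)[OF lim[OF \<epsilon>(1,2)] h(2)] have "\<forall>\<^sub>F d in sequentially. (cx d \<epsilon> - a d) / b d < y - h \<and> (- ln (m' - m)) / h \<le> b d"
            by (rule eventually_conj)
          then show ?thesis
          proof eventually_elim
            case (elim d)
            have "cx d \<epsilon> - a d < (y - h) * b d" using elim b_pos[rule_format, of d] by (simp add: divide_less_eq)
            then have "cx d \<epsilon> - a d - y * b d < - (h * b d)" by (simp add: left_diff_distrib)
            moreover have "- ln (m' - m) \<le> h * b d"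
              using conjunct2[OF elim] unfolding pos_divide_le_eq[OF h(1)] by (simp only: mult.commute)
            ultimately have "cx d \<epsilon> - a d - y * b d < ln (m' - m)" by linarith
            then have "exp (cx d \<epsilon> - a d - y * b d) < exp (ln (m' - m))" by simp
            also have "\<dots> = m' - m" using m' by simp
            finally show ?case using lo[OF \<epsilon>(1,2), of d y] \<epsilon>(3) by linarith
          qed
        qed
      qed
      then show "(\<lambda>d. cdf (V d) y) \<longlonglongrightarrow> cdf M y" by (simp add: G_def)
    qed
  qed
qed

section \<open>Eigenvalues and complexity\<close>

lemma expectation_infsum:
  fixes f :: "'a \<Rightarrow> real"
  assumes "integrable (measure_pmf p) f"
  shows "E p f = (\<Sum>\<^sub>\<infinity>x. pmf p x * f x)"
proof -
  have "integrable (density (count_space UNIV) (pmf p)) f"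
    using assms by (simp add: measure_pmf_eq_density)
  then have "integrable (count_space UNIV) (\<lambda>x. pmf p x * f x)"
    by (subst (asm) integrable_density) auto
  then have "Infinite_Set_Sum.abs_summable_on (\<lambda>x. pmf p x * f x) UNIV" by (simp add: abs_summable_on_def)
  then show ?thesis unfolding pmf_expectation_eq_infsetsum by (rule infsetsum_infsum)
qed

lemma measure_pmf_infsum: "measure (measure_pmf p) S = (\<Sum>\<^sub>\<infinity>x\<in>S. pmf p x)"
  unfolding measure_pmf_conv_infsetsum by (rule infsetsum_infsum) auto

locale eigen =
  fixes lam :: "nat \<Rightarrow> nat \<Rightarrow> real"
  assumes lam_nonneg: "\<And>j k. 1 \<le> j \<Longrightarrow> 1 \<le> k \<Longrightarrow> lam j k \<ge> 0"
    and lam_summable: "\<And>j. 1 \<le> j \<Longrightarrow> lam j summable_on {1..}"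
    and lam_pos: "\<And>j. 1 \<le> j \<Longrightarrow> lam j 1 > 0"
begin

lemma trace1_pos: assumes "1 \<le> j" shows "trace1 lam j > 0"
proof -
  have "sum (lam j) {1} \<le> infsum (lam j) {1..}"
    by (rule finite_sum_le_infsum[OF lam_summable[OF assms]]) (use lam_nonneg[OF assms] in auto)
  then show ?thesis using lam_pos[OF assms] by (simp add: trace1_def)
qed

lemma barlam_nonneg: "1 \<le> j \<Longrightarrow> 1 \<le> k \<Longrightarrow> 0 \<le> barlam lam j k"
  using lam_nonneg[of j k] trace1_pos[of j] by (simp add: barlam_def)

lemma barlam_has_sum: assumes "1 \<le> j" shows "(barlam lam j has_sum 1) {1..}"
proof -
  have "((\<lambda>k. (1 / trace1 lam j) * lam j k) has_sum (1 / trace1 lam j) * trace1 lam j) {1..}"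
    unfolding trace1_def by (intro has_sum_cmult_right has_sum_infsum lam_summable[OF assms])
  moreover have "(\<lambda>k. (1 / trace1 lam j) * lam j k) = barlam lam j" by (auto simp: fun_eq_iff barlam_def)
  ultimately show ?thesis using trace1_pos[OF assms] by simp
qed

text \<open>The normalised eigenvalues as probabilities of their indices; index 0 gets mass 0
  because eigenvalues are numbered from 1.\<close>

definition eigp :: "nat \<Rightarrow> nat pmf" where
  "eigp j = embed_pmf (\<lambda>k. if 1 \<le> k then barlam lam j k else 0)"

lemma pmf_eigp:
  assumes j: "1 \<le> j" shows "pmf (eigp j) k = (if 1 \<le> k then barlam lam j k else 0)"
  unfolding eigp_def
proof (rule pmf_embed_pmf)
  show "0 \<le> (if 1 \<le> k then barlam lam j k else 0)" for k using barlam_nonneg[OF j] by simp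
  have "((\<lambda>k. if 1 \<le> k then barlam lam j k else 0) has_sum 1) UNIV"
    using barlam_has_sum[OF j] by (subst has_sum_cong_neutral[where T="{1..}" and g="barlam lam j"]) auto
  then have s: "(\<lambda>k. if 1 \<le> k then barlam lam j k else 0) sums 1" by (rule has_sum_imp_sums)
  have "(\<integral>\<^sup>+k. ennreal (if 1 \<le> k then barlam lam j k else 0) \<partial>count_space UNIV) = (\<Sum>k. ennreal (if 1 \<le> k then barlam lam j k else 0))"
    by (rule nn_integral_count_space_nat)
  also have "\<dots> = ennreal (\<Sum>k. if 1 \<le> k then barlam lam j k else 0)"
    by (rule suminf_ennreal2) (use barlam_nonneg[OF j] sums_summable[OF s] in auto)
  also have "\<dots> = 1" using sums_unique[OF s] by simp
  finally show "(\<integral>\<^sup>+k. ennreal (if 1 \<le> k then barlam lam j k else 0) \<partial>count_space UNIV) = 1" .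
qed

lemma set_eigp:
  assumes j: "1 \<le> j" and "k \<in> set_pmf (eigp j)"
  shows "1 \<le> k" "0 < barlam lam j k" "barlam lam j k \<le> 1"
proof -
  have p: "pmf (eigp j) k > 0" using assms(2) by (simp add: pmf_positive_iff)
  then show k: "1 \<le> k" using pmf_eigp[OF j, of k] by (auto split: if_splits)
  show "0 < barlam lam j k" "barlam lam j k \<le> 1"
    using p pmf_le_1[of "eigp j" k] pmf_eigp[OF j, of k] k by auto
qed

lemma expectation_eigp:
  fixes f :: "nat \<Rightarrow> real"
  assumes j: "1 \<le> j" and "integrable (measure_pmf (eigp j)) f" and S: "\<And>k. 1 \<le> k \<Longrightarrow> k \<notin> S \<Longrightarrow> f k = 0 \<or> barlam lam j k = 0"
    and g: "\<And>k. k \<in> S \<Longrightarrow> 1 \<le> k \<Longrightarrow> g k = f k * barlam lam j k" and S1: "\<And>k. k \<in> S \<Longrightarrow> 1 \<le> k"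
  shows "E (eigp j) f = (\<Sum>\<^sub>\<infinity>k\<in>S. g k)"
  unfolding expectation_infsum[OF assms(2)]
  by (rule infsum_cong_neutral) (use S g S1 in \<open>auto simp: pmf_eigp[OF j] mult.commute\<close>)

definition Yv :: "nat \<Rightarrow> nat \<Rightarrow> real" where "Yv j k = - ln (barlam lam j k)"

lemma Yv_nonneg: "1 \<le> j \<Longrightarrow> k \<in> set_pmf (eigp j) \<Longrightarrow> 0 \<le> Yv j k"
  using set_eigp[of j k] by (simp add: Yv_def)

text \<open>The default \<open>undefined\<close> confines the support to extensional functions, in
  agreement with the \<open>PiE\<close> set \<open>multi_idx\<close>.\<close>

definition Pd :: "nat \<Rightarrow> (nat \<Rightarrow> nat) pmf" where "Pd d = Pi_pmf {1..d} undefined eigp"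

definition Ud :: "nat \<Rightarrow> (nat \<Rightarrow> nat) \<Rightarrow> real" where "Ud d \<kappa> = (\<Sum>j\<in>{1..d}. Yv j (\<kappa> j))"

definition trD :: "nat \<Rightarrow> real" where "trD d = (\<Prod>j\<in>{1..d}. trace1 lam j)"

lemma trD_pos: "trD d > 0"
  unfolding trD_def by (rule prod_pos) (use trace1_pos in auto)

lemma pmf_Pd:
  "pmf (Pd d) \<kappa> = (if \<kappa> \<in> multi_idx d then prod_eig lam d \<kappa> / trD d else 0)"
proof (cases "\<kappa> \<in> multi_idx d")
  case True
  then have k: "\<And>j. j \<in> {1..d} \<Longrightarrow> 1 \<le> \<kappa> j" "\<And>j. j \<notin> {1..d} \<Longrightarrow> \<kappa> j = undefined"
    by (auto simp: multi_idx_def PiE_iff extensional_def)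
  have "pmf (Pd d) \<kappa> = (\<Prod>j\<in>{1..d}. pmf (eigp j) (\<kappa> j))"
    unfolding Pd_def by (rule pmf_Pi') (use k in auto)
  also have "\<dots> = (\<Prod>j\<in>{1..d}. lam j (\<kappa> j) / trace1 lam j)"
    using k(1) by (intro prod.cong refl) (auto simp: pmf_eigp barlam_def)
  finally show ?thesis using True by (simp add: prod_eig_def trD_def prod_dividef)
next
  case False
  then consider j where "j \<in> {1..d}" "\<not> 1 \<le> \<kappa> j" | j where "j \<notin> {1..d}" "\<kappa> j \<noteq> undefined"
    by (auto simp: multi_idx_def PiE_iff extensional_def)
  then have "pmf (Pd d) \<kappa> = 0"
  proof cases
    case (1 j)
    then have "pmf (eigp j) (\<kappa> j) = 0" using pmf_eigp[of j "\<kappa> j"] by simp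
    then show ?thesis unfolding Pd_def pmf_Pi[OF finite_atLeastAtMost] using 1 by (auto intro!: prod_zero bexI[of _ j])
  next
    case (2 j)
    then show ?thesis unfolding Pd_def by (intro pmf_Pi_outside) auto
  qed
  then show ?thesis using False by simp
qed

lemma prod_eig_pmf: "\<kappa> \<in> multi_idx d \<Longrightarrow> prod_eig lam d \<kappa> = trD d * pmf (Pd d) \<kappa>"
  using trD_pos[of d] by (simp add: pmf_Pd)

text \<open>On the support every factor is positive and the logarithm of the product splits; at a
  vanishing eigenvalue the convention for \<open>ln 0\<close> would break the identity.\<close>

lemma Ud_eq:
  assumes "\<kappa> \<in> set_pmf (Pd d)" shows "Ud d \<kappa> = - ln (pmf (Pd d) \<kappa>)"
proof -
  have m: "\<kappa> \<in> PiE_dflt {1..d} undefined (set_pmf \<circ> eigp)"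
    using assms set_Pi_pmf_subset'[of "{1..d}" undefined eigp] by (auto simp: Pd_def)
  have s: "\<kappa> j \<in> set_pmf (eigp j)" if "j \<in> {1..d}" for j using m that by (auto simp: PiE_dflt_def)
  have "pmf (Pd d) \<kappa> = (\<Prod>j\<in>{1..d}. pmf (eigp j) (\<kappa> j))"
    unfolding Pd_def by (rule pmf_Pi') (use m in \<open>auto simp: PiE_dflt_def\<close>)
  also have "\<dots> = (\<Prod>j\<in>{1..d}. barlam lam j (\<kappa> j))"
    by (rule prod.cong) (use s set_eigp(1) in \<open>auto simp: pmf_eigp\<close>)
  finally have p: "pmf (Pd d) \<kappa> = (\<Prod>j\<in>{1..d}. barlam lam j (\<kappa> j))" .
  have "0 < barlam lam j (\<kappa> j)" if "j \<in> {1..d}" for j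
    by (rule set_eigp(2)[OF _ s[OF that]]) (use that in simp)
  then have "ln (\<Prod>j\<in>{1..d}. barlam lam j (\<kappa> j)) = (\<Sum>j\<in>{1..d}. ln (barlam lam j (\<kappa> j)))"
    by (intro ln_prod) force+
  then show ?thesis unfolding p Ud_def Yv_def by (simp add: sum_negf)
qed

lemma trace_d_eq: "trace_d lam d = trD d"
proof -
  have "trace_d lam d = (\<Sum>\<^sub>\<infinity>\<kappa>\<in>multi_idx d. trD d * pmf (Pd d) \<kappa>)"
    unfolding trace_d_def by (rule infsum_cong) (rule prod_eig_pmf)
  also have "\<dots> = trD d * measure (measure_pmf (Pd d)) (multi_idx d)"
    unfolding measure_pmf_infsum by (rule infsum_cmult_right')
  also have "measure (measure_pmf (Pd d)) (multi_idx d) = 1"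
    by (subst measure_pmf.prob_eq_1) (auto simp: AE_measure_pmf_iff set_pmf_iff pmf_Pd split: if_splits)
  finally show ?thesis by simp
qed

lemma sum_prod_eig:
  assumes "S \<subseteq> multi_idx d" "finite S"
  shows "(\<Sum>\<kappa>\<in>S. prod_eig lam d \<kappa>) = trD d * measure (measure_pmf (Pd d)) S"
proof -
  have "(\<Sum>\<kappa>\<in>S. prod_eig lam d \<kappa>) = (\<Sum>\<kappa>\<in>S. trD d * pmf (Pd d) \<kappa>)"
    using assms(1) by (intro sum.cong refl prod_eig_pmf) auto
  then show ?thesis using assms(2) by (simp add: measure_measure_pmf_finite sum_distrib_left)
qed

lemma top_sum_ge:
  assumes "S \<subseteq> multi_idx d" "finite S" "card S \<le> n"
  shows "trD d * measure (measure_pmf (Pd d)) S \<le> top_sum lam d n"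
  unfolding top_sum_def
proof (rule cSup_upper)
  show "trD d * measure (measure_pmf (Pd d)) S \<in> (\<lambda>S. \<Sum>\<kappa>\<in>S. prod_eig lam d \<kappa>) ` {S. S \<subseteq> multi_idx d \<and> finite S \<and> card S \<le> n}"
    using assms by (intro image_eqI[of _ _ S]) (auto simp: sum_prod_eig)
  show "bdd_above ((\<lambda>S. \<Sum>\<kappa>\<in>S. prod_eig lam d \<kappa>) ` {S. S \<subseteq> multi_idx d \<and> finite S \<and> card S \<le> n})"
    using trD_pos[of d] by (auto intro!: bdd_aboveI[of _ "trD d"] simp: sum_prod_eig mult_left_le)
qed

lemma top_sum_le:
  assumes "\<And>S. S \<subseteq> multi_idx d \<Longrightarrow> finite S \<Longrightarrow> card S \<le> n \<Longrightarrow> measure (measure_pmf (Pd d)) S \<le> B"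
  shows "top_sum lam d n \<le> trD d * B"
  unfolding top_sum_def
proof (rule cSup_least)
  show "(\<lambda>S. \<Sum>\<kappa>\<in>S. prod_eig lam d \<kappa>) ` {S. S \<subseteq> multi_idx d \<and> finite S \<and> card S \<le> n} \<noteq> {}"
    by (auto intro!: exI[of _ "{}"])
  fix x assume "x \<in> (\<lambda>S. \<Sum>\<kappa>\<in>S. prod_eig lam d \<kappa>) ` {S. S \<subseteq> multi_idx d \<and> finite S \<and> card S \<le> n}"
  then obtain S where S: "S \<subseteq> multi_idx d" "finite S" "card S \<le> n" "x = (\<Sum>\<kappa>\<in>S. prod_eig lam d \<kappa>)" by auto
  then show "x \<le> trD d * B" using assms[OF S(1-3)] trD_pos[of d] by (simp add: sum_prod_eig)
qed

lemma tail_d_le_iff: "tail_d lam d n \<le> e \<longleftrightarrow> trD d * (1 - e) \<le> top_sum lam d n"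
  using trD_pos[of d] by (simp add: tail_d_def trace_d_eq divide_le_eq algebra_simps)

text \<open>Probabilities of at least \<open>exp (- x)\<close> sum to at most 1, so a finite set of
  such multi-indices has at most \<open>exp x\<close> elements; finiteness of the whole set
  follows.\<close>

lemma large_prob_set:
  fixes d :: nat and x :: real
  defines "S \<equiv> {\<kappa>. exp (- x) \<le> pmf (Pd d) \<kappa>}"
  shows "finite S" "real (card S) \<le> exp x" "S \<subseteq> multi_idx d"
    "measure (measure_pmf (Pd d)) {\<kappa>. Ud d \<kappa> \<le> x} \<le> measure (measure_pmf (Pd d)) S"
proof -
  have fc: "real (card F) \<le> exp x" if F: "finite F" "F \<subseteq> S" for F
  proof -
    have "real (card F) * exp (- x) = (\<Sum>\<kappa>\<in>F. exp (- x))" by simp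
    also have "\<dots> \<le> (\<Sum>\<kappa>\<in>F. pmf (Pd d) \<kappa>)" using F by (intro sum_mono) (auto simp: S_def)
    also have "\<dots> = measure (measure_pmf (Pd d)) F" using F by (simp add: measure_measure_pmf_finite)
    also have "\<dots> \<le> 1" by simp
    finally show ?thesis by (simp add: exp_minus field_simps)
  qed
  show fS: "finite S"
  proof (rule ccontr)
    assume "infinite S"
    then obtain F where "finite F" "card F = nat \<lceil>exp x\<rceil> + 1" "F \<subseteq> S"
      using infinite_arbitrarily_large[of S] by blast
    with fc[of F] show False by linarith
  qed
  show "real (card S) \<le> exp x" by (rule fc[OF fS]) simp
  show "S \<subseteq> multi_idx d"
  proof
    fix \<kappa> assume "\<kappa> \<in> S"
    then have "exp (- x) \<le> pmf (Pd d) \<kappa>" by (simp add: S_def)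
    then have "pmf (Pd d) \<kappa> > 0" using exp_gt_zero[of "- x"] by linarith
    then show "\<kappa> \<in> multi_idx d" by (auto simp: pmf_Pd split: if_splits)
  qed
  show "measure (measure_pmf (Pd d)) {\<kappa>. Ud d \<kappa> \<le> x} \<le> measure (measure_pmf (Pd d)) S"
  proof (rule measure_pmf.finite_measure_mono_AE)
    show "AE \<kappa> in measure_pmf (Pd d). \<kappa> \<in> {\<kappa>. Ud d \<kappa> \<le> x} \<longrightarrow> \<kappa> \<in> S"
      unfolding AE_measure_pmf_iff
    proof (intro ballI impI)
      fix \<kappa> assume k: "\<kappa> \<in> set_pmf (Pd d)" "\<kappa> \<in> {\<kappa>. Ud d \<kappa> \<le> x}"
      have p: "pmf (Pd d) \<kappa> > 0" using k by (simp add: pmf_positive_iff)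
      have "- x \<le> ln (pmf (Pd d) \<kappa>)" using k Ud_eq[OF k(1)] by simp
      then have "exp (- x) \<le> exp (ln (pmf (Pd d) \<kappa>))" by simp
      then show "\<kappa> \<in> S" using p by (simp add: S_def)
    qed
  qed simp
qed

lemma tail_d_large_prob:
  assumes "1 - e \<le> measure (measure_pmf (Pd d)) {\<kappa>. Ud d \<kappa> \<le> x}"
  shows "tail_d lam d (card {\<kappa>. exp (- x) \<le> pmf (Pd d) \<kappa>}) \<le> e"
  unfolding tail_d_le_iff
proof -
  have "trD d * (1 - e) \<le> trD d * measure (measure_pmf (Pd d)) {\<kappa>. exp (- x) \<le> pmf (Pd d) \<kappa>}"
    using trD_pos[of d] assms large_prob_set(4)[of d x] by (intro mult_left_mono) auto
  also have "\<dots> \<le> top_sum lam d (card {\<kappa>. exp (- x) \<le> pmf (Pd d) \<kappa>})"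
    by (rule top_sum_ge[OF large_prob_set(3,1) order_refl])
  finally show "trD d * (1 - e) \<le> top_sum lam d (card {\<kappa>. exp (- x) \<le> pmf (Pd d) \<kappa>})" .
qed

lemma complexity_le:
  assumes "1 - \<epsilon>\<^sup>2 \<le> measure (measure_pmf (Pd d)) {\<kappa>. Ud d \<kappa> \<le> x}"
  shows "real (complexity lam d \<epsilon>) \<le> exp x"
proof -
  have "complexity lam d \<epsilon> \<le> card {\<kappa>. exp (- x) \<le> pmf (Pd d) \<kappa>}"
    unfolding complexity_def by (rule Least_le) (rule tail_d_large_prob[OF assms])
  then show ?thesis using large_prob_set(2)[of x d] by linarith
qed

text \<open>Among any \<open>n\<close> multi-indices, those with \<open>Ud d \<kappa> <= x\<close>
  are covered by the first term, and each of the others weighs at most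
  \<open>exp (- x)\<close>.\<close>

lemma complexity_ge:
  assumes \<epsilon>: "0 < \<epsilon>"
  shows "1 - \<epsilon>\<^sup>2 \<le> measure (measure_pmf (Pd d)) {\<kappa>. Ud d \<kappa> \<le> x} + real (complexity lam d \<epsilon>) * exp (- x)"
proof -
  let ?n = "complexity lam d \<epsilon>" and ?P = "measure (measure_pmf (Pd d))"
  \<comment> \<open>\<open>LeastI\<close> requires some admissible number of terms; it exists
    because the distribution function of \<open>Ud d\<close> tends to 1.\<close>
  let ?K = "distr (measure_pmf (Pd d)) borel (Ud d)"
  interpret K: real_distribution ?K
    by (rule prob_space.real_distribution_distr[OF prob_space_measure_pmf]) simp
  have "\<forall>\<^sub>F y in at_top. 1 - \<epsilon>\<^sup>2 < cdf ?K y"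
    by (rule order_tendstoD(1)[OF K.cdf_lim_at_top_prob]) (use \<epsilon> in simp)
  then obtain y where "1 - \<epsilon>\<^sup>2 < cdf ?K y" using eventually_happens' trivial_limit_at_top_linorder by blast
  moreover have "cdf ?K y = ?P {\<kappa>. Ud d \<kappa> \<le> y}"
    unfolding cdf_def by (subst measure_distr) (auto intro!: arg_cong2[of _ _ _ _ Sigma_Algebra.measure])
  ultimately have "tail_d lam d (card {\<kappa>. exp (- y) \<le> pmf (Pd d) \<kappa>}) \<le> \<epsilon>\<^sup>2"
    by (intro tail_d_large_prob) simp
  then have "tail_d lam d ?n \<le> \<epsilon>\<^sup>2" unfolding complexity_def by (rule LeastI)
  then have 1: "trD d * (1 - \<epsilon>\<^sup>2) \<le> top_sum lam d ?n" unfolding tail_d_le_iff .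
  have "top_sum lam d ?n \<le> trD d * (?P {\<kappa>. Ud d \<kappa> \<le> x} + real ?n * exp (- x))"
  proof (rule top_sum_le)
    fix S assume S: "S \<subseteq> multi_idx d" "finite S" "card S \<le> ?n"
    let ?T = "S \<inter> {\<kappa>. pmf (Pd d) \<kappa> \<le> exp (- x)}"
    have "?P S \<le> ?P ({\<kappa>. Ud d \<kappa> \<le> x} \<union> ?T)"
    proof (rule measure_pmf.finite_measure_mono_AE)
      show "AE \<kappa> in measure_pmf (Pd d). \<kappa> \<in> S \<longrightarrow> \<kappa> \<in> {\<kappa>. Ud d \<kappa> \<le> x} \<union> ?T"
        unfolding AE_measure_pmf_iff
      proof (intro ballI impI)
        fix \<kappa> assume k: "\<kappa> \<in> set_pmf (Pd d)" "\<kappa> \<in> S"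
        show "\<kappa> \<in> {\<kappa>. Ud d \<kappa> \<le> x} \<union> ?T"
        proof (cases "Ud d \<kappa> \<le> x")
          case False
          have p: "pmf (Pd d) \<kappa> > 0" using k by (simp add: pmf_positive_iff)
          have "ln (pmf (Pd d) \<kappa>) < - x" using False Ud_eq[OF k(1)] by simp
          then have "exp (ln (pmf (Pd d) \<kappa>)) < exp (- x)" by (simp only: exp_less_cancel_iff)
          then show ?thesis using p k by simp
        qed simp
      qed
    qed simp
    also have "\<dots> \<le> ?P {\<kappa>. Ud d \<kappa> \<le> x} + ?P ?T" by (rule measure_Un_le) auto
    also have "?P ?T = (\<Sum>\<kappa>\<in>?T. pmf (Pd d) \<kappa>)" using S by (intro measure_measure_pmf_finite) auto
    also have "\<dots> \<le> (\<Sum>\<kappa>\<in>?T. exp (- x))" by (intro sum_mono) auto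
    also have "\<dots> = real (card ?T) * exp (- x)" by simp
    also have "\<dots> \<le> real ?n * exp (- x)"
    proof (rule mult_right_mono)
      have "card ?T \<le> card S" using S by (intro card_mono) auto
      then show "real (card ?T) \<le> real ?n" using S by simp
    qed simp
    finally show "?P S \<le> ?P {\<kappa>. Ud d \<kappa> \<le> x} + real ?n * exp (- x)" by simp
  qed
  then have "trD d * (1 - \<epsilon>\<^sup>2) \<le> trD d * (?P {\<kappa>. Ud d \<kappa> \<le> x} + real ?n * exp (- x))" using 1 by linarith
  then show ?thesis using trD_pos[of d] by simp
qed

text \<open>As \<open>Ud\<close> is nonnegative on the support, complexity 0 would turn
  \<open>complexity_ge\<close> at \<open>x = -1\<close> into
  \<open>1 - \<epsilon>\<^sup>2 <= 0\<close>. Positivity lets \<open>exp\<close> undo the logarithm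
  of the complexity.\<close>

lemma complexity_pos:
  assumes "0 < \<epsilon>" "\<epsilon> < 1"
  shows "0 < complexity lam d \<epsilon>"
proof (rule ccontr)
  assume "\<not> 0 < complexity lam d \<epsilon>"
  then have z: "complexity lam d \<epsilon> = 0" by simp
  have "measure (measure_pmf (Pd d)) {\<kappa>. Ud d \<kappa> \<le> - 1} = 0"
  proof (subst measure_pmf.prob_eq_0)
    show "AE \<kappa> in measure_pmf (Pd d). \<kappa> \<notin> {\<kappa>. Ud d \<kappa> \<le> - 1}"
      unfolding AE_measure_pmf_iff
    proof
      fix \<kappa> assume k: "\<kappa> \<in> set_pmf (Pd d)"
      have "0 < pmf (Pd d) \<kappa>" "pmf (Pd d) \<kappa> \<le> 1" using k by (auto simp: pmf_positive_iff pmf_le_1)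
      then have "ln (pmf (Pd d) \<kappa>) \<le> 0" by (simp add: ln_le_zero_iff)
      then show "\<kappa> \<notin> {\<kappa>. Ud d \<kappa> \<le> - 1}" using Ud_eq[OF k] by simp
    qed
  qed simp
  then have "1 - \<epsilon>\<^sup>2 \<le> 0" using complexity_ge[OF assms(1), of d "- 1"] z by simp
  moreover have "\<epsilon>\<^sup>2 < 1" using assms by (simp add: power_less_one_iff)
  ultimately show False by simp
qed

end

section \<open>Truncation of the spectrum\<close>

text \<open>The index from which \<open>X d \<tau>\<close> is close to \<open>s\<close> may depend
  on \<open>\<tau>\<close>; this order of quantifiers is the content of the two iterated
  limits.\<close>

lemma limsup_liminf_tendsto_iff:
  fixes X :: "nat \<Rightarrow> real \<Rightarrow> real"
  shows "((\<lambda>\<tau>. limsup (\<lambda>d. ereal (X d \<tau>))) \<longlongrightarrow> ereal s) (at_right 0)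
      \<and> ((\<lambda>\<tau>. liminf (\<lambda>d. ereal (X d \<tau>))) \<longlongrightarrow> ereal s) (at_right 0)
    \<longleftrightarrow> (\<forall>e>0. \<exists>\<tau>0>0. \<forall>\<tau>. 0 < \<tau> \<and> \<tau> < \<tau>0 \<longrightarrow> (\<forall>\<^sub>F d in sequentially. \<bar>X d \<tau> - s\<bar> \<le> e))"
    (is "?S \<and> ?I \<longleftrightarrow> ?C")
proof
  assume h: "?S \<and> ?I"
  show ?C
  proof (intro allI impI)
    fix e :: real assume e: "e > 0"
    have "\<forall>\<^sub>F \<tau> in at_right 0. limsup (\<lambda>d. ereal (X d \<tau>)) < ereal (s + e)"
      using h e by (intro order_tendstoD(2)[OF conjunct1[OF h]]) simp
    moreover have "\<forall>\<^sub>F \<tau> in at_right 0. ereal (s - e) < liminf (\<lambda>d. ereal (X d \<tau>))"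
      using h e by (intro order_tendstoD(1)[OF conjunct2[OF h]]) simp
    ultimately have "\<forall>\<^sub>F \<tau> in at_right 0. limsup (\<lambda>d. ereal (X d \<tau>)) < ereal (s + e) \<and> ereal (s - e) < liminf (\<lambda>d. ereal (X d \<tau>))"
      by (rule eventually_conj)
    then obtain \<tau>0 where \<tau>0: "\<tau>0 > 0" "\<And>\<tau>. 0 < \<tau> \<Longrightarrow> \<tau> < \<tau>0 \<Longrightarrow> limsup (\<lambda>d. ereal (X d \<tau>)) < ereal (s + e) \<and> ereal (s - e) < liminf (\<lambda>d. ereal (X d \<tau>))"
      unfolding eventually_at_right_field by blast
    have "\<forall>\<^sub>F d in sequentially. \<bar>X d \<tau> - s\<bar> \<le> e" if t: "0 < \<tau>" "\<tau> < \<tau>0" for \<tau>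
    proof -
      have "\<forall>\<^sub>F d in sequentially. ereal (X d \<tau>) < ereal (s + e)"
        using \<tau>0(2)[OF t] by (intro Limsup_lessD) simp
      moreover have "\<forall>\<^sub>F d in sequentially. ereal (s - e) < ereal (X d \<tau>)"
        using \<tau>0(2)[OF t] by (intro less_LiminfD) simp
      ultimately show ?thesis by eventually_elim (simp add: abs_le_iff)
    qed
    then show "\<exists>\<tau>0>0. \<forall>\<tau>. 0 < \<tau> \<and> \<tau> < \<tau>0 \<longrightarrow> (\<forall>\<^sub>F d in sequentially. \<bar>X d \<tau> - s\<bar> \<le> e)"
      using \<tau>0(1) by blast
  qed
next
  assume C: ?C
  have bounds: "\<forall>\<^sub>F \<tau> in at_right 0. limsup (\<lambda>d. ereal (X d \<tau>)) \<le> ereal (s + e) \<and> ereal (s - e) \<le> liminf (\<lambda>d. ereal (X d \<tau>))"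
    if e: "e > 0" for e
  proof -
    obtain \<tau>0 where \<tau>0: "\<tau>0 > 0" "\<And>\<tau>. 0 < \<tau> \<Longrightarrow> \<tau> < \<tau>0 \<Longrightarrow> \<forall>\<^sub>F d in sequentially. \<bar>X d \<tau> - s\<bar> \<le> e"
      using C e by blast
    show ?thesis
      unfolding eventually_at_right_field
    proof (intro exI[of _ \<tau>0] conjI allI impI \<tau>0(1))
      fix \<tau> assume t: "0 < \<tau>" "\<tau> < \<tau>0"
      show "limsup (\<lambda>d. ereal (X d \<tau>)) \<le> ereal (s + e)"
        by (rule Limsup_bounded) (use \<tau>0(2)[OF t] in \<open>eventually_elim, simp add: abs_le_iff\<close>)
      show "ereal (s - e) \<le> liminf (\<lambda>d. ereal (X d \<tau>))"
        by (rule Liminf_bounded) (use \<tau>0(2)[OF t] in \<open>eventually_elim, simp add: abs_le_iff\<close>)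
    qed
  qed
  have le: "liminf (\<lambda>d. ereal (X d \<tau>)) \<le> limsup (\<lambda>d. ereal (X d \<tau>))" for \<tau>
    by (rule Liminf_le_Limsup) simp
  have up: "\<exists>e>0. ereal (s + e) < u" if "ereal s < u" for u
  proof -
    obtain r where "ereal s < ereal r" "ereal r < u" using ereal_dense2[OF \<open>ereal s < u\<close>] by blast
    then show ?thesis by (intro exI[of _ "r - s"]) auto
  qed
  have dn: "\<exists>e>0. u < ereal (s - e)" if "u < ereal s" for u
  proof -
    obtain r where "u < ereal r" "ereal r < ereal s" using ereal_dense2[OF \<open>u < ereal s\<close>] by blast
    then show ?thesis by (intro exI[of _ "s - r"]) auto
  qed
  have up': "\<forall>\<^sub>F \<tau> in at_right 0. limsup (\<lambda>d. ereal (X d \<tau>)) < u" if u: "ereal s < u" for u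
  proof -
    obtain e where e: "e > 0" "ereal (s + e) < u" using up[OF u] by blast
    show ?thesis using bounds[OF e(1)] by eventually_elim (use e(2) le_less_trans in blast)
  qed
  have dn': "\<forall>\<^sub>F \<tau> in at_right 0. u < liminf (\<lambda>d. ereal (X d \<tau>))" if u: "u < ereal s" for u
  proof -
    obtain e where e: "e > 0" "u < ereal (s - e)" using dn[OF u] by blast
    show ?thesis using bounds[OF e(1)] by eventually_elim (use e(2) less_le_trans in blast)
  qed
  have ?S
  proof (rule order_tendstoI)
    show "\<forall>\<^sub>F \<tau> in at_right 0. u < limsup (\<lambda>d. ereal (X d \<tau>))" if "u < ereal s" for u
      using dn'[OF that] by eventually_elim (use le less_le_trans in blast)
  qed (rule up')
  moreover have ?I
  proof (rule order_tendstoI)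
    show "\<forall>\<^sub>F \<tau> in at_right 0. liminf (\<lambda>d. ereal (X d \<tau>)) < u" if "ereal s < u" for u
      using up'[OF that] by eventually_elim (use le le_less_trans in blast)
  qed (rule dn')
  ultimately show "?S \<and> ?I" by simp
qed

lemma pchar_scale: "pchar (map_pmf (\<lambda>k. g k / c) p) t = pchar (map_pmf g p) (t / c)"
  by (simp add: pchar_def integral_map_pmf)

lemma pchar_scale_tendsto:
  assumes "filterlim b at_top sequentially"
  shows "(\<lambda>d. pchar (map_pmf (\<lambda>k. g k / b d) p) t) \<longlonglongrightarrow> 1"
proof -
  have "(\<lambda>d. t / b d) \<longlonglongrightarrow> 0"
    by (rule tendsto_divide_0[OF tendsto_const filterlim_at_top_imp_at_infinity[OF assms]])
  from isCont_tendsto_compose[OF isCont_pchar this]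
  have "(\<lambda>d. pchar (map_pmf g p) (t / b d)) \<longlonglongrightarrow> pchar (map_pmf g p) 0" .
  moreover have "pchar (map_pmf g p) 0 = 1" by (simp add: pchar_def)
  ultimately show ?thesis unfolding pchar_scale by simp
qed

context eigen
begin

text \<open>Indices beyond \<open>N\<close> keep their probability but get the value 0, so the law
  stays a probability while they drop out of tails at positive levels and of truncated
  moments.\<close>

definition Yt :: "enat \<Rightarrow> nat \<Rightarrow> nat \<Rightarrow> real" where
  "Yt N j k = (if enat k \<le> N then Yv j k else 0)"

definition Qa :: "enat \<Rightarrow> real \<Rightarrow> nat \<Rightarrow> real pmf" where
  "Qa N c j = (if 1 \<le> j then map_pmf (\<lambda>k. Yt N j k / c) (eigp j) else return_pmf 0)"

lemma Yt_nonneg: "1 \<le> j \<Longrightarrow> k \<in> set_pmf (eigp j) \<Longrightarrow> 0 \<le> Yt N j k"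
  using Yv_nonneg by (simp add: Yt_def)

lemma Qa_nonneg: "c > 0 \<Longrightarrow> x \<in> set_pmf (Qa N c j) \<Longrightarrow> 0 \<le> x"
  using Yt_nonneg by (auto simp: Qa_def split: if_splits)

lemma barlam_le_1: "1 \<le> j \<Longrightarrow> 1 \<le> k \<Longrightarrow> barlam lam j k \<le> 1"
  using pmf_le_1[of "eigp j" k] pmf_eigp[of j k] by simp

lemma Yv_less_iff:
  assumes "c > 0" "0 < barlam lam j k"
  shows "x < Yv j k / c \<longleftrightarrow> barlam lam j k < exp (- x * c)"
proof -
  have "x < Yv j k / c \<longleftrightarrow> ln (barlam lam j k) < - x * c"
    unfolding Yv_def pos_less_divide_eq[OF assms(1)] by auto
  also have "\<dots> \<longleftrightarrow> exp (ln (barlam lam j k)) < exp (- x * c)" by (simp only: exp_less_cancel_iff)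
  finally show ?thesis using assms(2) by simp
qed

lemma tailp_Qa:
  assumes j: "1 \<le> j" and c: "c > 0" and x: "x > 0"
  shows "tailp (Qa N c j) x = (\<Sum>\<^sub>\<infinity>k\<in>{k. 1 \<le> k \<and> enat k \<le> N}. (if barlam lam j k < exp (- x * c) then barlam lam j k else 0))"
proof -
  have "tailp (Qa N c j) x = E (eigp j) (\<lambda>k. indicator {x<..} (Yt N j k / c))"
  proof -
    have "Qa N c j = map_pmf (\<lambda>k. Yt N j k / c) (eigp j)" using j by (simp add: Qa_def)
    then show ?thesis unfolding tailp_eq by (simp only: integral_map_pmf)
  qed
  also have "\<dots> = (\<Sum>\<^sub>\<infinity>k\<in>{k. 1 \<le> k \<and> enat k \<le> N}. (if barlam lam j k < exp (- x * c) then barlam lam j k else 0))"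
  proof (rule expectation_eigp[OF j])
    show "integrable (measure_pmf (eigp j)) (\<lambda>k. indicator {x<..} (Yt N j k / c) :: real)"
      by (rule integrable_measure_pmf_bounded[of _ _ 1]) (simp add: indicator_def)
    show "indicator {x<..} (Yt N j k / c) = (0::real) \<or> barlam lam j k = 0"
      if "1 \<le> k" "k \<notin> {k. 1 \<le> k \<and> enat k \<le> N}" for k
      using that x by (simp add: Yt_def)
    show "(if barlam lam j k < exp (- x * c) then barlam lam j k else 0) = indicator {x<..} (Yt N j k / c) * barlam lam j k"
      if k: "k \<in> {k. 1 \<le> k \<and> enat k \<le> N}" "1 \<le> k" for k
    proof (cases "barlam lam j k = 0")
      case False
      then have "0 < barlam lam j k" using barlam_nonneg[OF j k(2)] by linarith
      from Yv_less_iff[OF c this, of x] show ?thesis using k by (simp add: Yt_def indicator_def)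
    qed simp
  qed simp
  finally show ?thesis .
qed

lemma Mfun_eq:
  assumes j: "1 \<le> j" and c: "c > 0" and \<tau>: "\<tau> > 0" and q: "q > 0"
  shows "Mfun lam q N j (\<tau> * c) = E (eigp j) (\<lambda>k. indicator {..\<tau>} (Yt N j k / c) * Yt N j k ^ q)"
  unfolding Mfun_def
proof (rule expectation_eigp[OF j, symmetric])
  show "integrable (measure_pmf (eigp j)) (\<lambda>k. indicator {..\<tau>} (Yt N j k / c) * Yt N j k ^ q)"
  proof (rule integrable_measure_pmf_bounded[of _ _ "(\<tau> * c) ^ q"])
    fix k assume k: "k \<in> set_pmf (eigp j)"
    have n: "0 \<le> Yt N j k" by (rule Yt_nonneg[OF j k])
    show "norm (indicator {..\<tau>} (Yt N j k / c) * Yt N j k ^ q) \<le> (\<tau> * c) ^ q"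
    proof (cases "Yt N j k / c \<le> \<tau>")
      case True
      then have "Yt N j k \<le> \<tau> * c" using c by (simp add: divide_le_eq)
      then show ?thesis using True n power_mono[of "Yt N j k" "\<tau> * c" q] by simp
    qed (use c \<tau> in simp)
  qed
  show "indicator {..\<tau>} (Yt N j k / c) * Yt N j k ^ q = 0 \<or> barlam lam j k = 0"
    if "1 \<le> k" "k \<notin> {k. 1 \<le> k \<and> enat k \<le> N}" for k
    using that q by (simp add: Yt_def)
  show "(if exp (- (\<tau> * c)) \<le> barlam lam j k then \<bar>ln (barlam lam j k)\<bar> ^ q * barlam lam j k else 0)
      = indicator {..\<tau>} (Yt N j k / c) * Yt N j k ^ q * barlam lam j k"
    if k: "k \<in> {k. 1 \<le> k \<and> enat k \<le> N}" "1 \<le> k" for k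
  proof (cases "barlam lam j k = 0")
    case False
    then have p: "0 < barlam lam j k" using barlam_nonneg[OF j k(2)] by linarith
    have "ln (barlam lam j k) \<le> 0" using p barlam_le_1[OF j k(2)] by (simp add: ln_le_zero_iff)
    then have a: "\<bar>ln (barlam lam j k)\<bar> = Yt N j k" using k by (simp add: Yt_def Yv_def)
    have "exp (- (\<tau> * c)) \<le> barlam lam j k \<longleftrightarrow> Yt N j k / c \<le> \<tau>"
      using Yv_less_iff[OF c p, of \<tau>] k by (simp add: Yt_def not_less[symmetric])
    then show ?thesis unfolding a by (simp add: indicator_def)
  qed simp
qed simp

lemma trm1_Qa: "1 \<le> j \<Longrightarrow> c > 0 \<Longrightarrow> \<tau> > 0 \<Longrightarrow> trm1 (Qa N c j) \<tau> = Mfun lam 1 N j (\<tau> * c) / c"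
  by (simp add: Mfun_eq trm1_def Qa_def integral_map_pmf)

lemma trm2_Qa: "1 \<le> j \<Longrightarrow> c > 0 \<Longrightarrow> \<tau> > 0 \<Longrightarrow> trm2 (Qa N c j) \<tau> = Mfun lam 2 N j (\<tau> * c) / c\<^sup>2"
  by (simp add: Mfun_eq trm2_def Qa_def integral_map_pmf power_divide)

lemma trvar_Qa:
  "1 \<le> j \<Longrightarrow> c > 0 \<Longrightarrow> \<tau> > 0 \<Longrightarrow> trvar (Qa N c j) \<tau> = (Mfun lam 2 N j (\<tau> * c) - (Mfun lam 1 N j (\<tau> * c))\<^sup>2) / c\<^sup>2"
  by (simp add: trvar_def trm1_Qa trm2_Qa power_divide diff_divide_distrib)

lemma norm_pchar_truncation_le:
  assumes j: "1 \<le> j"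
  shows "norm (pchar (map_pmf (\<lambda>k. Yv j k / c) (eigp j)) t - pchar (Qa N c j) t)
    \<le> 2 * (\<Sum>\<^sub>\<infinity>k\<in>{k. N < enat k}. barlam lam j k)"
proof -
  let ?f = "\<lambda>k. iexp (t * (Yv j k / c)) - iexp (t * (Yt N j k / c))"
  have "pchar (map_pmf (\<lambda>k. Yv j k / c) (eigp j)) t - pchar (Qa N c j) t
     = E (eigp j) (\<lambda>k. iexp (t * (Yv j k / c))) - E (eigp j) (\<lambda>k. iexp (t * (Yt N j k / c)))"
    using j by (simp add: pchar_def Qa_def integral_map_pmf)
  moreover have "\<dots> = E (eigp j) ?f"
    by (rule Bochner_Integration.integral_diff[symmetric]) (rule integrable_iexp_pmf)+
  moreover have "norm (E (eigp j) ?f) \<le> E (eigp j) (\<lambda>k. 2 * indicator {k. N < enat k} k)"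
  proof (rule norm_expectation_le)
    show "integrable (measure_pmf (eigp j)) (\<lambda>k. 2 * indicator {k. N < enat k} k :: real)"
      by (rule integrable_measure_pmf_bounded[of _ _ 2]) (simp add: indicator_def)
    show "norm (?f k) \<le> 2 * indicator {k. N < enat k} k" for k
    proof (cases "enat k \<le> N")
      case False
      have "norm (?f k) \<le> norm (iexp (t * (Yv j k / c))) + norm (iexp (t * (Yt N j k / c)))"
        by (rule norm_triangle_ineq4)
      then show ?thesis using False by (simp add: not_le)
    qed (simp add: Yt_def)
  qed
  moreover have "E (eigp j) (\<lambda>k. 2 * indicator {k. N < enat k} k) = 2 * measure (measure_pmf (eigp j)) {k. N < enat k}"
    by simp
  moreover have "measure (measure_pmf (eigp j)) {k. N < enat k} = (\<Sum>\<^sub>\<infinity>k\<in>{k. N < enat k}. barlam lam j k)"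
    unfolding measure_pmf_infsum
  proof (rule infsum_cong)
    fix k assume k: "k \<in> {k. N < enat k}"
    have "k \<noteq> 0"
    proof
      assume "k = 0"
      then show False using k by (simp add: zero_enat_def[symmetric])
    qed
    then show "pmf (eigp j) k = barlam lam j k" using pmf_eigp[OF j, of k] by simp
  qed
  ultimately show ?thesis by simp
qed

text \<open>For fixed \<open>j\<close> both factors tend to 1 because \<open>b d\<close> tends to
  infinity, and their differences are dominated by twice the summable spectral tails. Tannery's
  theorem sends the sum of the differences to 0, and with it the difference of the products.\<close>

lemma truncation_negligible:
  fixes b :: "nat \<Rightarrow> real"
  assumes b: "\<forall>d. b d > 0" "filterlim b at_top sequentially"
    and N: "(\<lambda>j. \<Sum>\<^sub>\<infinity>k\<in>{k. N < enat k}. barlam lam j k) summable_on {1..}"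
  shows "(\<lambda>d. (\<Prod>j=1..d. pchar (map_pmf (\<lambda>k. Yv j k / b d) (eigp j)) t) - (\<Prod>j=1..d. pchar (Qa N (b d) j) t)) \<longlonglongrightarrow> 0"
proof -
  define s where "s j = (if 1 \<le> j then 2 * (\<Sum>\<^sub>\<infinity>k\<in>{k. N < enat k}. barlam lam j k) else 0)" for j
  define f where "f j d = (if 1 \<le> j \<and> j \<le> d then norm (pchar (map_pmf (\<lambda>k. Yv j k / b d) (eigp j)) t - pchar (Qa N (b d) j) t) else 0)" for j d
  have "(\<lambda>j. 2 * (\<Sum>\<^sub>\<infinity>k\<in>{k. N < enat k}. barlam lam j k)) summable_on {1..}"
    by (rule summable_on_cmult_right[OF N])
  then have "s summable_on UNIV"
    by (subst summable_on_cong_neutral[where T="{1..}" and g="\<lambda>j. 2 * (\<Sum>\<^sub>\<infinity>k\<in>{k. N < enat k}. barlam lam j k)"]) (auto simp: s_def)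
  then have ss: "summable s" by (intro sums_summable[OF has_sum_imp_sums[OF has_sum_infsum]])
  have fs: "norm (f j d) \<le> s j" for j d
  proof (cases "1 \<le> j \<and> j \<le> d")
    case True
    then show ?thesis using norm_pchar_truncation_le[of j "b d" t N] by (simp add: f_def s_def)
  next
    case False
    have "0 \<le> s j"
      using order_trans[OF norm_ge_zero norm_pchar_truncation_le[of j 1 t N]] by (simp add: s_def)
    then show ?thesis unfolding f_def if_not_P[OF False] by simp
  qed
  have f0: "(\<lambda>d. f j d) \<longlonglongrightarrow> 0" for j
  proof (cases "1 \<le> j")
    case True
    have "(\<lambda>d. norm (pchar (map_pmf (\<lambda>k. Yv j k / b d) (eigp j)) t - pchar (Qa N (b d) j) t)) \<longlonglongrightarrow> norm (1 - 1 :: complex)"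
      using True unfolding Qa_def by (simp only: if_True) (intro tendsto_norm tendsto_diff pchar_scale_tendsto b)
    moreover have "\<forall>\<^sub>F d in sequentially. norm (pchar (map_pmf (\<lambda>k. Yv j k / b d) (eigp j)) t - pchar (Qa N (b d) j) t) = f j d"
      using eventually_ge_at_top[of j] by eventually_elim (use True in \<open>simp add: f_def\<close>)
    ultimately have "(\<lambda>d. f j d) \<longlonglongrightarrow> norm (1 - 1 :: complex)" by (rule Lim_transform_eventually)
    then show ?thesis by simp
  next
    case False
    then have "f j = (\<lambda>d. 0)" by (auto simp: f_def fun_eq_iff)
    then show ?thesis by simp
  qed
  have "(\<lambda>d. suminf (\<lambda>j. f j d)) \<longlonglongrightarrow> suminf (\<lambda>j. 0 :: real)"
  proof -
    have "\<forall>\<^sub>F (k, n) in sequentially \<times>\<^sub>F sequentially. norm (f k n) \<le> s k"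
      by (rule always_eventually) (use fs in auto)
    from tannerys_theorem[OF f0 this ss sequentially_bot] show ?thesis by blast
  qed
  moreover have "suminf (\<lambda>j. f j d) = (\<Sum>j=1..d. f j d)" for d
    by (rule suminf_finite) (auto simp: f_def)
  ultimately have lim: "(\<lambda>d. \<Sum>j=1..d. f j d) \<longlonglongrightarrow> 0" by simp
  show ?thesis
  proof (rule Lim_null_comparison[OF _ lim], intro always_eventually allI)
    fix d
    have "norm ((\<Prod>j=1..d. pchar (map_pmf (\<lambda>k. Yv j k / b d) (eigp j)) t) - (\<Prod>j=1..d. pchar (Qa N (b d) j) t))
      \<le> (\<Sum>j=1..d. norm (pchar (map_pmf (\<lambda>k. Yv j k / b d) (eigp j)) t - pchar (Qa N (b d) j) t))"
      by (rule norm_prod_diff_le) (auto intro: norm_pchar_le)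
    also have "\<dots> = (\<Sum>j=1..d. f j d)" by (rule sum.cong) (auto simp: f_def)
    finally show "norm ((\<Prod>j=1..d. pchar (map_pmf (\<lambda>k. Yv j k / b d) (eigp j)) t) - (\<Prod>j=1..d. pchar (Qa N (b d) j) t))
      \<le> (\<Sum>j=1..d. f j d)" .
  qed
qed

definition Vd :: "real \<Rightarrow> real \<Rightarrow> nat \<Rightarrow> real pmf" where
  "Vd a b d = map_pmf (\<lambda>\<kappa>. Ud d \<kappa> / b - a / b) (Pd d)"

lemma cdf_Vd: "b > 0 \<Longrightarrow> cdf (pmf_law (Vd a b d)) y = measure (measure_pmf (Pd d)) {\<kappa>. Ud d \<kappa> \<le> a + y * b}"
proof -
  assume b: "b > 0"
  have "Ud d \<kappa> / b - a / b \<le> y \<longleftrightarrow> Ud d \<kappa> \<le> a + y * b" for \<kappa>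
  proof -
    have "Ud d \<kappa> / b - a / b = (Ud d \<kappa> - a) / b" by (simp add: diff_divide_distrib)
    then show ?thesis using b by (simp add: divide_le_eq algebra_simps)
  qed
  then have "(\<lambda>\<kappa>. Ud d \<kappa> / b - a / b) -` {..y} = {\<kappa>. Ud d \<kappa> \<le> a + y * b}" by auto
  moreover have "cdf (pmf_law (Vd a b d)) y = measure (measure_pmf (Vd a b d)) {..y}"
    unfolding cdf_def by (subst measure_distr) (auto simp: vimage_def)
  ultimately show ?thesis by (simp add: Vd_def measure_map_pmf)
qed

lemma pchar_Vd: "pchar (Vd a b d) t = (\<Prod>j=1..d. pchar (map_pmf (\<lambda>k. Yv j k / b) (eigp j)) t) * iexp (t * (- a / b))"
proof -
  have "Vd a b d = map_pmf (\<lambda>\<kappa>. (\<Sum>j\<in>{1..d}. Yv j (\<kappa> j) / b) + - a / b) (Pi_pmf {1..d} undefined eigp)"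
    unfolding Vd_def Pd_def Ud_def by (simp add: sum_divide_distrib)
  then show ?thesis using pchar_sum_Pi_pmf[of "{1..d}" "\<lambda>j k. Yv j k / b" "- a / b" undefined eigp t] by simp
qed

end

theorem theorem3:
  fixes lam :: "nat \<Rightarrow> nat \<Rightarrow> real"
    and a b :: "nat \<Rightarrow> real"
    and M :: "real measure" and \<gamma> \<sigma>2 :: real and L :: "real \<Rightarrow> real" and \<nu> :: "real measure"
    and q :: "real \<Rightarrow> real" and N :: enat
  assumes lam_nonneg: "\<forall>j\<ge>1. \<forall>k\<ge>1. lam j k \<ge> 0"
    and lam_mono: "\<forall>j\<ge>1. \<forall>k\<ge>1. lam j (Suc k) \<le> lam j k"
    and lam_summable: "\<forall>j\<ge>1. lam j summable_on {1..}"
    and lam_pos: "\<forall>j\<ge>1. lam j 1 > 0"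
    and b_pos: "\<forall>d. b d > 0"
    and b_lim: "filterlim b at_top sequentially"
    and G_sd: "self_decomposable M"
    and G_levy: "levy_triplet M \<gamma> \<sigma>2 L \<nu>"
    and q_mono: "antimono_on {0<..<1} q"
    and q_def: "\<forall>\<epsilon>\<in>{0<..<1}. q \<epsilon> = gen_inv (cdf M) (1 - \<epsilon>\<^sup>2)"
    and small: "\<forall>\<tau>>0. (\<lambda>d. Max ((\<lambda>j. \<Sum>\<^sub>\<infinity>k\<in>{1..}.
                  (if barlam lam j k < exp (- \<tau> * b d) then barlam lam j k else 0)) ` {1..d}))
                \<longlonglongrightarrow> 0"
    and N_cond: "(\<lambda>j. \<Sum>\<^sub>\<infinity>k\<in>{k. N < enat k}. barlam lam j k) summable_on {1..}"
  shows "(\<forall>\<epsilon>\<in>{0<..<1}.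
            (\<lambda>d. ln (real (complexity lam d \<epsilon>)) - a d - q \<epsilon> * b d) \<in> o(b))
     \<longleftrightarrow>
         (\<forall>x>0. (\<lambda>d. \<Sum>j=1..d. \<Sum>\<^sub>\<infinity>k\<in>{k. 1 \<le> k \<and> enat k \<le> N}.
                   (if barlam lam j k < exp (- x * b d) then barlam lam j k else 0))
                 \<longlonglongrightarrow> - L x)
       \<and> (\<forall>\<tau>>0. (\<lambda>d. ((\<Sum>j=1..d. Mfun lam 1 N j (\<tau> * b d)) - a d) / b d)
                 \<longlonglongrightarrow> \<gamma> + (LINT x:{0<..\<tau>}|\<nu>. x ^ 3 / (1 + x\<^sup>2))
                       - (LINT x:{\<tau><..}|\<nu>. x / (1 + x\<^sup>2)))
       \<and> ((\<lambda>\<tau>. limsup (\<lambda>d. ereal ((\<Sum>j=1..d. Mfun lam 2 N j (\<tau> * b d)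
                     - (Mfun lam 1 N j (\<tau> * b d))\<^sup>2) / (b d)\<^sup>2)))
             \<longlongrightarrow> ereal \<sigma>2) (at_right 0)
       \<and> ((\<lambda>\<tau>. liminf (\<lambda>d. ereal ((\<Sum>j=1..d. Mfun lam 2 N j (\<tau> * b d)
                     - (Mfun lam 1 N j (\<tau> * b d))\<^sup>2) / (b d)\<^sup>2)))
             \<longlongrightarrow> ereal \<sigma>2) (at_right 0)"
proof -
  interpret eig: eigen lam
    using lam_nonneg lam_summable lam_pos by unfold_locales auto
  have M: "real_distribution M" using G_sd by (simp add: self_decomposable_def)
  have lev: "levy_exponent \<sigma>2 L \<nu>"
    using G_levy unfolding levy_triplet_def by unfold_locales auto
  have bp: "b d > 0" for d using b_pos by simp
  define Q where "Q d j = eig.Qa N (b d) j" for d j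
  define A where "A d = a d / b d" for d
  have tailQ: "tailp (Q d j) x = (\<Sum>\<^sub>\<infinity>k\<in>{k. 1 \<le> k \<and> enat k \<le> N}. (if barlam lam j k < exp (- x * b d) then barlam lam j k else 0))"
    if "1 \<le> j" "x > 0" for d j x
    unfolding Q_def by (rule eig.tailp_Qa[OF that(1) bp that(2)])
  interpret NA: null_array \<gamma> \<sigma>2 L \<nu> Q A
  proof (intro null_array.intro lev null_array_axioms.intro)
    show "0 \<le> x" if "x \<in> set_pmf (Q d j)" for d j x using that eig.Qa_nonneg[OF bp] by (simp add: Q_def)
    fix \<tau> e :: real assume \<tau>: "\<tau> > 0" and e: "e > 0"
    let ?m = "\<lambda>d j. \<Sum>\<^sub>\<infinity>k\<in>{1..}. (if barlam lam j k < exp (- \<tau> * b d) then barlam lam j k else 0)"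
    have "(\<lambda>d. Max (?m d ` {1..d})) \<longlonglongrightarrow> 0" using small \<tau> by blast
    from order_tendstoD(2)[OF this e]
    show "\<forall>\<^sub>F d in sequentially. \<forall>j\<in>{1..d}. tailp (Q d j) \<tau> \<le> e"
    proof eventually_elim
      case (elim d)
      show ?case
      proof
        fix j assume j: "j \<in> {1..d}"
        then have j1: "1 \<le> j" by simp
        \<comment> \<open>The smallness hypothesis concerns the full spectrum, which is the case
          \<open>N = \<infinity>\<close>; truncation only lowers the values and hence the
          tails.\<close>
        have "{k::nat. 1 \<le> k \<and> enat k \<le> \<infinity>} = {1..}" by auto
        then have eq: "?m d j = tailp (eig.Qa \<infinity> (b d) j) \<tau>"
          using eig.tailp_Qa[OF j1 bp \<tau>, of \<infinity> d] by simp
        have "tailp (Q d j) \<tau> \<le> tailp (eig.Qa \<infinity> (b d) j) \<tau>"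
          unfolding tailp_def Q_def eig.Qa_def
        proof (simp only: j1 if_True measure_map_pmf, rule measure_pmf.finite_measure_mono_AE)
          show "AE k in measure_pmf (eig.eigp j). k \<in> (\<lambda>k. eig.Yt N j k / b d) -` {\<tau><..} \<longrightarrow> k \<in> (\<lambda>k. eig.Yt \<infinity> j k / b d) -` {\<tau><..}"
            using \<tau> by (intro AE_I2) (auto simp: eig.Yt_def split: if_splits)
        qed simp
        also have "\<dots> = ?m d j" by (rule eq[symmetric])
        also have "\<dots> \<le> Max (?m d ` {1..d})" using j by (intro Max_ge) auto
        finally show "tailp (Q d j) \<tau> \<le> e" using elim by simp
      qed
    qed
  qed
  have charM: "char M t = exp (NA.psi t)" for t
    using G_levy unfolding levy_triplet_def NA.psi_def levy_kernel_def by blast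

  define cx where "cx d \<epsilon> = ln (real (complexity lam d \<epsilon>))" for d \<epsilon>
  define V where "V d = eig.Vd (a d) (b d) d" for d
  have weak: "(\<forall>\<epsilon>\<in>{0<..<1}. (\<lambda>d. cx d \<epsilon> - a d - q \<epsilon> * b d) \<in> o(b)) \<longleftrightarrow> weak_conv_m (\<lambda>d. pmf_law (V d)) M"
  proof (rule quantile_asymptotics_iff_weak_conv[OF b_pos b_lim M real_distribution_pmf_law _ q_def])
    show "cdf M x < cdf M y" if "x < y" "0 < cdf M x" "cdf M x < 1" for x y
      by (rule self_decomposable_cdf_strict[OF G_sd _ that]) (simp add: charM)
    fix d and \<epsilon> y :: real assume \<epsilon>: "0 < \<epsilon>" "\<epsilon> < 1"
    have cV: "cdf (pmf_law (V d)) y = measure (measure_pmf (eig.Pd d)) {\<kappa>. eig.Ud d \<kappa> \<le> a d + y * b d}"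
      unfolding V_def by (rule eig.cdf_Vd[OF bp])
    have pos: "0 < real (complexity lam d \<epsilon>)" using eig.complexity_pos[OF \<epsilon>] by simp
    show "cx d \<epsilon> \<le> a d + y * b d" if "1 - \<epsilon>\<^sup>2 \<le> cdf (pmf_law (V d)) y"
    proof -
      have "real (complexity lam d \<epsilon>) \<le> exp (a d + y * b d)"
        by (rule eig.complexity_le) (use that cV in simp)
      from ln_mono[OF this pos] show ?thesis by (simp only: cx_def ln_exp)
    qed
    have "exp (cx d \<epsilon> - a d - y * b d) = real (complexity lam d \<epsilon>) * exp (- (a d + y * b d))"
    proof -
      have "cx d \<epsilon> - a d - y * b d = cx d \<epsilon> + - (a d + y * b d)" by simp
      then show ?thesis unfolding exp_add using pos by (simp only: exp_add cx_def exp_ln)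
    qed
    then show "1 - \<epsilon>\<^sup>2 \<le> cdf (pmf_law (V d)) y + exp (cx d \<epsilon> - a d - y * b d)"
      using eig.complexity_ge[OF \<epsilon>(1), of d "a d + y * b d"] unfolding cV by simp
  qed
  have "weak_conv_m (\<lambda>d. pmf_law (V d)) M \<longleftrightarrow> (\<forall>t. (\<lambda>d. pchar (V d) t) \<longlonglongrightarrow> exp (NA.psi t))"
    unfolding pchar_eq_char charM[symmetric]
  proof (intro iffI allI)
    show "(\<lambda>d. char (pmf_law (V d)) t) \<longlonglongrightarrow> char M t" if "weak_conv_m (\<lambda>d. pmf_law (V d)) M" for t
      by (rule levy_continuity1[OF real_distribution_pmf_law M that])
    show "weak_conv_m (\<lambda>d. pmf_law (V d)) M" if "\<forall>t. (\<lambda>d. char (pmf_law (V d)) t) \<longlonglongrightarrow> char M t"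
      by (rule levy_continuity[OF real_distribution_pmf_law M that[rule_format]])
  qed
  also have "\<dots> \<longleftrightarrow> (\<forall>t. (\<lambda>d. NA.charS d t) \<longlonglongrightarrow> exp (NA.psi t))"
  proof -
    \<comment> \<open>The full sum and the one truncated at \<open>N\<close> have asymptotically
      equal characteristic functions; this is where the condition on \<open>N\<close>
      enters.\<close>
    have "(\<lambda>d. pchar (V d) t - NA.charS d t) \<longlonglongrightarrow> 0" for t
    proof (rule Lim_null_comparison[OF _ tendsto_norm_zero[OF eig.truncation_negligible[OF b_pos b_lim N_cond, of t]]],
        intro always_eventually allI)
      fix d
      let ?x = "\<Prod>j=1..d. pchar (map_pmf (\<lambda>k. eig.Yv j k / b d) (eig.eigp j)) t"
      let ?y = "\<Prod>j=1..d. pchar (eig.Qa N (b d) j) t"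
      have "- t * A d = t * (- a d / b d)" by (simp add: A_def)
      then have "pchar (V d) t - NA.charS d t = (?x - ?y) * iexp (t * (- a d / b d))"
        unfolding V_def eig.pchar_Vd NA.charS_def Q_def left_diff_distrib by (simp only:)
      then show "norm (pchar (V d) t - NA.charS d t) \<le> norm (?x - ?y)"
        by (simp only: norm_mult norm_exp_i_times mult_1_right order_refl)
    qed
    then show ?thesis by (intro all_cong1 Lim_transform_eq)
  qed
  also have "\<dots> \<longleftrightarrow> (\<forall>x>0. (\<lambda>d. NA.Ft d x) \<longlonglongrightarrow> - L x) \<and> (\<forall>\<tau>>0. (\<lambda>d. NA.Sm d \<tau> - A d) \<longlonglongrightarrow> NA.levy_shift \<tau>)
    \<and> (\<forall>e>0. \<exists>\<tau>0>0. \<forall>\<tau>. 0 < \<tau> \<and> \<tau> < \<tau>0 \<longrightarrow> (\<forall>\<^sub>F d in sequentially. \<bar>NA.Sv d \<tau> - \<sigma>2\<bar> \<le> e))"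
  proof
    assume conv: "\<forall>t. (\<lambda>d. NA.charS d t) \<longlonglongrightarrow> exp (NA.psi t)"
    show "(\<forall>x>0. (\<lambda>d. NA.Ft d x) \<longlonglongrightarrow> - L x) \<and> (\<forall>\<tau>>0. (\<lambda>d. NA.Sm d \<tau> - A d) \<longlonglongrightarrow> NA.levy_shift \<tau>)
      \<and> (\<forall>e>0. \<exists>\<tau>0>0. \<forall>\<tau>. 0 < \<tau> \<and> \<tau> < \<tau>0 \<longrightarrow> (\<forall>\<^sub>F d in sequentially. \<bar>NA.Sv d \<tau> - \<sigma>2\<bar> \<le> e))"
    proof (rule NA.necessity[OF M charM conv[rule_format]])
      fix y :: real
      assume Ft: "\<And>y. y > 0 \<Longrightarrow> isCont L y \<Longrightarrow> (\<lambda>d. NA.Ft d y) \<longlonglongrightarrow> - L y" and y: "y > 0"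
      \<comment> \<open>Unscaled tails: every row is read off the single sequence
        \<open>T j\<close>, evaluated at multiples of \<open>b d\<close>. This common source of the
        rows is what rules out jumps of \<open>L\<close>.\<close>
      define T where "T j s = measure (measure_pmf (eig.eigp j)) {k. s < eig.Yt N j k}" for j s
      have TQ: "T j (x * b d) = tailp (Q d j) x" if "1 \<le> j" for j d x
      proof -
        have "(\<lambda>k. eig.Yt N j k / b d) -` {x<..} = {k. x * b d < eig.Yt N j k}"
          using bp[of d] by (auto simp: less_divide_eq)
        then show ?thesis unfolding T_def tailp_def Q_def eig.Qa_def using that by (simp add: measure_map_pmf)
      qed
      have Tanti: "T j t \<le> T j s" if "s \<le> t" for j s t
        unfolding T_def by (rule measure_pmf.finite_measure_mono) (use that in auto)
      show "isCont L y"
      proof (rule limit_tail_isCont[OF NA.L_mono NA.L_lim bp b_lim, where N="\<lambda>d s. \<Sum>j=1..d. T j s"])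
        show "(\<Sum>j=1..d. T j t) \<le> (\<Sum>j=1..d. T j s)" if "s \<le> t" for d s t
          by (intro sum_mono Tanti that)
        show "(\<Sum>j=1..d. T j s) - (\<Sum>j=1..d. T j t) \<le> (\<Sum>j=1..d'. T j s) - (\<Sum>j=1..d'. T j t)"
          if "d \<le> d'" "s \<le> t" for d d' s t
          unfolding sum_subtractf[symmetric] by (rule sum_mono2) (use that Tanti in auto)
        have "(\<Sum>j=1..d. T j (x * b d)) = NA.Ft d x" for d x
          unfolding NA.Ft_def by (rule sum.cong) (auto simp: TQ)
        then show "(\<lambda>d. \<Sum>j=1..d. T j (x * b d)) \<longlonglongrightarrow> - L x" if "x > 0" "isCont L x" for x
          using Ft[OF that] by simp
        \<comment> \<open>The difference is the tail of the last entry of row \<open>Suc d\<close>,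
          so nullness of the array applies after a shift of the index by one.\<close>
        show "(\<lambda>d. (\<Sum>j=1..Suc d. T j (x * b (Suc d))) - (\<Sum>j=1..d. T j (x * b (Suc d)))) \<longlonglongrightarrow> 0" if x: "x > 0" for x
        proof (rule tendstoI)
          fix e :: real assume "e > 0"
          then have "\<forall>\<^sub>F d in sequentially. \<forall>j\<in>{1..d}. tailp (Q d j) x \<le> e/2" by (intro NA.null x) simp
          then have "\<forall>\<^sub>F d in sequentially. \<forall>j\<in>{1..Suc d}. tailp (Q (Suc d) j) x \<le> e/2"
            unfolding eventually_sequentially_Suc[of "\<lambda>d. \<forall>j\<in>{1..d}. tailp (Q d j) x \<le> e/2"] .
          then show "\<forall>\<^sub>F d in sequentially. dist ((\<Sum>j=1..Suc d. T j (x * b (Suc d))) - (\<Sum>j=1..d. T j (x * b (Suc d)))) 0 < e"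
          proof eventually_elim
            case (elim d)
            have "(\<Sum>j=1..Suc d. T j (x * b (Suc d))) - (\<Sum>j=1..d. T j (x * b (Suc d))) = tailp (Q (Suc d) (Suc d)) x"
              by (simp add: TQ)
            moreover have "tailp (Q (Suc d) (Suc d)) x \<le> e/2" using elim by simp
            moreover have "0 \<le> tailp (Q (Suc d) (Suc d)) x" by (rule tailp_nonneg)
            ultimately show ?case using \<open>e > 0\<close> by (simp only: dist_real_def diff_zero abs_of_nonneg)
          qed
        qed
      qed (rule y)
    qed
  next
    assume h: "(\<forall>x>0. (\<lambda>d. NA.Ft d x) \<longlonglongrightarrow> - L x) \<and> (\<forall>\<tau>>0. (\<lambda>d. NA.Sm d \<tau> - A d) \<longlonglongrightarrow> NA.levy_shift \<tau>)
      \<and> (\<forall>e>0. \<exists>\<tau>0>0. \<forall>\<tau>. 0 < \<tau> \<and> \<tau> < \<tau>0 \<longrightarrow> (\<forall>\<^sub>F d in sequentially. \<bar>NA.Sv d \<tau> - \<sigma>2\<bar> \<le> e))"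
    show "\<forall>t. (\<lambda>d. NA.charS d t) \<longlonglongrightarrow> exp (NA.psi t)"
      using h by (intro allI NA.charS_tendsto) simp_all
  qed
  finally have main: "weak_conv_m (\<lambda>d. pmf_law (V d)) M \<longleftrightarrow>
    (\<forall>x>0. (\<lambda>d. NA.Ft d x) \<longlonglongrightarrow> - L x) \<and> (\<forall>\<tau>>0. (\<lambda>d. NA.Sm d \<tau> - A d) \<longlonglongrightarrow> NA.levy_shift \<tau>)
    \<and> (\<forall>e>0. \<exists>\<tau>0>0. \<forall>\<tau>. 0 < \<tau> \<and> \<tau> < \<tau>0 \<longrightarrow> (\<forall>\<^sub>F d in sequentially. \<bar>NA.Sv d \<tau> - \<sigma>2\<bar> \<le> e))" .

  define X where "X d \<tau> = (\<Sum>j=1..d. Mfun lam 2 N j (\<tau> * b d) - (Mfun lam 1 N j (\<tau> * b d))\<^sup>2) / (b d)\<^sup>2" for d \<tau>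
  have eA: "(\<Sum>j=1..d. \<Sum>\<^sub>\<infinity>k\<in>{k. 1 \<le> k \<and> enat k \<le> N}. (if barlam lam j k < exp (- x * b d) then barlam lam j k else 0)) = NA.Ft d x"
    if "x > 0" for d x
    unfolding NA.Ft_def by (rule sum.cong) (auto simp: tailQ that)
  have eB: "((\<Sum>j=1..d. Mfun lam 1 N j (\<tau> * b d)) - a d) / b d = NA.Sm d \<tau> - A d" if "\<tau> > 0" for d \<tau>
  proof -
    have "NA.Sm d \<tau> = (\<Sum>j=1..d. Mfun lam 1 N j (\<tau> * b d) / b d)"
      unfolding NA.Sm_def Q_def by (rule sum.cong) (auto simp: eig.trm1_Qa bp that)
    then show ?thesis by (simp add: A_def diff_divide_distrib sum_divide_distrib)
  qed
  have eC: "NA.Sv d \<tau> = X d \<tau>" if "\<tau> > 0" for d \<tau>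
  proof -
    have "NA.Sv d \<tau> = (\<Sum>j=1..d. (Mfun lam 2 N j (\<tau> * b d) - (Mfun lam 1 N j (\<tau> * b d))\<^sup>2) / (b d)\<^sup>2)"
      unfolding NA.Sv_def Q_def by (rule sum.cong) (auto simp: eig.trvar_Qa bp that)
    then show ?thesis by (simp only: X_def sum_divide_distrib)
  qed
  have A_iff: "(\<forall>x>0. (\<lambda>d. \<Sum>j=1..d. \<Sum>\<^sub>\<infinity>k\<in>{k. 1 \<le> k \<and> enat k \<le> N}.
      (if barlam lam j k < exp (- x * b d) then barlam lam j k else 0)) \<longlonglongrightarrow> - L x)
    \<longleftrightarrow> (\<forall>x>0. (\<lambda>d. NA.Ft d x) \<longlonglongrightarrow> - L x)"
    by (intro all_cong1 imp_cong refl) (simp only: eA)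
  have B_iff: "(\<forall>\<tau>>0. (\<lambda>d. ((\<Sum>j=1..d. Mfun lam 1 N j (\<tau> * b d)) - a d) / b d)
      \<longlonglongrightarrow> \<gamma> + (LINT x:{0<..\<tau>}|\<nu>. x ^ 3 / (1 + x\<^sup>2)) - (LINT x:{\<tau><..}|\<nu>. x / (1 + x\<^sup>2)))
    \<longleftrightarrow> (\<forall>\<tau>>0. (\<lambda>d. NA.Sm d \<tau> - A d) \<longlonglongrightarrow> NA.levy_shift \<tau>)"
    unfolding NA.levy_shift_def[symmetric] by (intro all_cong1 imp_cong refl) (simp only: eB)
  have C_iff: "((\<lambda>\<tau>. limsup (\<lambda>d. ereal (X d \<tau>))) \<longlongrightarrow> ereal \<sigma>2) (at_right 0)
      \<and> ((\<lambda>\<tau>. liminf (\<lambda>d. ereal (X d \<tau>))) \<longlongrightarrow> ereal \<sigma>2) (at_right 0)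
    \<longleftrightarrow> (\<forall>e>0. \<exists>\<tau>0>0. \<forall>\<tau>. 0 < \<tau> \<and> \<tau> < \<tau>0 \<longrightarrow> (\<forall>\<^sub>F d in sequentially. \<bar>NA.Sv d \<tau> - \<sigma>2\<bar> \<le> e))"
    unfolding limsup_liminf_tendsto_iff
    by (intro all_cong1 imp_cong refl ex_cong1 conj_cong) (simp only: eC)
  show ?thesis
    unfolding A_iff B_iff X_def[symmetric] C_iff main[symmetric] weak[symmetric] cx_def ..
qed

end
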